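(* Let $n\ge 1$, $N\ge 0$ be integers. For $k\in[0,N]_{\mathbb Z}$ let $\mathcal S_k:\mathbb R\to\mathbb R^{2n\times 2n}$ be $C_p^1$ (continuous with piecewise continuous derivative) with $\mathcal S_k(\lambda)$ symplectic and $\Psi(\mathcal S_k(\lambda))\ge 0$ for all $\lambda\in\mathbb R$. Let $\sigma$ be the set of finite eigenvalues of the Dirichlet problem $y_{k+1}(\lambda)=\mathcal S_k(\lambda)y_k(\lambda)$, $x_0(\lambda)=0=x_{N+1}(\lambda)$. Then, for any $a<b$, the condition $$\rho_k(\lambda):=\operatorname{rank}(\mathcal S_k(a)-\mathcal S_k(\lambda^-))-\operatorname{rank}(\mathcal S_k(a)-\mathcal S_k(\lambda))=0,\quad \lambda\in(a,b],\ k\in[0,N]_{\mathbb Z},\qquad( * )$$ is necessary and sufficient for $$L_d^*\big((Z^{[0]}(a))^{-1}Y^{[N+1]}(b),0,N+1\big)=L_d\big((Z^{[N+1]}(a))^{-1}Y^{[0]}(b),0,N+1\big)=\#\{\nu\in\sigma\mid a<\nu\le b\}.$$ Similarly, condition $( * )$ is necessary and sufficient for the representations $$\sum_{a<\nu\le b}n_{Z^{[l]}(a)}(\nu)=\sum_{k=0}^N\mu(\langle\tilde{\mathcal S}_k(b)\rangle,\langle I\rangle)\le n(N+1),\qquad l\in\{0,N+1\},$$ where $\tilde{\mathcal S}_k(\lambda)=(Z_{k+1}^{[l]}(a))^{-1}\mathcal S_k(\lambda)Z_k^{[l]}(a)$.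
   Context: Notation: $[M,N]_{\mathbb Z}=[M,N]\cap\mathbb Z$; $\mathcal J=\begin{pmatrix}0&I\\ -I&0\end{pmatrix}$ (of the appropriate size); $S\in\mathbb R^{2n\times2n}$ is symplectic if $S^T\mathcal JS=\mathcal J$; $A^\dagger$ is the Moore-Penrose inverse; $\operatorname{ind}A$ is the number of negative eigenvalues of a symmetric matrix $A$; $A\ge0$ means symmetric nonnegative definite; $\operatorname{rank}A(\lambda^-)$ is the left-hand limit of $\operatorname{rank}A(\cdot)$ at $\lambda$ (all such limits used here exist under the hypotheses). For a symplectic $C^1_p$ function $S(\lambda)$ put $\Psi(S(\lambda))=\mathcal J^T\dot S(\lambda)S^{-1}(\lambda)$ (a symmetric matrix), $\dot{}=d/d\lambda$. A solution has the form $y_k=\binom{x_k}{u_k}$ with $x_k,u_k\in\mathbb R^n$. For $l\in\{0,N+1\}$, $Z_k^{[l]}(\lambda)$ is the symplectic fundamental matrix of $y_{k+1}=\mathcal S_k(\lambda)y_k$ with $Z_l^{[l]}(\lambda)=I$, and $Y_k^{[l]}(\lambda)=Z_k^{[l]}(\lambda)\binom0I=\binom{X_k^{[l]}(\lambda)}{U_k^{[l]}(\lambda)}$ is the principal solution at $l$. A number $\lambda_0$ is a finite eigenvalue of the Dirichlet problem if $\theta(\lambda_0):=\operatorname{rank}X^{[0]}_{N+1}(\lambda_0^-)-\operatorname{rank}X^{[0]}_{N+1}(\lambda_0)\ge1$; $\#\{\nu\in\sigma\mid\dots\}$ counts finite eigenvalues with multiplicity $\theta$. Comparative index. For real $2m\times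 m$ matrices $Y=\binom XU$, $\hat Y=\binom{\hat X}{\hat U}$ of rank $m$ with $X^TU$, $\hat X^T\hat U$ symmetric, $\mu(Y,\hat Y)=\operatorname{rank}\mathcal M+\operatorname{ind}\mathcal D$, where $\mathcal M=(I-XX^\dagger)\hat X$, $\mathcal T=I-\mathcal M^\dagger\mathcal M$, $\mathcal D=\mathcal T\,w^T(Y,\hat Y)X^\dagger\hat X\,\mathcal T$, $w(Y,\hat Y)=Y^T\mathcal J\hat Y$. For a symplectic $S=\begin{pmatrix}A&B\\ C&D\end{pmatrix}\in\mathbb R^{2n\times2n}$ let $\langle S\rangle=\binom{\mathcal X}{\mathcal U}\in\mathbb R^{4n\times2n}$ with $\mathcal X=\begin{pmatrix}I&0\\ A&B\end{pmatrix}$, $\mathcal U=\begin{pmatrix}0&-I\\ C&D\end{pmatrix}$; then $\mu(\langle S\rangle,\langle\hat S\rangle)$ is defined with $m=2n$. For sequences of symplectic matrices $Z_k,\hat Z_k$, $k\in[0,N+1]_{\mathbb Z}$, with $Y_k=Z_k\binom0I$, $\hat Y_k=\hat Z_k\binom0I$, put $$L_d(\hat Z^{-1}Y,0,N+1)=\sum_{k=0}^N\mu(\langle\hat Z_{k+1}^{-1}Z_{k+1}\rangle,\langle\hat Z_k^{-1}Z_k\rangle),\qquad L_d^*(Z^{-1}\hat Y,0,N+1)=\sum_{k=0}^N\mu(\langle\hat Z_{k}^{-1}Z_{k}\rangle,\langle\hat Z_{k+1}^{-1}Z_{k+1}\rangle).$$ Thus in $L_d((Z^{[N+1]}(a))^{-1}Y^{[0]}(b),0,N+1)$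 one takes $\hat Z_k=Z_k^{[N+1]}(a)$, $Z_k=Z_k^{[0]}(b)$, and in $L_d^*((Z^{[0]}(a))^{-1}Y^{[N+1]}(b),0,N+1)$ one takes $Z_k=Z_k^{[0]}(a)$, $\hat Z_k=Z_k^{[N+1]}(b)$. For fixed $l$, with $\tilde{\mathcal B}_k(\lambda)$ the upper right $n\times n$ block of $\tilde{\mathcal S}_k(\lambda)=(Z_{k+1}^{[l]}(a))^{-1}\mathcal S_k(\lambda)Z_k^{[l]}(a)$, put $n_{Z^{[l]}(a)}(\lambda)=\sum_{k=0}^N\big(\operatorname{rank}\tilde{\mathcal B}_k(\lambda^-)-\operatorname{rank}\tilde{\mathcal B}_k(\lambda)\big)$. *)

theory Defs
  imports "HOL-Analysis.Analysis"
begin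

section \<open>Block matrices\<close>

text \<open>
  A matrix of size \<open>2n \<times> 2n\<close> is indexed by the sum type \<open>'n + 'n\<close>; \<open>Inl\<close> addresses the first
  \<open>n\<close> coordinates, \<open>Inr\<close> the last \<open>n\<close> ones.
\<close>

definition block :: "real^'c^'r \<Rightarrow> real^'d^'r \<Rightarrow> real^'c^'s \<Rightarrow> real^'d^'s \<Rightarrow> real^('c::finite + 'd::finite)^('r::finite + 's::finite)"
  where "block A B C D = (\<chi> i j.
    case i of
      Inl r \<Rightarrow> (case j of Inl c \<Rightarrow> A $ r $ c | Inr d \<Rightarrow> B $ r $ d)
    | Inr s \<Rightarrow> (case j of Inl c \<Rightarrow> C $ s $ c | Inr d \<Rightarrow> D $ s $ d))"

definition vstack :: "real^'c^'r \<Rightarrow> real^'c^'s \<Rightarrow> real^'c^('r::finite + 's::finite)"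
  where "vstack X U = (\<chi> i j. case i of Inl r \<Rightarrow> X $ r $ j | Inr s \<Rightarrow> U $ s $ j)"

definition upper :: "real^'c^('r::finite + 's::finite) \<Rightarrow> real^'c^'r"
  where "upper Y = (\<chi> i j. Y $ Inl i $ j)"

definition block11 :: "real^('c::finite + 'd::finite)^('r::finite + 's::finite) \<Rightarrow> real^'c^'r"
  where "block11 M = (\<chi> i j. M $ Inl i $ Inl j)"

definition block12 :: "real^('c::finite + 'd::finite)^('r::finite + 's::finite) \<Rightarrow> real^'d^'r"
  where "block12 M = (\<chi> i j. M $ Inl i $ Inr j)"

definition block21 :: "real^('c::finite + 'd::finite)^('r::finite + 's::finite) \<Rightarrow> real^'c^'s"
  where "block21 M = (\<chi> i j. M $ Inr i $ Inl j)"

definition block22 :: "real^('c::finite + 'd::finite)^('r::finite + 's::finite) \<Rightarrow> real^'d^'s"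
  where "block22 M = (\<chi> i j. M $ Inr i $ Inr j)"

section \<open>Linear algebra\<close>

definition J_mat :: "real^('m::finite + 'm)^('m + 'm)"
  where "J_mat = block 0 (mat 1) (- mat 1) 0"

definition symplectic :: "real^('n::finite + 'n)^('n + 'n) \<Rightarrow> bool"
  where "symplectic S \<longleftrightarrow> transpose S ** J_mat ** S = J_mat"

definition nonneg_definite :: "real^'n^'n \<Rightarrow> bool"
  where "nonneg_definite A \<longleftrightarrow> transpose A = A \<and> (\<forall>v. 0 \<le> v \<bullet> (A *v v))"

text \<open>The Moore-Penrose inverse is the unique solution of the four Penrose equations.\<close>

definition mp_inverse :: "real^'n^'m \<Rightarrow> real^'m^'n"
  where "mp_inverse A = (THE G.
    A ** G ** A = A \<and> G ** A ** G = G \<and>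
    transpose (A ** G) = A ** G \<and> transpose (G ** A) = G ** A)"

text \<open>
  Number of negative eigenvalues, counted with multiplicity. It is applied to symmetric matrices
  only, for which the dimension of the eigenspace is the (geometric and algebraic) multiplicity.
\<close>

definition neg_index :: "real^'n^'n \<Rightarrow> nat"
  where "neg_index A =
    (\<Sum>x\<in>{x. x < 0 \<and> (\<exists>v. v \<noteq> 0 \<and> A *v v = x *\<^sub>R v)}. dim {v. A *v v = x *\<^sub>R v})"

section \<open>Piecewise continuously differentiable functions\<close>

text \<open>
  The exceptional set \<open>P\<close> is locally finite, and the derivative has finite one-sided limits at its
  points. (The library's \<open>piecewise_C1_differentiable_on\<close> would allow the derivative to be
  unbounded near exceptional points.)
\<close>

definition C1p :: "(real \<Rightarrow> 'a::real_normed_vector) \<Rightarrow> bool"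
  where "C1p f \<longleftrightarrow> continuous_on UNIV f \<and>
    (\<exists>f' P. (\<forall>c d. finite (P \<inter> {c..d})) \<and>
      (\<forall>t. t \<notin> P \<longrightarrow> (f has_vector_derivative f' t) (at t) \<and> isCont f' t) \<and>
      (\<forall>t\<in>P. (\<exists>l. (f' \<longlongrightarrow> l) (at_left t)) \<and> (\<exists>r. (f' \<longlongrightarrow> r) (at_right t))))"

definition Psi :: "(real \<Rightarrow> real^('n::finite + 'n)^('n + 'n)) \<Rightarrow> real \<Rightarrow> real^('n + 'n)^('n + 'n)"
  where "Psi S \<tau> = transpose J_mat ** vector_derivative S (at \<tau>) ** matrix_inv (S \<tau>)"

text \<open>
  The derivative is required to satisfy the inequality wherever it exists. For a \<open>C1p\<close> function this
  is the same as requiring it, at every point, of both one-sided derivatives, since these are limits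
  of derivatives at nearby points.
\<close>

definition Psi_nonneg :: "(real \<Rightarrow> real^('n::finite + 'n)^('n + 'n)) \<Rightarrow> bool"
  where "Psi_nonneg S \<longleftrightarrow> (\<forall>\<tau>. S differentiable (at \<tau>) \<longrightarrow> nonneg_definite (Psi S \<tau>))"

section \<open>Comparative index\<close>

definition comp_index :: "real^'m^('m::finite + 'm) \<Rightarrow> real^'m^('m + 'm) \<Rightarrow> nat"
  where "comp_index Y Y' =
    (let X = upper Y; X' = upper Y';
         M = (mat 1 - X ** mp_inverse X) ** X';
         T = mat 1 - mp_inverse M ** M;
         w = transpose Y ** J_mat ** Y';
         D = T ** transpose w ** mp_inverse X ** X' ** T
     in rank M + neg_index D)"

definition bracket :: "real^('n::finite + 'n)^('n + 'n) \<Rightarrow> real^('n + 'n)^(('n + 'n) + ('n + 'n))"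
  where "bracket S =
    vstack (block (mat 1) 0 (block11 S) (block12 S)) (block 0 (- mat 1) (block21 S) (block22 S))"

text \<open>
  \<open>Ld Z' Z N\<close> stands for \<open>L\<^sub>d(Z'\<inverse>Y, 0, N+1)\<close> and \<open>Ld_star Z Z' N\<close> for \<open>L\<^sub>d\<^sup>*(Z\<inverse>Y', 0, N+1)\<close>,
  where \<open>Y\<close>, \<open>Y'\<close> consist of the last \<open>n\<close> columns of \<open>Z\<close>, \<open>Z'\<close>. In both, the comparative indices
  are formed from \<open>Z'\<inverse> Z\<close>.
\<close>

definition Ld :: "(nat \<Rightarrow> real^('n::finite + 'n)^('n + 'n)) \<Rightarrow>
    (nat \<Rightarrow> real^('n + 'n)^('n + 'n)) \<Rightarrow> nat \<Rightarrow> nat"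
  where "Ld Z' Z N =
    (\<Sum>k\<le>N. comp_index (bracket (matrix_inv (Z' (Suc k)) ** Z (Suc k)))
                       (bracket (matrix_inv (Z' k) ** Z k)))"

definition Ld_star :: "(nat \<Rightarrow> real^('n::finite + 'n)^('n + 'n)) \<Rightarrow>
    (nat \<Rightarrow> real^('n + 'n)^('n + 'n)) \<Rightarrow> nat \<Rightarrow> nat"
  where "Ld_star Z Z' N =
    (\<Sum>k\<le>N. comp_index (bracket (matrix_inv (Z' k) ** Z k))
                       (bracket (matrix_inv (Z' (Suc k)) ** Z (Suc k))))"

section \<open>Symplectic systems\<close>

primrec fund0 :: "(nat \<Rightarrow> real \<Rightarrow> real^('n::finite + 'n)^('n + 'n)) \<Rightarrow> real \<Rightarrow> nat \<Rightarrow>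
    real^('n + 'n)^('n + 'n)"
  where
    "fund0 S \<tau> 0 = mat 1"
  | "fund0 S \<tau> (Suc k) = S k \<tau> ** fund0 S \<tau> k"

text \<open>\<open>fund S l \<tau> k\<close> is the fundamental matrix \<open>Z\<^sub>k\<close> normalised by \<open>Z\<^sub>l = I\<close>; see the lemmas below.\<close>

definition fund :: "(nat \<Rightarrow> real \<Rightarrow> real^('n::finite + 'n)^('n + 'n)) \<Rightarrow> nat \<Rightarrow> real \<Rightarrow> nat \<Rightarrow>
    real^('n + 'n)^('n + 'n)"
  where "fund S l \<tau> k = fund0 S \<tau> k ** matrix_inv (fund0 S \<tau> l)"

lemma fund_Suc: "fund S l \<tau> (Suc k) = S k \<tau> ** fund S l \<tau> k"
  by (simp add: fund_def matrix_mul_assoc)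

lemma J_mat_square: "(J_mat :: real^('m::finite + 'm)^('m + 'm)) ** J_mat = - mat 1"
proof -
  have "((J_mat :: real^('m + 'm)^('m + 'm)) ** J_mat) $ i $ j = (- mat 1) $ i $ j" for i j
    by (cases i; cases j)
      (simp_all add: matrix_matrix_mult_def J_mat_def block_def mat_def UNIV_Plus_UNIV[symmetric]
        sum.Plus if_distrib[where f = "\<lambda>x. x * _"] sum_negf del: UNIV_Plus_UNIV cong: if_cong)
  then show ?thesis by (simp add: vec_eq_iff)
qed

lemma symplectic_imp_invertible:
  fixes S :: "real^('n::finite + 'n)^('n + 'n)"
  assumes "symplectic S"
  shows "invertible S"
proof -
  have "(- J_mat :: real^('n + 'n)^('n + 'n)) ** J_mat = mat 1"
    using J_mat_square[where 'm = 'n] by (simp add: vec_eq_iff matrix_matrix_mult_def sum_negf)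
  then have "(- J_mat ** transpose S ** J_mat) ** S = mat 1"
    using assms by (simp add: symplectic_def matrix_mul_assoc[symmetric])
  then show ?thesis
    by (auto simp: invertible_def matrix_left_right_inverse)
qed

lemma fund_same:
  assumes "\<And>k. k < l \<Longrightarrow> symplectic (S k \<tau>)"
  shows "fund S l \<tau> l = mat 1"
proof -
  have "invertible (fund0 S \<tau> l)"
    using assms
  proof (induction l)
    case 0
    then show ?case by (auto simp: invertible_def)
  next
    case (Suc l)
    then show ?case by (simp add: invertible_mult symplectic_imp_invertible)
  qed
  then show ?thesis
    unfolding fund_def matrix_inv_def invertible_def
    by (rule conjunct1[OF someI_ex])
qed

definition principal :: "(nat \<Rightarrow> real \<Rightarrow> real^('n::finite + 'n)^('n + 'n)) \<Rightarrow> nat \<Rightarrow> real \<Rightarrow> nat \<Rightarrow>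
    real^'n^('n + 'n)"
  where "principal S l \<tau> k = fund S l \<tau> k ** vstack 0 (mat 1)"

text \<open>Left-hand limit of the rank, taken in the discrete space \<^typ>\<open>nat\<close>.\<close>

definition rank_left :: "(real \<Rightarrow> real^'c^'r) \<Rightarrow> real \<Rightarrow> nat"
  where "rank_left A \<tau> = Lim (at_left \<tau>) (\<lambda>t. rank (A t))"

definition rank_drop :: "(real \<Rightarrow> real^'c^'r) \<Rightarrow> real \<Rightarrow> int"
  where "rank_drop A \<tau> = int (rank_left A \<tau>) - int (rank (A \<tau>))"

text \<open>Finite eigenvalues of the Dirichlet problem and their multiplicities.\<close>

definition eig_mult :: "(nat \<Rightarrow> real \<Rightarrow> real^('n::finite + 'n)^('n + 'n)) \<Rightarrow> nat \<Rightarrow> real \<Rightarrow> int"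
  where "eig_mult S N \<tau> = rank_drop (\<lambda>t. upper (principal S 0 t (Suc N))) \<tau>"

definition finite_eigs :: "(nat \<Rightarrow> real \<Rightarrow> real^('n::finite + 'n)^('n + 'n)) \<Rightarrow> nat \<Rightarrow> real set"
  where "finite_eigs S N = {\<tau>. 1 \<le> eig_mult S N \<tau>}"

text \<open>
  The index sets of this sum and of the one in \<open>focal_sum\<close> are finite for the systems under
  consideration, as the ranks involved are piecewise constant in \<open>\<tau>\<close>.
\<close>

definition eig_count :: "(nat \<Rightarrow> real \<Rightarrow> real^('n::finite + 'n)^('n + 'n)) \<Rightarrow> nat \<Rightarrow>
    real \<Rightarrow> real \<Rightarrow> int"
  where "eig_count S N a b = (\<Sum>\<nu>\<in>{\<nu> \<in> finite_eigs S N. a < \<nu> \<and> \<nu> \<le> b}. eig_mult S N \<nu>)"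

definition transformed :: "(nat \<Rightarrow> real \<Rightarrow> real^('n::finite + 'n)^('n + 'n)) \<Rightarrow> nat \<Rightarrow> real \<Rightarrow>
    nat \<Rightarrow> real \<Rightarrow> real^('n + 'n)^('n + 'n)"
  where "transformed S l a k \<tau> = matrix_inv (fund S l a (Suc k)) ** S k \<tau> ** fund S l a k"

definition n_Z :: "(nat \<Rightarrow> real \<Rightarrow> real^('n::finite + 'n)^('n + 'n)) \<Rightarrow> nat \<Rightarrow> nat \<Rightarrow>
    real \<Rightarrow> real \<Rightarrow> int"
  where "n_Z S N l a \<tau> = (\<Sum>k\<le>N. rank_drop (\<lambda>t. block12 (transformed S l a k t)) \<tau>)"

definition focal_sum :: "(nat \<Rightarrow> real \<Rightarrow> real^('n::finite + 'n)^('n + 'n)) \<Rightarrow> nat \<Rightarrow> nat \<Rightarrow>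
    real \<Rightarrow> real \<Rightarrow> int"
  where "focal_sum S N l a b = (\<Sum>\<nu>\<in>{\<nu>. a < \<nu> \<and> \<nu> \<le> b \<and> n_Z S N l a \<nu> \<noteq> 0}. n_Z S N l a \<nu>)"

definition comp_sum :: "(nat \<Rightarrow> real \<Rightarrow> real^('n::finite + 'n)^('n + 'n)) \<Rightarrow> nat \<Rightarrow> nat \<Rightarrow>
    real \<Rightarrow> real \<Rightarrow> nat"
  where "comp_sum S N l a b =
    (\<Sum>k\<le>N. comp_index (bracket (transformed S l a k b)) (bracket (mat 1)))"

definition rho :: "(nat \<Rightarrow> real \<Rightarrow> real^('n::finite + 'n)^('n + 'n)) \<Rightarrow> real \<Rightarrow> nat \<Rightarrow> real \<Rightarrow> int"
  where "rho S a k \<tau> = rank_drop (\<lambda>t. S k a - S k t) \<tau>"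

end

theory Submission
  imports Defs
begin

text \<open>
  All equalities of the theorem have the same defect. Let \<open>\<delta>\<close> be the sum of all \<open>rho S a k \<tau>\<close> with
  \<open>k \<le> N\<close> and \<open>a < \<tau> \<le> b\<close>. Then \<open>eig_count - Ld\<close>, \<open>eig_count - Ld_star\<close> and, for both \<open>l\<close>,
  \<open>focal_sum - comp_sum\<close> are equal to \<open>\<delta>\<close>. As every summand of \<open>\<delta>\<close> is nonnegative, each equality
  holds if and only if all of them vanish. The bound on \<open>comp_sum\<close> comes from
  \<open>comp_index_le_rank\<close>.

  The source of the defect is geometric. The graph of a symplectic matrix \<open>Z\<close> is a Lagrangian
  subspace, framed by \<open>bracket Z\<close>. Along a path \<open>Z(\<tau>)\<close> the rank of the upper right block drops when
  the graph gains an intersection with the vertical subspace, and \<open>rank (M - Z(\<tau>))\<close> drops when it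
  gains one with the graph of \<open>M\<close>. In a suitable chart the vertical subspace, the graph of \<open>M\<close> and
  the graph of \<open>Z(\<tau>)\<close> are the graphs of symmetric matrices \<open>0\<close>, \<open>P\<close> and \<open>Q(\<tau>)\<close>. The condition on
  \<open>Psi\<close> says that \<open>Q\<close> is nondecreasing, so its eigenvalues cross zero upwards only, and both kinds of
  crossings are counted by losses of negative eigenvalues of \<open>Q\<close> and of \<open>Q - P\<close>
  (\<open>chart_jumps\<close>). The comparative index of the two graphs is \<open>n(Q - P) + n(P) - n(Q)\<close> with \<open>n\<close> the
  number of negative eigenvalues (\<open>comp_index_chart\<close>), so its variation is the difference of the two
  crossing numbers (\<open>crossing_formula\<close>). With \<open>M = Z(a)\<close> the second crossing number is the sum of the
  drops of \<open>rank (Z(a) - Z(\<tau>))\<close>. Applied to each transformed coefficient, this is the statement on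
  \<open>focal_sum\<close>.

  The formula for the comparative index in a chart is obtained by evaluating the inertia of
  Kashiwara's form of three Lagrangian subspaces in two ways: it is a bordered form, which gives the
  definition of the comparative index plus a rank (\<open>comp_index_plus_rank\<close>), and in a chart a linear
  substitution splits it into three symmetric matrices.

  Finite eigenvalues are the crossings of the graph of the product \<open>S\<^sub>N(\<tau>) \<dots> S\<^sub>0(\<tau>)\<close> with the vertical
  subspace. Locally a crossing number is the difference of a potential, namely of minus the
  inertia of \<open>Q\<close>; hence it does not change when the path is deformed with fixed ends
  (\<open>rectangle_jumps\<close>). So the factors may be moved from \<open>a\<close> to \<open>b\<close> one at a time
  (\<open>staircase_jumps\<close>), and each step is an instance of the crossing formula. Moving them in the
  order \<open>0, \<dots>, N\<close> produces \<open>Ld\<close>, and the reverse order produces \<open>Ld_star\<close>.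
\<close>

section \<open>Negative subspaces of symmetric bilinear forms\<close>

definition neg_def_on :: "('v::euclidean_space \<Rightarrow> real) \<Rightarrow> 'v set \<Rightarrow> bool"
  where "neg_def_on q W \<longleftrightarrow> (\<forall>v\<in>W. v \<noteq> 0 \<longrightarrow> q v < 0)"

text \<open>
  The number of negative squares of a quadratic function on a subspace. Working with subspaces
  instead of eigenvalues makes the count additive and invariant under linear substitutions
  without diagonalising anything.
\<close>

definition neg_dim :: "('v::euclidean_space \<Rightarrow> real) \<Rightarrow> 'v set \<Rightarrow> nat"
  where "neg_dim q S = Max {dim W | W. subspace W \<and> W \<subseteq> S \<and> neg_def_on q W}"

lemma finite_dims: "finite {dim W | W :: 'v::euclidean_space set. P W}"
  by (rule finite_subset[of _ "{..DIM('v)}"]) (auto simp: dim_subset_UNIV)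

lemma dim_le_neg_dim:
  assumes "subspace W" "W \<subseteq> S" "neg_def_on q W"
  shows "dim W \<le> neg_dim q S"
  unfolding neg_dim_def using assms by (intro Max_ge finite_dims) auto

lemma neg_dim_attained:
  fixes q :: "'v::euclidean_space \<Rightarrow> real"
  assumes "subspace S"
  obtains W where "subspace W" "W \<subseteq> S" "neg_def_on q W" "dim W = neg_dim q S"
proof -
  have "neg_dim q S \<in> {dim W | W. subspace W \<and> W \<subseteq> S \<and> neg_def_on q W}"
    unfolding neg_dim_def
    by (intro Max_in finite_dims)
      (use subspace_single_0 subspace_0[OF assms] in \<open>auto simp: neg_def_on_def intro!: exI[of _ "{0}"]\<close>)
  then show ?thesis using that by auto
qed

lemma neg_dim_eqI:
  assumes "subspace S" "subspace W" "W \<subseteq> S" "neg_def_on q W" "dim W = d"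
    and "\<And>V. subspace V \<Longrightarrow> V \<subseteq> S \<Longrightarrow> neg_def_on q V \<Longrightarrow> dim V \<le> d"
  shows "neg_dim q S = d"
proof -
  obtain V where V: "subspace V" "V \<subseteq> S" "neg_def_on q V" "dim V = neg_dim q S"
    using neg_dim_attained[OF assms(1)] by blast
  then have "neg_dim q S \<le> d" using assms(6) by force
  moreover have "d \<le> neg_dim q S" using dim_le_neg_dim[of W S q] assms by simp
  ultimately show ?thesis by simp
qed

lemma inj_on_linear_subspaceI:
  assumes "linear g" "subspace S" "\<And>x. x \<in> S \<Longrightarrow> g x = 0 \<Longrightarrow> x = 0"
  shows "inj_on g S"
  using assms by (metis linear_inj_on_iff_eq_0 span_eq_iff)

text \<open>
  A substitution need not be injective: a negative subspace meets the kernel only in \<open>0\<close>, and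
  every negative subspace of the image lifts through a linear section. Hence degenerate
  directions may be added or removed freely.
\<close>

lemma neg_dim_image:
  fixes g :: "'v::euclidean_space \<Rightarrow> 'w::euclidean_space"
  assumes g: "linear g" and S: "subspace S"
    and q: "\<And>x. x \<in> S \<Longrightarrow> q1 x = q2 (g x)" and q0: "q2 0 = 0"
  shows "neg_dim q1 S = neg_dim q2 (g ` S)"
proof (rule antisym)
  obtain W where W: "subspace W" "W \<subseteq> S" "neg_def_on q1 W" "dim W = neg_dim q1 S"
    using neg_dim_attained[OF S] by blast
  have inj: "inj_on g W"
    by (rule inj_on_linear_subspaceI[OF g W(1)]) (use W q q0 in \<open>force simp: neg_def_on_def\<close>)
  have "dim (g ` W) = dim W"
    by (rule dim_image_eq[OF g]) (use inj W(1) in \<open>metis span_eq_iff\<close>)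
  moreover have "dim (g ` W) \<le> neg_dim q2 (g ` S)"
    using W q linear_0[OF g]
    by (intro dim_le_neg_dim linear_subspace_image g) (force simp: neg_def_on_def)+
  ultimately show "neg_dim q1 S \<le> neg_dim q2 (g ` S)" using W by simp
next
  obtain W where W: "subspace W" "W \<subseteq> g ` S" "neg_def_on q2 W" "dim W = neg_dim q2 (g ` S)"
    using neg_dim_attained[OF linear_subspace_image[OF g S]] by blast
  obtain h where h: "range h \<subseteq> S" "linear h" "\<And>v. v \<in> g ` S \<Longrightarrow> g (h v) = v"
    using linear_exists_right_inverse_on[OF g S] by blast
  have inj: "inj_on h W"
    by (rule inj_on_inverseI[of _ g]) (use h W in auto)
  have "dim (h ` W) = dim W"
    by (rule dim_image_eq[OF h(2)]) (use inj W(1) in \<open>metis span_eq_iff\<close>)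
  moreover have "dim (h ` W) \<le> neg_dim q1 S"
  proof (intro dim_le_neg_dim linear_subspace_image h W)
    show "h ` W \<subseteq> S" using h by auto
    show "neg_def_on q1 (h ` W)"
      unfolding neg_def_on_def
    proof safe
      fix v assume v: "v \<in> W" "h v \<noteq> 0"
      then have "v \<noteq> 0" using linear_0[OF h(2)] by auto
      moreover have "q1 (h v) = q2 (g (h v))" by (rule q) (use h in auto)
      ultimately show "q1 (h v) < 0" using v W h(3)[of v] by (auto simp: neg_def_on_def)
    qed
  qed
  ultimately show "neg_dim q2 (g ` S) \<le> neg_dim q1 S" using W by simp
qed

definition symmetric_bilinear :: "('v::euclidean_space \<Rightarrow> 'v \<Rightarrow> real) \<Rightarrow> bool"
  where "symmetric_bilinear B \<longleftrightarrow> (\<forall>y. linear (\<lambda>x. B x y)) \<and> (\<forall>x y. B x y = B y x)"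

context
  fixes B :: "'v::euclidean_space \<Rightarrow> 'v \<Rightarrow> real"
  assumes B: "symmetric_bilinear B"
begin

lemma symmetric_bilinear_sym: "B x y = B y x"
  using B by (simp add: symmetric_bilinear_def)

lemma symmetric_bilinear_simps:
  "B (x + y) z = B x z + B y z" "B z (x + y) = B z x + B z y"
  "B (x - y) z = B x z - B y z" "B z (x - y) = B z x - B z y"
  "B (r *\<^sub>R x) z = r * B x z" "B z (r *\<^sub>R x) = r * B z x"
  "B 0 z = 0" "B z 0 = 0"
proof -
  have l: "linear (\<lambda>x. B x z)" for z using B by (simp add: symmetric_bilinear_def)
  show 1: "B (x + y) z = B x z + B y z" "B (x - y) z = B x z - B y z" 
    "B (r *\<^sub>R x) z = r * B x z" "B 0 z = 0" for x y z r
    using linear_add[OF l, of x y z] linear_diff[OF l, of x y z] linear_scale[OF l, of r x z] 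
      linear_0[OF l, of z] by simp_all
  show "B z (x + y) = B z x + B z y" "B z (x - y) = B z x - B z y"
     "B z (r *\<^sub>R x) = r * B z x" "B z 0 = 0"
    using 1 by (simp_all add: symmetric_bilinear_sym[of z])
qed

text \<open>
  Orthogonality to \<open>W\<close> amounts to \<open>dim W\<close> linear equations, also for a degenerate form.
\<close>

lemma dim_orthogonal_ge:
  fixes W :: "'v set"
  assumes S: "subspace S" and W: "subspace W"
  shows "subspace {v\<in>S. \<forall>w\<in>W. B v w = 0}"
    and "dim S \<le> dim {v\<in>S. \<forall>w\<in>W. B v w = 0} + dim W"
proof -
  let ?C = "{v\<in>S. \<forall>w\<in>W. B v w = 0}"
  show C: "subspace ?C"
    using S by (auto simp: subspace_def symmetric_bilinear_simps)
  obtain E where E: "E \<subseteq> W" "pairwise orthogonal E" "\<And>x. x \<in> E \<Longrightarrow> norm x = 1"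
    "independent E" "card E = dim W" "span E = W"
    using orthonormal_basis_subspace[OF W] by blast
  then have finE: "finite E" by (simp add: independent_imp_finite)
  define L where "L v = (\<Sum>e\<in>E. B v e *\<^sub>R e)" for v
  have L: "linear L"
    by (rule linearI) (auto simp: L_def symmetric_bilinear_simps scaleR_add_left sum.distrib scaleR_sum_right)
  obtain h where h: "range h \<subseteq> S" "linear h" "\<And>v. v \<in> L ` S \<Longrightarrow> L (h v) = v"
    using linear_exists_right_inverse_on[OF L S] by blast
  have LW: "L ` S \<subseteq> W"
    unfolding L_def using E W by (auto intro!: subspace_sum subspace_scale)
  have ker: "v \<in> ?C" if "v \<in> S" "L v = 0" for v
  proof -
    have "B v e = 0" if "e \<in> E" for e
      using E(4) that \<open>L v = 0\<close> finE unfolding L_def independent_explicit by auto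
    then have "span E \<subseteq> {w. B v w = 0}"
      by (intro span_minimal) (auto simp: subspace_def symmetric_bilinear_simps)
    then show ?thesis using that E by auto
  qed
  have "S \<subseteq> {x + y |x y. x \<in> ?C \<and> y \<in> h ` L ` S}"
  proof
    fix v assume v: "v \<in> S"
    have "h (L v) \<in> S" using h by auto
    moreover have "L (v - h (L v)) = 0" using h(3)[of "L v"] v by (simp add: linear_diff[OF L])
    ultimately have "v - h (L v) \<in> ?C" by (intro ker subspace_diff S v) auto
    then show "v \<in> {x + y |x y. x \<in> ?C \<and> y \<in> h ` L ` S}"
      using v by (intro CollectI exI[of _ "v - h (L v)"] exI[of _ "h (L v)"]) auto
  qed
  then have "dim S \<le> dim {x + y |x y. x \<in> ?C \<and> y \<in> h ` L ` S}" by (rule dim_subset)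
  also have "\<dots> \<le> dim ?C + dim (h ` L ` S)"
    using dim_sums_Int[OF C, of "h ` L ` S"] by (simp add: linear_subspace_image L h S)
  also have "dim (h ` L ` S) \<le> dim W"
    using dim_image_le[OF h(2), of "L ` S"] dim_subset[OF LW] by linarith
  finally show "dim S \<le> dim ?C + dim W" by simp
qed

text \<open>
  The upper bound in every inertia computation below: a negative and a nonnegative subspace meet
  only in \<open>0\<close>, so exhibiting both with complementary dimensions determines the inertia.
\<close>

lemma dim_neg_plus_nonneg_le:
  assumes "subspace S" "subspace W" "W \<subseteq> S" "neg_def_on (\<lambda>v. B v v) W"
    "subspace C" "C \<subseteq> S" "\<And>v. v \<in> C \<Longrightarrow> 0 \<le> B v v"
  shows "W \<inter> C = {0}" "dim W + dim C \<le> dim S"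
proof -
  show 0: "W \<inter> C = {0}"
    using assms by (force simp: neg_def_on_def subspace_0)
  have "dim W + dim C = dim {x + y |x y. x \<in> W \<and> y \<in> C}"
    using dim_sums_Int[OF assms(2,5)] 0 by simp
  also have "\<dots> \<le> dim S"
    using assms by (intro dim_subset) (auto intro: subspace_add)
  finally show "dim W + dim C \<le> dim S" .
qed

text \<open>
  Sylvester's decomposition: the orthogonal complement of a maximal negative subspace contains no
  negative vector, since such a vector could be adjoined to the subspace.
\<close>

lemma neg_nonneg_decomposition:
  assumes S: "subspace S"
  obtains W C where "subspace W" "W \<subseteq> S" "neg_def_on (\<lambda>v. B v v) W" "dim W = neg_dim (\<lambda>v. B v v) S"
    "subspace C" "C \<subseteq> S" "\<And>v. v \<in> C \<Longrightarrow> 0 \<le> B v v" "dim W + dim C = dim S"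
    "C = {v\<in>S. \<forall>w\<in>W. B v w = 0}"
proof -
  obtain W where W: "subspace W" "W \<subseteq> S" "neg_def_on (\<lambda>v. B v v) W" 
      "dim W = neg_dim (\<lambda>v. B v v) S"
    using neg_dim_attained[OF S] by blast
  define C where "C = {v\<in>S. \<forall>w\<in>W. B v w = 0}"
  note C = dim_orthogonal_ge[OF S W(1), folded C_def]
  have nonneg: "0 \<le> B v v" if v: "v \<in> C" for v
  proof (rule ccontr)
    assume neg: "\<not> 0 \<le> B v v"
    let ?W = "{x + y |x y. x \<in> W \<and> y \<in> span {v}}"
    have "v \<notin> W" using neg v by (auto simp: C_def)
    have "v \<noteq> 0" using neg by (auto simp: symmetric_bilinear_simps)
    have "W \<inter> span {v} = {0}"
    proof -
      have "k = 0" if "k *\<^sub>R v \<in> W" for k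
        using that \<open>v \<notin> W\<close> subspace_scale[OF W(1) that, of "inverse k"] by (cases "k = 0") auto
      then show ?thesis using W by (auto simp: span_singleton subspace_0)
    qed
    then have "dim ?W = dim W + 1"
      using dim_sums_Int[OF W(1), of "span {v}"] \<open>v \<noteq> 0\<close> by (simp add: subspace_span dim_insert)
    moreover have "dim ?W \<le> neg_dim (\<lambda>v. B v v) S"
    proof (rule dim_le_neg_dim)
      show "subspace ?W" by (intro subspace_sums W subspace_span)
      show "?W \<subseteq> S" using W v S by (auto simp: span_singleton C_def intro!: subspace_add subspace_scale)
      show "neg_def_on (\<lambda>v. B v v) ?W"
        unfolding neg_def_on_def
      proof safe
        fix x y assume x: "x \<in> W" and y: "y \<in> span {v}" and nz: "x + y \<noteq> 0"
        obtain k where k: "y = k *\<^sub>R v" using y by (auto simp: span_singleton)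
        have o: "B v x = 0" "B x v = 0" using v x symmetric_bilinear_sym[of x v] by (auto simp: C_def)
        have e: "B (x + y) (x + y) = B x x + k * k * B v v"
          using o by (simp add: k symmetric_bilinear_simps)
        show "B (x + y) (x + y) < 0"
        proof (cases "x = 0")
          case True
          then have "k \<noteq> 0" using nz k by auto
          then have "0 < k * k" by (metis not_real_square_gt_zero)
          then show ?thesis using e True neg by (simp add: symmetric_bilinear_simps mult_less_0_iff)
        next
          case False
          then have "B x x < 0" using W x by (auto simp: neg_def_on_def)
          moreover have "k * k * B v v \<le> 0" using neg by (intro mult_nonneg_nonpos) auto
          ultimately show ?thesis using e by simp
        qed
      qed
    qed
    ultimately show False using W by simp
  qed
  have CS: "C \<subseteq> S" by (auto simp: C_def)
  have "dim W + dim C = dim S"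
    using dim_neg_plus_nonneg_le(2)[OF S W(1-3) C(1) CS nonneg] C(2) by simp
  from that[OF W C(1) CS nonneg this C_def] show ?thesis .
qed

text \<open>
  The Cauchy-Schwarz inequality for a null vector.
\<close>

lemma nonneg_isotropic_radical:
  assumes C: "subspace C" "\<And>v. v \<in> C \<Longrightarrow> 0 \<le> B v v" and "u \<in> C" "B u u = 0" "y \<in> C"
  shows "B u y = 0"
proof (rule ccontr)
  assume ne: "B u y \<noteq> 0"
  \<comment> \<open>The form at \<open>k u + y\<close> is affine in \<open>k\<close>; this \<open>k\<close> makes its value \<open>-1\<close>.\<close>
  define k where "k = - (B y y + 1) / (2 * B u y)"
  have "0 \<le> B (k *\<^sub>R u + y) (k *\<^sub>R u + y)"
    by (intro C(2) subspace_add subspace_scale C(1) assms)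
  also have "\<dots> = 2 * k * B u y + B y y"
    using assms by (simp add: symmetric_bilinear_simps symmetric_bilinear_sym[of y u])
  also have "\<dots> = -1" using ne by (simp add: k_def field_simps)
  finally show False by simp
qed

end

lemma symmetric_bilinear_sum:
  fixes B1 :: "'a::euclidean_space \<Rightarrow> 'a \<Rightarrow> real" and B2 :: "'b::euclidean_space \<Rightarrow> 'b \<Rightarrow> real"
  assumes B1: "symmetric_bilinear B1" and B2: "symmetric_bilinear B2"
  shows "symmetric_bilinear (\<lambda>v w. B1 (fst v) (fst w) + B2 (snd v) (snd w))"
  unfolding symmetric_bilinear_def
  by (auto intro!: linearI simp: symmetric_bilinear_simps[OF B1] symmetric_bilinear_simps[OF B2] algebra_simps
       symmetric_bilinear_sym[OF B1] symmetric_bilinear_sym[OF B2])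

lemma neg_dim_sum:
  fixes B1 :: "'a::euclidean_space \<Rightarrow> 'a \<Rightarrow> real" and B2 :: "'b::euclidean_space \<Rightarrow> 'b \<Rightarrow> real"
  assumes B1: "symmetric_bilinear B1" and B2: "symmetric_bilinear B2"
  shows "neg_dim (\<lambda>(x, y). B1 x x + B2 y y) UNIV
    = neg_dim (\<lambda>x. B1 x x) UNIV + neg_dim (\<lambda>y. B2 y y) UNIV"
proof -
  let ?q = "\<lambda>(x, y). B1 x x + B2 y y"
  obtain W1 C1 where 1: "subspace W1" "neg_def_on (\<lambda>v. B1 v v) W1" "dim W1 = neg_dim (\<lambda>v. B1 v v) UNIV"
    "subspace C1" "\<And>v. v \<in> C1 \<Longrightarrow> 0 \<le> B1 v v" "dim W1 + dim C1 = DIM('a)"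
    by (rule neg_nonneg_decomposition[OF B1 subspace_UNIV], rule that) (assumption | simp)+
  obtain W2 C2 where 2: "subspace W2" "neg_def_on (\<lambda>v. B2 v v) W2" "dim W2 = neg_dim (\<lambda>v. B2 v v) UNIV"
    "subspace C2" "\<And>v. v \<in> C2 \<Longrightarrow> 0 \<le> B2 v v" "dim W2 + dim C2 = DIM('b)"
    by (rule neg_nonneg_decomposition[OF B2 subspace_UNIV], rule that) (assumption | simp)+
  have q: "(\<lambda>v. (case v of (x, y) \<Rightarrow> B1 x x + B2 y y)) = (\<lambda>v. B1 (fst v) (fst v) + B2 (snd v) (snd v))"
    by auto
  note Q = symmetric_bilinear_sum[OF B1 B2]
  have neg: "neg_def_on ?q (W1 \<times> W2)"
    unfolding neg_def_on_def
  proof safe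
    fix x y assume "x \<in> W1" "y \<in> W2" "(x, y) \<noteq> 0"
    then show "B1 x x + B2 y y < 0"
      using 1(2) 2(2) unfolding neg_def_on_def
      by (cases "x = 0"; cases "y = 0")
         (auto simp: symmetric_bilinear_simps[OF B1] symmetric_bilinear_simps[OF B2] zero_prod_def intro!: add_neg_neg)
  qed
  show ?thesis
  proof (rule neg_dim_eqI[OF subspace_UNIV _ _ neg])
    show "subspace (W1 \<times> W2)" by (intro subspace_Times 1 2)
    show "dim (W1 \<times> W2) = neg_dim (\<lambda>x. B1 x x) UNIV + neg_dim (\<lambda>y. B2 y y) UNIV"
      using dim_Times[OF 1(1) 2(1)] 1 2 by simp
    fix V :: "('a \<times> 'b) set" assume V: "subspace V" "neg_def_on ?q V"
    have "dim V + dim (C1 \<times> C2) \<le> dim (UNIV :: ('a \<times> 'b) set)"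
      by (rule dim_neg_plus_nonneg_le(2)[OF Q])
         (use V 1 2 in \<open>auto simp: q intro!: subspace_Times\<close>)
    then show "dim V \<le> neg_dim (\<lambda>x. B1 x x) UNIV + neg_dim (\<lambda>y. B2 y y) UNIV"
      using dim_Times[OF 1(4) 2(4)] 1 2 by simp
  qed auto
qed

section \<open>Inertia of symmetric matrices\<close>

definition quad :: "real^'m^'m \<Rightarrow> real^'m \<Rightarrow> real"
  where "quad A v = v \<bullet> (A *v v)"

abbreviation neg_inertia :: "real^'m^'m \<Rightarrow> nat"
  where "neg_inertia A \<equiv> neg_dim (quad A) UNIV"

lemma inner_matrix_left: "(A *v x) \<bullet> y = x \<bullet> (transpose A *v (y :: real^'n))"
  by (metis dot_lmul_matrix inner_commute vector_transpose_matrix transpose_transpose)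

lemma inner_matrix_symmetric:
  fixes A :: "real^'n^'n"
  assumes "transpose A = A"
  shows "(A *v x) \<bullet> y = x \<bullet> (A *v y)"
  using inner_matrix_left[of A x y] assms by simp

lemma symmetric_bilinear_matrix:
  fixes A :: "real^'n^'n"
  assumes "transpose A = A"
  shows "symmetric_bilinear (\<lambda>x y. x \<bullet> (A *v y))"
  unfolding symmetric_bilinear_def
proof (intro conjI allI)
  show "linear (\<lambda>x. x \<bullet> (A *v y))" for y by (rule linearI) (simp_all add: inner_add_left)
  show "x \<bullet> (A *v y) = y \<bullet> (A *v x)" for x y
    using inner_matrix_symmetric[OF assms, of x y] by (simp add: inner_commute)
qed

lemma uminus_matrix_vector_mult: "(- A) *v v = - (A *v v)" for A :: "real^'n^'m"
  by (simp add: matrix_vector_mult_def vec_eq_iff sum_negf)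

lemma dim_kernel_plus_range:
  fixes L :: "'v::euclidean_space \<Rightarrow> 'w::euclidean_space"
  assumes L: "linear L" and S: "subspace S"
  shows "dim {x\<in>S. L x = 0} + dim (L ` S) = dim S"
proof -
  obtain h where h: "range h \<subseteq> S" "linear h" "\<And>v. v \<in> L ` S \<Longrightarrow> L (h v) = v"
    using linear_exists_right_inverse_on[OF L S] by blast
  let ?K = "{x\<in>S. L x = 0}" and ?R = "h ` L ` S"
  have K: "subspace ?K"
    using S by (auto simp: subspace_def linear_add[OF L] linear_scale[OF L] linear_0[OF L])
  have LS: "subspace (L ` S)" by (intro linear_subspace_image L S)
  have R: "subspace ?R" by (intro linear_subspace_image h LS)
  have "inj_on h (L ` S)" by (rule inj_on_inverseI[of _ L]) (use h in auto)
  then have "dim ?R = dim (L ` S)"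
    using LS by (intro dim_image_eq h) (metis span_eq_iff)
  moreover have "?K \<inter> ?R = {0}"
    using S R h linear_0[OF h(2)] linear_0[OF L] by (auto simp: subspace_0)
  moreover have "{x + y |x y. x \<in> ?K \<and> y \<in> ?R} = S"
  proof safe
    fix x assume "x \<in> S"
    then show "\<exists>xa y. x = xa + y \<and> xa \<in> ?K \<and> y \<in> ?R"
      using h by (intro exI[of _ "x - h (L x)"] exI[of _ "h (L x)"])
        (auto simp: linear_diff[OF L] intro!: subspace_diff S)
  qed (use S h in \<open>auto intro: subspace_add\<close>)
  ultimately show ?thesis using dim_sums_Int[OF K R] by simp
qed

lemma rank_plus_dim_kernel: "dim {x. A *v x = 0} + rank A = CARD('n)" for A :: "real^'n^'m"
  using dim_kernel_plus_range[of "(*v) A" UNIV] by (simp add: rank_dim_range)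

text \<open>
  In the orthogonal complement of a maximal negative subspace the null vectors of the form are
  exactly the kernel of \<open>A\<close>, so a complement of the kernel in it is a maximal positive subspace.
\<close>

lemma rank_eq_inertia_sum:
  fixes A :: "real^'n^'n"
  assumes sym: "transpose A = A"
  shows "rank A = neg_inertia A + neg_inertia (- A)"
proof -
  define B where "B x y = x \<bullet> (A *v y)" for x y
  have B: "symmetric_bilinear B" using symmetric_bilinear_matrix[OF sym] by (simp add: B_def[abs_def])
  have qB: "quad A = (\<lambda>v. B v v)" by (auto simp: quad_def B_def)
  have qmB: "quad (- A) = (\<lambda>v. - B v v)"
    by (auto simp: quad_def B_def uminus_matrix_vector_mult)
  let ?K = "{x. A *v x = 0}"
  have K: "subspace ?K" by (auto simp: subspace_def matrix_vector_right_distrib matrix_vector_mult_scaleR)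
  obtain W C where W: "subspace W" "neg_def_on (\<lambda>v. B v v) W" "dim W = neg_dim (\<lambda>v. B v v) UNIV"
    and C: "subspace C" "\<And>v. v \<in> C \<Longrightarrow> 0 \<le> B v v" "dim W + dim C = CARD('n)" "C = {v\<in>UNIV. \<forall>w\<in>W. B v w = 0}"
    by (rule neg_nonneg_decomposition[OF B subspace_UNIV], rule that) (assumption | simp)+
  have BK: "B v w = 0" "B w v = 0" if "v \<in> ?K" for v w
    using that symmetric_bilinear_sym[OF B, of v w] by (auto simp: B_def)
  have WC: "W \<inter> C = {0}"
    by (rule dim_neg_plus_nonneg_le(1)[OF B subspace_UNIV W(1) _ W(2) C(1) _ C(2)]) auto
  have "{x + y |x y. x \<in> W \<and> y \<in> C} = UNIV"
  proof (rule subspace_dim_equal[OF subspace_sums[OF W(1) C(1)] subspace_UNIV subset_UNIV])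
    show "dim (UNIV :: (real^'n) set) \<le> dim {x + y |x y. x \<in> W \<and> y \<in> C}"
      using dim_sums_Int[OF W(1) C(1)] WC C(3) by simp
  qed
  then have split: "\<exists>w\<in>W. \<exists>c\<in>C. v = w + c" for v by (smt (verit, best) UNIV_I mem_Collect_eq)
  have rad: "v \<in> ?K" if "v \<in> C" "B v v = 0" for v
  proof -
    have "(A *v v) \<bullet> y = 0" for y
    proof -
      obtain w c where "w \<in> W" "c \<in> C" "y = w + c" using split by blast
      moreover have "B v w = 0" using C(4) that \<open>w \<in> W\<close> by auto
      moreover have "B v c = 0" using nonneg_isotropic_radical[OF B C(1,2) that \<open>c \<in> C\<close>] by simp
      ultimately have "B v y = 0" by (simp add: symmetric_bilinear_simps[OF B])
      then show ?thesis using inner_matrix_symmetric[OF sym, of v y] by (simp add: B_def)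
    qed
    from this[of "A *v v"] show ?thesis by simp
  qed
  have KC: "?K \<subseteq> C" using BK C(4) by auto
  define C' where "C' = {y \<in> C. \<forall>x \<in> ?K. orthogonal x y}"
  have C'sub: "subspace C'"
    using C(1) unfolding C'_def by (auto simp: subspace_def orthogonal_clauses)
  have dimC': "dim C' + dim ?K = dim C"
    unfolding C'_def using dim_subspace_orthogonal_to_vectors[OF K C(1) KC] by simp
  have pos: "B v v > 0" if "v \<in> C'" "v \<noteq> 0" for v
  proof -
    have "v \<in> C" using that by (auto simp: C'_def)
    moreover have "B v v \<noteq> 0"
    proof
      assume "B v v = 0"
      then have "v \<in> ?K" using rad \<open>v \<in> C\<close> by blast
      then have "orthogonal v v" using that by (auto simp: C'_def)
      then show False using that by (simp add: orthogonal_def)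
    qed
    ultimately show ?thesis using C(2)[of v] by simp
  qed
  have "dim C' = neg_dim (\<lambda>v. - B v v) UNIV"
  proof (rule neg_dim_eqI[symmetric, OF subspace_UNIV C'sub _ _ refl])
    show "neg_def_on (\<lambda>v. - B v v) C'" using pos by (auto simp: neg_def_on_def)
    fix V :: "(real^'n) set" assume V: "subspace V" "neg_def_on (\<lambda>v. - B v v) V"
    let ?N = "{x + y |x y. x \<in> W \<and> y \<in> ?K}"
    have N: "subspace ?N" by (intro subspace_sums W K)
    have "dim ?N = dim W + dim ?K"
    proof -
      have "W \<inter> ?K \<subseteq> {0}" using WC KC by auto
      then have "W \<inter> ?K = {0}" using subspace_0[OF W(1)] by auto
      then show ?thesis using dim_sums_Int[OF W(1) K] by simp
    qed
    moreover have Bm: "symmetric_bilinear (\<lambda>x y. - B x y)"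
      using B by (auto simp: symmetric_bilinear_def intro!: linear_compose_neg)
    have "dim V + dim ?N \<le> dim (UNIV :: (real^'n) set)"
    proof (rule dim_neg_plus_nonneg_le(2)[OF Bm subspace_UNIV V(1) _ V(2) N])
      fix v assume "v \<in> ?N"
      then obtain w k where v: "v = w + k" "w \<in> W" "k \<in> ?K" by auto
      then have "B v v = B w w" using BK[of k] by (simp add: symmetric_bilinear_simps[OF B])
      also have "\<dots> \<le> 0" using v W(2) by (cases "w = 0") (auto simp: neg_def_on_def symmetric_bilinear_simps[OF B] less_imp_le)
      finally show "0 \<le> - B v v" by simp
    qed auto
    ultimately show "dim V \<le> dim C'" using dimC' C(3) by simp
  qed auto
  then show ?thesis
    using rank_plus_dim_kernel[of A] dimC' C(3) W(3) by (simp add: qB qmB)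
qed

text \<open>
  Bordering by \<open>L\<close>, as a Lagrange multiplier does, restricts a form to the kernel of \<open>L\<close> and adds
  one hyperbolic plane, hence one negative square, for each dimension of the range of \<open>L\<close>.
\<close>

lemma neg_dim_bordered:
  fixes B :: "'v::euclidean_space \<Rightarrow> 'v \<Rightarrow> real" and L :: "'v \<Rightarrow> 'w::euclidean_space"
  assumes B: "symmetric_bilinear B" and L: "linear L"
  shows "neg_dim (\<lambda>(x, e). B x x + e \<bullet> L x) UNIV = neg_dim (\<lambda>x. B x x) {x. L x = 0} + dim (range L)"
    (is "neg_dim ?q UNIV = neg_dim ?b ?K + _")
proof -
  have K: "subspace ?K" by (rule linear_subspace_kernel[OF L])
  have dimK: "dim ?K + dim (range L) = DIM('v)"
    using dim_kernel_plus_range[OF L subspace_UNIV] by simp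
  obtain W where W: "subspace W" "W \<subseteq> ?K" "neg_def_on ?b W" "dim W = neg_dim ?b ?K"
    using neg_dim_attained[OF K] by blast
  define R where "R = {y \<in> UNIV. \<forall>x \<in> ?K. orthogonal x y}"
  have R: "subspace R" unfolding R_def by (auto simp: subspace_def orthogonal_clauses)
  have dimR: "dim R = dim (range L)"
    unfolding R_def using dim_subspace_orthogonal_to_vectors[OF K subspace_UNIV] dimK by simp
  have RK: "x = 0" if "x \<in> R" "x \<in> ?K" for x
    using that by (auto simp: R_def orthogonal_def)
  obtain G where G: "linear G" "\<And>r. r \<in> R \<Longrightarrow> G (L r) = r"
  proof -
    have "inj_on L R" by (rule inj_on_linear_subspaceI[OF L R]) (use RK in auto)
    then show ?thesis using linear_exists_left_inverse_on[OF L R] that by blast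
  qed
  define f where "f x = (\<Sum>b\<in>Basis. B x b *\<^sub>R b)" for x
  have f: "linear f" unfolding f_def
    by (rule linearI) (auto simp: symmetric_bilinear_simps[OF B] scaleR_add_left sum.distrib scaleR_sum_right)
  have f_inner: "f x \<bullet> y = B x y" for x y
  proof -
    have "linear (\<lambda>y. B x y)" by (rule linearI) (auto simp: symmetric_bilinear_simps[OF B])
    then have "B x y = (\<Sum>b\<in>Basis. (y \<bullet> b) *\<^sub>R B x b)"
      by (subst euclidean_representation[symmetric, of y])
         (simp add: linear_sum linear_scale del: real_scaleR_def)
    then show ?thesis by (simp add: f_def inner_sum_left inner_sum_right inner_commute mult.commute)
  qed
  \<comment> \<open>On \<open>W + R\<close> the multiplier is chosen so that the value at \<open>n + r\<close> becomes \<open>B n n - r \<bullet> r\<close>: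
    \<open>G\<close> inverts \<open>L\<close> on \<open>R\<close>, hence \<open>adjoint G v \<bullet> L r = v \<bullet> r\<close>, and \<open>v\<close> cancels \<open>2 B n r + B r r\<close>.\<close>
  define p where "p z = (fst z + snd z, adjoint G (- 2 *\<^sub>R f (fst z) - f (snd z) - snd z))" for z
  have p: "linear p"
    unfolding p_def
    by (intro linearI) (simp_all add: linear_add[OF f] linear_scale[OF f] linear_add[OF adjoint_linear[OF G(1)]]
        linear_diff[OF adjoint_linear[OF G(1)]] linear_scale[OF adjoint_linear[OF G(1)]]
        linear_neg[OF adjoint_linear[OF G(1)]] algebra_simps)
  have qp: "?q (p (n, r)) = B n n - r \<bullet> r" if "n \<in> W" "r \<in> R" for n r
  proof -
    have "L n = 0" using that W by auto
    then have Lnr: "L (n + r) = L r" by (simp add: linear_add[OF L])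
    have "adjoint G v \<bullet> L r = v \<bullet> r" for v
      using adjoint_works[OF G(1), of "L r" v] G(2)[OF that(2)] by (metis inner_commute)
    then have "?q (p (n, r)) = B (n + r) (n + r) + (- 2 *\<^sub>R f n - f r - r) \<bullet> r"
      by (simp add: p_def Lnr)
    also have "\<dots> = B n n - r \<bullet> r"
      by (simp add: inner_diff_left f_inner symmetric_bilinear_simps[OF B] symmetric_bilinear_sym[OF B, of r n])
    finally show ?thesis .
  qed
  have neg: "neg_def_on ?q (p ` (W \<times> R))"
    unfolding neg_def_on_def
  proof (intro ballI impI)
    fix v assume "v \<in> p ` (W \<times> R)" "v \<noteq> 0"
    then obtain n r where nr: "n \<in> W" "r \<in> R" "p (n, r) \<noteq> 0" and v: "v = p (n, r)" by auto
    have "n \<noteq> 0 \<or> r \<noteq> 0" using nr(3) linear_0[OF p] by (auto simp: zero_prod_def)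
    moreover have lt: "n \<noteq> 0 \<Longrightarrow> B n n < 0" using nr(1) W(3) by (simp add: neg_def_on_def)
    moreover have "B n n \<le> 0"
      using lt by (cases "n = 0") (simp_all add: symmetric_bilinear_simps[OF B])
    moreover have "0 \<le> r \<bullet> r" "r \<noteq> 0 \<Longrightarrow> 0 < r \<bullet> r" by auto
    ultimately show "?q v < 0" unfolding v qp[OF nr(1,2)] by linarith
  qed
  show ?thesis
  proof (rule neg_dim_eqI[OF subspace_UNIV _ _ neg])
    have inj: "inj_on p (W \<times> R)"
    proof (rule inj_on_linear_subspaceI[OF p])
      fix z assume z: "z \<in> W \<times> R" "p z = 0"
      have "fst z + snd z = 0" using arg_cong[OF z(2), of fst] by (simp add: p_def)
      then have "fst z = - snd z" by (simp add: eq_neg_iff_add_eq_0)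
      moreover have "fst z \<in> ?K" "snd z \<in> R" using z(1) W(2) by (auto simp: mem_Times_iff)
      ultimately have "fst z = - snd z" "fst z \<in> ?K" "snd z \<in> R" by simp_all
      then have "snd z \<in> ?K" using linear_neg[OF L, of "snd z"] by simp
      then have "snd z = 0" using RK \<open>snd z \<in> R\<close> by blast
      then show "z = 0" using \<open>fst z = - snd z\<close> by (simp add: prod_eq_iff)
    qed (intro subspace_Times W R)
    have sub: "subspace (W \<times> R)" by (intro subspace_Times W R)
    show "subspace (p ` (W \<times> R))" by (intro linear_subspace_image p sub)
    have "dim (p ` (W \<times> R)) = dim (W \<times> R)"
      by (rule dim_image_eq[OF p]) (use inj sub in \<open>metis span_eq_iff\<close>)
    then show "dim (p ` (W \<times> R)) = neg_dim ?b ?K + dim (range L)"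
      using dim_Times[OF W(1) R] W(4) dimR by simp
  next
    fix V :: "('v \<times> 'w) set" assume V: "subspace V" "neg_def_on ?q V"
    \<comment> \<open>Conversely, restricting to the kernel of \<open>L\<close> costs at most \<open>dim (range L)\<close> dimensions, and
      on the restriction the multiplier no longer contributes.\<close>
    let ?V0 = "{z\<in>V. (L \<circ> fst) z = 0}"
    have Lf: "linear (L \<circ> fst)" by (intro linear_compose linear_fst L)
    have V0: "subspace ?V0"
      using V(1) by (auto simp: subspace_def linear_add[OF L] linear_scale[OF L] linear_0[OF L])
    have "dim V = dim ?V0 + dim ((L \<circ> fst) ` V)" using dim_kernel_plus_range[OF Lf V(1)] by simp
    also have "dim ((L \<circ> fst) ` V) \<le> dim (range L)" by (intro dim_subset) auto
    also have "dim ?V0 = dim (fst ` ?V0)"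
    proof -
      have inj: "inj_on fst ?V0"
      proof (rule inj_on_linear_subspaceI[OF linear_fst V0])
        fix z assume z: "z \<in> ?V0" "fst z = 0"
        show "z = 0"
        proof (rule ccontr)
          assume "z \<noteq> 0"
          then have "?q z < 0" using z V(2) by (auto simp: neg_def_on_def)
          then show False using z by (simp add: case_prod_unfold linear_0[OF L] symmetric_bilinear_simps[OF B])
        qed
      qed
      have "span ?V0 = ?V0" by (simp only: span_eq_iff V0)
      then have "dim (fst ` ?V0) = dim ?V0" 
        using dim_image_eq[OF linear_fst, of ?V0] inj by (simp only:)
      then show ?thesis by simp
    qed
    also have "dim (fst ` ?V0) \<le> neg_dim ?b ?K"
    proof (rule dim_le_neg_dim)
      show "subspace (fst ` ?V0)" by (intro linear_subspace_image linear_fst V0)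
      show "neg_def_on ?b (fst ` ?V0)"
        unfolding neg_def_on_def
      proof (intro ballI impI)
        fix x assume "x \<in> fst ` ?V0" "x \<noteq> 0"
        then obtain e where e: "(x, e) \<in> V" "L x = 0" by auto
        have "(x, e) \<noteq> 0" using \<open>x \<noteq> 0\<close> by (simp add: zero_prod_def)
        then have "?q (x, e) < 0" using e(1) V(2) unfolding neg_def_on_def by blast
        then show "?b x < 0" using e(2) by simp
      qed
    qed auto
    finally show "dim V \<le> neg_dim ?b ?K + dim (range L)" by simp
  qed auto
qed

section \<open>Negative eigenvalues\<close>

text \<open>
  The eigenvectors with negative eigenvalues span a negative subspace \<open>W\<close>. Its orthogonal
  complement \<open>C\<close> is invariant, and it is nonnegative because a negative minimum of the Rayleigh
  quotient on \<open>C\<close> would be attained at one more eigenvector with negative eigenvalue.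
\<close>

lemma neg_index_eq_neg_inertia:
  fixes A :: "real^'n^'n"
  assumes sym: "transpose A = A"
  shows "neg_index A = neg_inertia A"
proof -
  define E where "E x = {v. A *v v = x *\<^sub>R v}" for x
  define \<Lambda> where "\<Lambda> = {x. x < 0 \<and> (\<exists>v. v \<noteq> 0 \<and> A *v v = x *\<^sub>R v)}"
  have E: "subspace (E x)" for x
    by (auto simp: E_def subspace_def matrix_vector_right_distrib matrix_vector_mult_scaleR algebra_simps)
  have orth: "v \<bullet> w = 0" if "v \<in> E x" "w \<in> E y" "x \<noteq> y" for v w x y
  proof -
    have "x * (v \<bullet> w) = y * (v \<bullet> w)"
      using inner_matrix_symmetric[OF sym, of v w] that by (simp add: E_def)
    then show ?thesis using that by simp
  qed
  have "\<exists>b. b \<subseteq> E x \<and> pairwise orthogonal b \<and> (\<forall>v\<in>b. norm v = 1) \<and> independent b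
      \<and> card b = dim (E x) \<and> span b = E x" for x
    using orthonormal_basis_subspace[OF E[of x]] by metis
  then obtain b where b: "\<And>x. b x \<subseteq> E x" "\<And>x. pairwise orthogonal (b x)"
      "\<And>x v. v \<in> b x \<Longrightarrow> norm v = 1" "\<And>x. independent (b x)"
      "\<And>x. card (b x) = dim (E x)" "\<And>x. span (b x) = E x"
    by metis
  define U where "U = (\<Union>x\<in>\<Lambda>. b x)"
  have norm_U: "norm v = 1" if "v \<in> U" for v using that b(3) by (auto simp: U_def)
  have orth_U: "pairwise orthogonal U"
    unfolding pairwise_def orthogonal_def
  proof (intro ballI impI)
    fix v w assume vw: "v \<in> U" "w \<in> U" "v \<noteq> w"
    then obtain x y where "v \<in> b x" "w \<in> b y" by (auto simp: U_def)
    then show "v \<bullet> w = 0"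
      using vw(3) b(2)[of x] orth[of v x w y] b(1) by (cases "x = y") (auto simp: pairwise_def orthogonal_def)
  qed
  have indep_U: "independent U"
    using norm_U by (intro pairwise_orthogonal_independent[OF orth_U]) force
  then have fin_U: "finite U" by (rule independent_imp_finite)
  have disj: "b x \<inter> b y = {}" if "x \<noteq> y" for x y
  proof (rule ccontr)
    assume "b x \<inter> b y \<noteq> {}"
    then obtain v where v: "v \<in> b x" "v \<in> b y" by auto
    then have "v \<bullet> v = 0" using orth[of v x v y] b(1) that by auto
    then show False using b(3)[OF v(1)] by simp
  qed
  have "b x \<noteq> {}" if "x \<in> \<Lambda>" for x
    using that b(6)[of x] by (auto simp: \<Lambda>_def E_def)
  then have "inj_on b \<Lambda>" using disj by (metis inf.idem inj_onI)
  moreover have "finite (b ` \<Lambda>)"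
    by (rule finite_subset[of _ "Pow U"]) (auto simp: U_def fin_U[unfolded U_def])
  ultimately have fin_\<Lambda>: "finite \<Lambda>" by (rule inj_on_finite[OF _ subset_refl])
  have card_U: "card U = neg_index A"
  proof -
    have "card U = (\<Sum>x\<in>\<Lambda>. card (b x))"
      unfolding U_def using fin_\<Lambda> disj independent_imp_finite[OF b(4)]
      by (intro card_UN_disjoint) auto
    then show ?thesis by (simp add: b(5) neg_index_def \<Lambda>_def E_def)
  qed
  define W where "W = span U"
  define C where "C = {y \<in> UNIV. \<forall>x \<in> W. orthogonal x y}"
  have W: "subspace W" "dim W = neg_index A"
    unfolding W_def using indep_U card_U by (simp_all add: dim_span dim_eq_card_independent)
  have C: "subspace C" unfolding C_def by (auto simp: subspace_def orthogonal_clauses)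
  have dimC: "dim C + dim W = CARD('n)"
    unfolding C_def using dim_subspace_orthogonal_to_vectors[OF W(1) subspace_UNIV] by simp
  define B where "B x y = x \<bullet> (A *v y)" for x y
  have B: "symmetric_bilinear B" using symmetric_bilinear_matrix[OF sym] by (simp add: B_def[abs_def])
  have qB: "quad A = (\<lambda>v. B v v)" by (auto simp: quad_def B_def)
  have eig_U: "\<exists>x<0. A *v e = x *\<^sub>R e" if "e \<in> U" for e
    using that b(1) by (fastforce simp: U_def \<Lambda>_def E_def)
  then obtain ev where ev: "\<And>e. e \<in> U \<Longrightarrow> ev e < 0" "\<And>e. e \<in> U \<Longrightarrow> A *v e = ev e *\<^sub>R e" by metis
  have neg: "neg_def_on (quad A) W"
    unfolding neg_def_on_def
  proof (intro ballI impI)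
    fix v assume v: "v \<in> W" "v \<noteq> 0"
    have expand: "(\<Sum>e\<in>U. (v \<bullet> e) *\<^sub>R e) = v"
      using v norm_U by (intro orthonormal_basis_expand orth_U fin_U) (auto simp: W_def)
    have "(A *v v) \<bullet> e = ev e * (v \<bullet> e)" if "e \<in> U" for e
      using inner_matrix_symmetric[OF sym, of v e] ev(2)[OF that] by simp
    then have "quad A v = (\<Sum>e\<in>U. ev e * (v \<bullet> e)\<^sup>2)"
      unfolding quad_def
      by (subst (1) expand[symmetric]) (simp add: inner_sum_left inner_sum_right inner_commute power2_eq_square mult_ac)
    moreover have "(\<Sum>e\<in>U. ev e * (v \<bullet> e)\<^sup>2) < 0"
    proof -
      obtain e where e: "e \<in> U" "v \<bullet> e \<noteq> 0"
      proof (rule ccontr)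
        assume "\<not> thesis"
        then have "\<forall>e\<in>U. (v \<bullet> e) *\<^sub>R e = 0" using that by auto
        then have "(\<Sum>e\<in>U. (v \<bullet> e) *\<^sub>R e) = 0" by (rule sum.neutral)
        then show False using expand v(2) by simp
      qed
      have "(\<Sum>e\<in>U. ev e * (v \<bullet> e)\<^sup>2) = ev e * (v \<bullet> e)\<^sup>2 + (\<Sum>e\<in>U - {e}. ev e * (v \<bullet> e)\<^sup>2)"
        by (rule sum.remove[OF fin_U e(1)])
      moreover have "ev e * (v \<bullet> e)\<^sup>2 < 0" using ev(1)[OF e(1)] e(2) by (simp add: mult_neg_pos)
      moreover have "(\<Sum>e\<in>U - {e}. ev e * (v \<bullet> e)\<^sup>2) \<le> 0"
        using ev(1) by (intro sum_nonpos mult_nonpos_nonneg) (auto simp: less_imp_le)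
      ultimately show ?thesis by linarith
    qed
    ultimately show "quad A v < 0" by simp
  qed
  have nonneg: "0 \<le> B v v" if v: "v \<in> C" for v
  proof (rule ccontr)
    assume "\<not> 0 \<le> B v v"
    then have vneg: "B v v < 0" by simp
    then have "v \<noteq> 0" by (auto simp: symmetric_bilinear_simps[OF B])
    let ?S = "C \<inter> sphere 0 1"
    have "compact ?S" using C by (intro closed_Int_compact closed_subspace) auto
    moreover have "v /\<^sub>R norm v \<in> ?S" using v \<open>v \<noteq> 0\<close> C by (auto intro: subspace_scale)
    moreover have "continuous_on ?S (\<lambda>v. B v v)"
      unfolding B_def by (intro continuous_intros matrix_vector_mult_linear_continuous_on)
    ultimately obtain u where u: "u \<in> ?S" "\<And>y. y \<in> ?S \<Longrightarrow> B u u \<le> B y y"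
      using continuous_attains_inf[of ?S "\<lambda>v. B v v"] by blast
    define m where "m = B u u"
    have "m \<le> B (v /\<^sub>R norm v) (v /\<^sub>R norm v)"
      unfolding m_def using \<open>v /\<^sub>R norm v \<in> ?S\<close> by (rule u(2))
    also have "\<dots> < 0" using vneg \<open>v \<noteq> 0\<close> by (simp add: symmetric_bilinear_simps[OF B] mult_pos_neg)
    finally have "m < 0" .
    \<comment> \<open>Minimality of \<open>m\<close> makes \<open>R\<close> nonnegative on \<open>C\<close>, with null vector \<open>u\<close>; so \<open>u\<close> lies in its
      radical on \<open>C\<close>, which is the eigenvalue equation.\<close>
    define R where "R x y = B x y - m * (x \<bullet> y)" for x y
    have R: "symmetric_bilinear R"
      unfolding symmetric_bilinear_def
    proof (intro conjI allI)
      show "linear (\<lambda>x. R x y)" for y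
        by (rule linearI) (simp_all add: R_def symmetric_bilinear_simps[OF B] inner_add_left algebra_simps)
      show "R x y = R y x" for x y
        by (simp add: R_def symmetric_bilinear_sym[OF B, of x y] inner_commute[of x y])
    qed
    have R_nonneg: "0 \<le> R y y" if y: "y \<in> C" for y
    proof (cases "y = 0")
      case True
      then show ?thesis by (simp add: symmetric_bilinear_simps[OF R])
    next
      case False
      then have "y /\<^sub>R norm y \<in> ?S" using y C by (auto intro: subspace_scale)
      then have "m \<le> B (y /\<^sub>R norm y) (y /\<^sub>R norm y)" unfolding m_def by (rule u(2))
      also have "\<dots> = B y y / (y \<bullet> y)"
        using False by (simp add: symmetric_bilinear_simps[OF B] dot_square_norm power2_eq_square divide_simps)
      finally show ?thesis using False by (simp add: R_def field_simps)
    qed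
    have "u \<in> C" "u \<bullet> u = 1" using u(1) by (auto simp: dot_square_norm)
    then have "R u u = 0" by (simp add: R_def m_def)
    have "A *v u \<in> C"
    proof -
      have "e \<bullet> (A *v u) = 0" if "e \<in> U" for e
      proof -
        have "orthogonal e u" using \<open>u \<in> C\<close> that by (auto simp: C_def W_def span_base)
        then show ?thesis
          using inner_matrix_symmetric[OF sym, of e u] ev(2)[OF that] by (simp add: orthogonal_def)
      qed
      then have "W \<subseteq> {x. x \<bullet> (A *v u) = 0}"
        unfolding W_def by (intro span_minimal subspace_hyperplane2) auto
      then show ?thesis by (auto simp: C_def orthogonal_def)
    qed
    then have d: "A *v u - m *\<^sub>R u \<in> C"
      using \<open>u \<in> C\<close> C by (intro subspace_diff subspace_scale)
    have "R u (A *v u - m *\<^sub>R u) = 0"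
      using nonneg_isotropic_radical[OF R C R_nonneg \<open>u \<in> C\<close> \<open>R u u = 0\<close> d] by simp
    moreover have "R u y = (A *v u - m *\<^sub>R u) \<bullet> y" for y
      using inner_matrix_symmetric[OF sym, of u y] by (simp add: R_def B_def inner_diff_left)
    ultimately have eig: "A *v u = m *\<^sub>R u" by simp
    have "u \<noteq> 0" using \<open>u \<bullet> u = 1\<close> by auto
    have "m \<in> \<Lambda>" using eig \<open>m < 0\<close> \<open>u \<noteq> 0\<close> by (auto simp: \<Lambda>_def)
    moreover have "u \<in> span (b m)" using eig by (simp add: b(6) E_def)
    ultimately have "u \<in> W" unfolding W_def U_def
      by (meson UN_upper span_mono subsetD)
    then have "orthogonal u u" using \<open>u \<in> C\<close> by (auto simp: C_def)
    then show False using \<open>u \<noteq> 0\<close> by (simp add: orthogonal_def)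
  qed
  have "neg_inertia A = neg_index A"
  proof (rule neg_dim_eqI[OF subspace_UNIV W(1) _ neg W(2)])
    fix V :: "(real^'n) set" assume V: "subspace V" "neg_def_on (quad A) V"
    have "dim V + dim C \<le> dim (UNIV :: (real^'n) set)"
      by (rule dim_neg_plus_nonneg_le(2)[OF B subspace_UNIV V(1) _ _ C _ nonneg]) (use V qB in auto)
    then show "dim V \<le> neg_index A" using dimC W by simp
  qed auto
  then show ?thesis by simp
qed

section \<open>The Moore-Penrose inverse\<close>

lemma orthogonal_projection_matrix:
  fixes S :: "(real^'n) set"
  assumes S: "subspace S"
  obtains P :: "real^'n^'n" where "transpose P = P" "\<And>v. P *v v \<in> S" "\<And>v. v \<in> S \<Longrightarrow> P *v v = v"
proof -
  obtain E where E: "E \<subseteq> S" "pairwise orthogonal E" "\<And>x. x \<in> E \<Longrightarrow> norm x = 1"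
    "independent E" "card E = dim S" "span E = S"
    using orthonormal_basis_subspace[OF S] by blast
  then have fin: "finite E" by (simp add: independent_imp_finite)
  define p where "p v = (\<Sum>e\<in>E. (v \<bullet> e) *\<^sub>R e)" for v
  have "linear p" unfolding p_def
    by (rule linearI) (simp_all add: inner_add_left scaleR_add_left sum.distrib scaleR_sum_right)
  then have P: "matrix p *v v = p v" for v by (simp add: matrix_works linear_matrix_vector_mul_eq)
  have "(matrix p *v x) \<bullet> y = (transpose (matrix p) *v x) \<bullet> y" for x y
    using inner_matrix_left[of "transpose (matrix p)" x y]
    by (simp add: P p_def inner_sum_left inner_sum_right inner_commute mult.commute)
  then have "transpose (matrix p) = matrix p"
    unfolding matrix_eq by (metis vector_eq_rdot)
  moreover have "matrix p *v v \<in> S" for v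
    unfolding P p_def using E S by (auto intro!: subspace_sum subspace_scale)
  moreover have "matrix p *v v = v" if "v \<in> S" for v
    unfolding P p_def using orthonormal_basis_expand[OF E(2,3) _ fin] that E(6) by simp
  ultimately show ?thesis using that by blast
qed

definition is_mp_inverse :: "real^'n^'m \<Rightarrow> real^'m^'n \<Rightarrow> bool"
  where "is_mp_inverse A G \<longleftrightarrow> A ** G ** A = A \<and> G ** A ** G = G \<and>
    transpose (A ** G) = A ** G \<and> transpose (G ** A) = G ** A"

text \<open>
  Any generalised inverse \<open>H\<close> of \<open>A\<close> becomes the Moore-Penrose inverse once it is preceded by the
  orthogonal projection \<open>Q\<close> onto the range and followed by the orthogonal projection \<open>P\<close> onto the
  complement of the kernel: the two products with \<open>A\<close> are then these projections.
\<close>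

lemma is_mp_inverse_exists:
  fixes A :: "real^'n^'m"
  shows "\<exists>G. is_mp_inverse A G"
proof -
  obtain K where K: "transpose K = K" "\<And>v. A *v (K *v v) = 0" "\<And>v. A *v v = 0 \<Longrightarrow> K *v v = v"
    by (rule orthogonal_projection_matrix[OF linear_subspace_kernel[OF matrix_vector_mul_linear, of A]], rule that)
      auto
  obtain Q where Q: "transpose Q = Q" "\<And>v. Q *v v \<in> range ((*v) A)" "\<And>v. Q *v (A *v v) = A *v v"
    by (rule orthogonal_projection_matrix[OF linear_subspace_image[OF matrix_vector_mul_linear[of A] subspace_UNIV]],
        rule that) auto
  obtain h where h: "linear h" "\<And>v. A *v (h (A *v v)) = A *v v"
    using linear_exists_right_inverse_on[OF matrix_vector_mul_linear[of A] subspace_UNIV] by blast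
  define H where "H = matrix h"
  have H: "H *v v = h v" for v
    unfolding H_def using h(1) by (simp add: matrix_works linear_matrix_vector_mul_eq)
  define P where "P = mat 1 - K"
  have P: "P *v v = v - K *v v" for v by (simp add: P_def matrix_vector_mult_diff_rdistrib)
  have Psym: "transpose P = P" using K(1) by (simp add: P_def transpose_def vec_eq_iff mat_def)
  have AP: "A *v (P *v v) = A *v v" for v by (simp add: P matrix_vector_mult_diff_distrib K(2))
  have PH: "P *v (H *v (A *v v)) = P *v v" for v
  proof -
    have "K *v (h (A *v v) - v) = h (A *v v) - v"
      by (rule K(3)) (simp add: matrix_vector_mult_diff_distrib h(2))
    then show ?thesis by (simp add: P H matrix_vector_mult_diff_distrib algebra_simps)
  qed
  have PP: "P *v (P *v v) = P *v v" for v
    using K(3)[OF K(2), of v] by (simp add: P matrix_vector_mult_diff_distrib)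
  define G where "G = P ** H ** Q"
  have "A ** G = Q"
  proof -
    have "A *v (H *v (Q *v v)) = Q *v v" for v using Q(2)[of v] h(2) H by auto
    then show ?thesis by (simp add: G_def matrix_eq AP flip: matrix_vector_mul_assoc)
  qed
  moreover have "G ** A = P" by (simp add: G_def matrix_eq Q(3) PH flip: matrix_vector_mul_assoc)
  moreover have "Q ** A = A" by (simp add: matrix_eq Q(3) flip: matrix_vector_mul_assoc)
  moreover have "P ** G = G" by (simp add: G_def matrix_eq PP flip: matrix_vector_mul_assoc)
  ultimately show ?thesis using Q(1) Psym by (auto simp: is_mp_inverse_def)
qed

lemma is_mp_inverse_unique:
  fixes A :: "real^'n^'m"
  assumes "is_mp_inverse A G" "is_mp_inverse A H"
  shows "G = H"
proof -
  note G = assms(1)[unfolded is_mp_inverse_def] and H = assms(2)[unfolded is_mp_inverse_def]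
  have "A ** G = A ** H ** (A ** G)" using H by (metis matrix_mul_assoc)
  also have "\<dots> = transpose (A ** G ** (A ** H))" using G H by (metis matrix_transpose_mul)
  also have "\<dots> = A ** H" using G H by (metis matrix_mul_assoc)
  finally have 1: "A ** G = A ** H" .
  have "G ** A = G ** A ** (H ** A)" using H by (metis matrix_mul_assoc)
  also have "\<dots> = transpose (H ** A ** (G ** A))" using G H by (metis matrix_transpose_mul)
  also have "\<dots> = H ** A" using G H by (metis matrix_mul_assoc)
  finally have 2: "G ** A = H ** A" .
  have "G = H ** A ** G" using G 2 by simp
  also have "\<dots> = H" using H 1 by (metis matrix_mul_assoc)
  finally show ?thesis .
qed

lemma mp_inverse:
  fixes A :: "real^'n^'m"
  shows "A ** mp_inverse A ** A = A" "transpose (mp_inverse A ** A) = mp_inverse A ** A"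
proof -
  have "is_mp_inverse A (THE G. is_mp_inverse A G)"
    by (rule theI') (use is_mp_inverse_exists is_mp_inverse_unique in blast)
  then have "is_mp_inverse A (mp_inverse A)"
    by (simp add: mp_inverse_def is_mp_inverse_def)
  then show "A ** mp_inverse A ** A = A" "transpose (mp_inverse A ** A) = mp_inverse A ** A"
    by (simp_all add: is_mp_inverse_def)
qed

section \<open>The comparative index as the inertia of a triple form\<close>

definition lower :: "real^'c^('r::finite + 's::finite) \<Rightarrow> real^'c^'s"
  where "lower Y = (\<chi> i j. Y $ Inr i $ j)"

text \<open>
  The matrix \<open>w(Y, Y')\<close> of the symplectic form between the columns of two frames; it vanishes for
  \<open>Y' = Y\<close> exactly if the columns of \<open>Y\<close> span an isotropic subspace.
\<close>

definition wronskian :: "real^'m^('m::finite + 'm) \<Rightarrow> real^'m^('m + 'm) \<Rightarrow> real^'m^'m"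
  where "wronskian Y Y' = transpose (upper Y) ** lower Y' - transpose (lower Y) ** upper Y'"

definition lagrangian_frame :: "real^'m^('m::finite + 'm) \<Rightarrow> bool"
  where "lagrangian_frame Y \<longleftrightarrow> wronskian Y Y = 0 \<and> (\<forall>v. upper Y *v v = 0 \<and> lower Y *v v = 0 \<longrightarrow> v = 0)"

lemma sum_UNIV_sum_type: "(\<Sum>i\<in>UNIV. f i) = (\<Sum>i\<in>UNIV. f (Inl i)) + (\<Sum>i\<in>UNIV. f (Inr i))"
  for f :: "('a::finite + 'b::finite) \<Rightarrow> 'c::comm_monoid_add"
  by (simp add: UNIV_Plus_UNIV[symmetric] sum.Plus del: UNIV_Plus_UNIV)

lemma J_mat_simps:
  "J_mat $ Inl i $ Inl j = 0" "J_mat $ Inl i $ Inr j = (if i = j then 1 else 0)"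
  "J_mat $ Inr i $ Inl j = (if i = j then - 1 else 0)" "J_mat $ Inr i $ Inr j = 0"
  by (simp_all add: J_mat_def block_def mat_def)

lemma wronskian_eq: "transpose Y ** J_mat ** Y' = wronskian Y Y'"
  by (simp add: vec_eq_iff matrix_matrix_mult_def wronskian_def transpose_def upper_def lower_def
      sum_UNIV_sum_type J_mat_simps if_distrib[where f = "\<lambda>x. _ * x"] sum_negf algebra_simps cong: if_cong)

lemma inner_wronskian:
  "d \<bullet> (wronskian Y Y' *v c) = (upper Y *v d) \<bullet> (lower Y' *v c) - (lower Y *v d) \<bullet> (upper Y' *v c)"
  by (simp add: wronskian_def matrix_vector_mult_diff_rdistrib inner_diff_right inner_matrix_left
      flip: matrix_vector_mul_assoc)

lemma lagrangian_frame_isotropic: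
  assumes "lagrangian_frame Y"
  shows "(upper Y *v d) \<bullet> (lower Y *v c) = (lower Y *v d) \<bullet> (upper Y *v c)"
  using assms inner_wronskian[of d Y Y c] by (simp add: lagrangian_frame_def)

lemma transpose_eqI:
  assumes "\<And>x y. x \<bullet> (A *v y) = (B *v x) \<bullet> y"
  shows "transpose A = (B :: real^'n^'m)"
proof -
  have "(transpose A *v x) \<bullet> y = (B *v x) \<bullet> y" for x y
    using assms[of x y] inner_matrix_left[of "transpose A" x y] by simp
  then show ?thesis unfolding matrix_eq by (metis vector_eq_rdot)
qed

definition comp_M :: "real^'m^('m::finite + 'm) \<Rightarrow> real^'m^('m + 'm) \<Rightarrow> real^'m^'m"
  where "comp_M Y Y' = (mat 1 - upper Y ** mp_inverse (upper Y)) ** upper Y'"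

definition comp_T :: "real^'m^('m::finite + 'm) \<Rightarrow> real^'m^('m + 'm) \<Rightarrow> real^'m^'m"
  where "comp_T Y Y' = mat 1 - mp_inverse (comp_M Y Y') ** comp_M Y Y'"

definition comp_D :: "real^'m^('m::finite + 'm) \<Rightarrow> real^'m^('m + 'm) \<Rightarrow> real^'m^'m"
  where "comp_D Y Y' =
    comp_T Y Y' ** transpose (wronskian Y Y') ** mp_inverse (upper Y) ** upper Y' ** comp_T Y Y'"

lemma comp_index_eq: "comp_index Y Y' = rank (comp_M Y Y') + neg_index (comp_D Y Y')"
  by (simp add: comp_index_def Let_def comp_M_def comp_T_def comp_D_def wronskian_eq)

lemma comp_M_mult:
  "comp_M Y Y' *v c = upper Y' *v c - upper Y *v (mp_inverse (upper Y) *v (upper Y' *v c))"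
  by (simp add: comp_M_def matrix_vector_mult_diff_rdistrib flip: matrix_vector_mul_assoc)

text \<open>
  So the kernel parametrises the vectors of the second subspace that differ from a vector of the
  first one by a vertical vector.
\<close>

lemma comp_M_kernel_iff:
  "comp_M Y Y' *v c = 0 \<longleftrightarrow> (\<exists>d. upper Y' *v c = upper Y *v d)"
proof
  assume "\<exists>d. upper Y' *v c = upper Y *v d"
  then obtain d where d: "upper Y' *v c = upper Y *v d" ..
  have "upper Y *v (mp_inverse (upper Y) *v (upper Y *v d)) = upper Y *v d"
    using mp_inverse(1)[of "upper Y"] by (metis matrix_vector_mul_assoc)
  then show "comp_M Y Y' *v c = 0" by (simp add: comp_M_mult d)
qed (auto simp: comp_M_mult)

lemma comp_T:
  shows comp_T_kernel: "comp_M Y Y' *v (comp_T Y Y' *v c) = 0"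
    and comp_T_fix: "comp_M Y Y' *v c = 0 \<Longrightarrow> comp_T Y Y' *v c = c"
    and transpose_comp_T: "transpose (comp_T Y Y') = comp_T Y Y'"
proof -
  let ?M = "comp_M Y Y'"
  have T: "comp_T Y Y' *v c = c - mp_inverse ?M *v (?M *v c)" for c
    by (simp add: comp_T_def matrix_vector_mult_diff_rdistrib flip: matrix_vector_mul_assoc)
  have "?M *v (mp_inverse ?M *v (?M *v c)) = ?M *v c"
    using mp_inverse(1)[of ?M] by (metis matrix_vector_mul_assoc)
  then show "?M *v (comp_T Y Y' *v c) = 0" by (simp add: T matrix_vector_mult_diff_distrib)
  show "?M *v c = 0 \<Longrightarrow> comp_T Y Y' *v c = c" by (simp add: T)
  have "transpose (mat 1 - B) = mat 1 - B" if "transpose B = B" for B :: "real^'a^'a"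
    using that by (auto simp: transpose_def vec_eq_iff mat_def)
  then show "transpose (comp_T Y Y') = comp_T Y Y'"
    unfolding comp_T_def using mp_inverse(2)[of ?M] by blast
qed

lemma inner_comp_D:
  "x \<bullet> (comp_D Y Y' *v y) = (wronskian Y Y' *v (comp_T Y Y' *v x)) \<bullet>
    (mp_inverse (upper Y) *v (upper Y' *v (comp_T Y Y' *v y)))"
  by (simp add: comp_D_def inner_matrix_left[of "wronskian Y Y'"] flip: matrix_vector_mul_assoc)
     (metis inner_matrix_left transpose_comp_T)

text \<open>
  Two preimages under \<open>upper Y\<close> differ by a vertical vector of the first subspace. This vector is
  symplectically orthogonal to \<open>Y' e\<close>, the sum of a vector of the first subspace and a vertical one.
  So it does not matter that the pseudoinverse picks a particular preimage.
\<close>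

lemma wronskian_lift:
  assumes Y: "lagrangian_frame Y" and c: "upper Y' *v c = upper Y *v d" 
    and e: "upper Y' *v e = upper Y *v d'"
  shows "(wronskian Y Y' *v e) \<bullet> (mp_inverse (upper Y) *v (upper Y' *v c)) = d \<bullet> (wronskian Y Y' *v e)"
proof -
  define k where "k = mp_inverse (upper Y) *v (upper Y' *v c) - d"
  have "upper Y *v (mp_inverse (upper Y) *v (upper Y *v d)) = upper Y *v d"
    using mp_inverse(1)[of "upper Y"] by (metis matrix_vector_mul_assoc)
  then have k: "upper Y *v k = 0" by (simp add: k_def c matrix_vector_mult_diff_distrib)
  have "k \<bullet> (wronskian Y Y' *v e) = 0"
    using lagrangian_frame_isotropic[OF Y, of k d'] by (simp add: inner_wronskian k e)
  then show ?thesis by (simp add: k_def inner_diff_left inner_diff_right inner_commute)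
qed

lemma comp_T_lift: "\<exists>d. upper Y' *v (comp_T Y Y' *v x) = upper Y *v d"
  using comp_T_kernel comp_M_kernel_iff by metis

text \<open>
  For \<open>y = Y d\<close>, \<open>y' = Y' c\<close> with \<open>y' - y\<close> vertical, the form is the symplectic product of \<open>y\<close>
  and \<open>y'\<close>. Its symmetry follows from the isotropy of both subspaces and of the vertical one.
\<close>

lemma transpose_comp_D:
  assumes Y: "lagrangian_frame Y" and Y': "lagrangian_frame Y'"
  shows "transpose (comp_D Y Y') = comp_D Y Y'"
proof (rule transpose_eqI)
  fix x y
  obtain dx dy where dx: "upper Y' *v (comp_T Y Y' *v x) = upper Y *v dx"
    and dy: "upper Y' *v (comp_T Y Y' *v y) = upper Y *v dy"
    using comp_T_lift by metis
  let ?x = "comp_T Y Y' *v x" and ?y = "comp_T Y Y' *v y"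
  have "x \<bullet> (comp_D Y Y' *v y) = dy \<bullet> (wronskian Y Y' *v ?x)"
    using inner_comp_D[of x Y Y' y] wronskian_lift[OF Y dy dx] by simp
  also have "\<dots> = dx \<bullet> (wronskian Y Y' *v ?y)"
    using lagrangian_frame_isotropic[OF Y, of dx dy] lagrangian_frame_isotropic[OF Y', of ?x ?y]
    by (simp add: inner_wronskian dx dy inner_commute)
  also have "\<dots> = y \<bullet> (comp_D Y Y' *v x)"
    using inner_comp_D[of y Y Y' x] wronskian_lift[OF Y dx dy] by simp
  finally show "x \<bullet> (comp_D Y Y' *v y) = (comp_D Y Y' *v x) \<bullet> y" by (simp add: inner_commute)
qed

text \<open>
  Kashiwara's quadratic form of the three Lagrangian subspaces spanned by \<open>Y\<close>, \<open>Y'\<close> and the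
  vertical vectors: the symplectic products of the pairs taken from \<open>Y d\<close>, \<open>Y' c\<close> and the vertical
  vector with lower part \<open>e\<close>.
\<close>

definition triple_form :: "real^'m^('m::finite + 'm) \<Rightarrow> real^'m^('m + 'm) \<Rightarrow>
    ((real^'m) \<times> (real^'m)) \<times> (real^'m) \<Rightarrow> real"
  where "triple_form Y Y' = (\<lambda>((c, d), e).
    d \<bullet> (wronskian Y Y' *v c) + e \<bullet> (upper Y' *v c - upper Y *v d))"

text \<open>
  The triple form is the form \<open>d \<bullet> (w(Y, Y') c)\<close> bordered by the condition that \<open>Y' c - Y d\<close> is
  vertical. On the solutions of this condition it is the form of \<open>comp_D\<close>, and the condition has
  rank \<open>rank (upper Y) + rank (comp_M Y Y')\<close>.
\<close>

lemma comp_index_plus_rank: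
  fixes Y Y' :: "real^'m^('m::finite + 'm)"
  assumes Y: "lagrangian_frame Y" and Y': "lagrangian_frame Y'"
  shows "comp_index Y Y' + rank (upper Y) = neg_dim (triple_form Y Y') UNIV"
proof -
  define B where "B p p' = (snd p \<bullet> (wronskian Y Y' *v fst p') + snd p' \<bullet> (wronskian Y Y' *v fst p)) / 2" for p p'
  define L where "L p = upper Y' *v fst p - upper Y *v snd p" for p
  have B: "symmetric_bilinear B"
    unfolding symmetric_bilinear_def
  proof (intro conjI allI)
    show "linear (\<lambda>x. B x y)" for y
      by (rule linearI) (simp_all add: B_def inner_add_left inner_add_right matrix_vector_right_distrib
          matrix_vector_mult_scaleR add_divide_distrib algebra_simps)
    show "B x y = B y x" for x y by (simp add: B_def)
  qed
  have L: "linear L"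
    by (rule linearI) (simp_all add: L_def matrix_vector_right_distrib matrix_vector_mult_scaleR algebra_simps)
  have "triple_form Y Y' = (\<lambda>(x, e). B x x + e \<bullet> L x)"
    by (auto simp: triple_form_def B_def L_def fun_eq_iff)
  then have "neg_dim (triple_form Y Y') UNIV = neg_dim (\<lambda>x. B x x) {x. L x = 0} + dim (range L)"
    using neg_dim_bordered[OF B L] by simp
  moreover have "dim (range L) = rank (upper Y) + rank (comp_M Y Y')"
  proof -
    let ?X = "range ((*v) (upper Y))" and ?M = "range ((*v) (comp_M Y Y'))"
    have sub: "subspace ?X" "subspace ?M"
      by (intro linear_subspace_image matrix_vector_mul_linear subspace_UNIV)+
    have "range L = {x + y |x y. x \<in> ?X \<and> y \<in> ?M}"
    proof (intro equalityI subsetI)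
      fix z assume "z \<in> range L"
      then obtain p where "z = L p" by auto
      then have "z = upper Y *v (mp_inverse (upper Y) *v (upper Y' *v fst p) - snd p) + comp_M Y Y' *v fst p"
        by (simp add: L_def comp_M_mult matrix_vector_mult_diff_distrib)
      then show "z \<in> {x + y |x y. x \<in> ?X \<and> y \<in> ?M}" by blast
    next
      fix z assume "z \<in> {x + y |x y. x \<in> ?X \<and> y \<in> ?M}"
      then obtain a c where "z = upper Y *v a + comp_M Y Y' *v c" by auto
      then have "z = L (c, mp_inverse (upper Y) *v (upper Y' *v c) - a)"
        by (simp add: L_def comp_M_mult matrix_vector_mult_diff_distrib)
      then show "z \<in> range L" by blast
    qed
    moreover have "?X \<inter> ?M = {0}"
    proof -
      have "x = 0" if "x = upper Y *v a" "x = comp_M Y Y' *v c" for x a c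
      proof -
        have "upper Y' *v c = upper Y *v (a + mp_inverse (upper Y) *v (upper Y' *v c))"
          using that by (simp add: comp_M_mult matrix_vector_right_distrib algebra_simps)
        then show ?thesis using that comp_M_kernel_iff by metis
      qed
      then have "?X \<inter> ?M \<subseteq> {0}" by blast
      then show ?thesis using subspace_0[OF sub(1)] subspace_0[OF sub(2)] by blast
    qed
    ultimately show ?thesis using dim_sums_Int[OF sub] by (simp add: rank_dim_range)
  qed
  moreover have "neg_dim (\<lambda>x. B x x) {x. L x = 0} = neg_index (comp_D Y Y')"
  proof -
    have "neg_dim (\<lambda>x. B x x) {x. L x = 0} = neg_dim (quad (comp_D Y Y')) (fst ` {x. L x = 0})"
    proof (rule neg_dim_image[OF linear_fst linear_subspace_kernel[OF L]])
      fix p assume "p \<in> {x. L x = 0}"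
      then have p: "upper Y' *v fst p = upper Y *v snd p" by (simp add: L_def)
      then have "comp_T Y Y' *v fst p = fst p" using comp_M_kernel_iff comp_T_fix by metis
      then have "quad (comp_D Y Y') (fst p) = snd p \<bullet> (wronskian Y Y' *v fst p)"
        unfolding quad_def using inner_comp_D[of "fst p" Y Y' "fst p"] wronskian_lift[OF Y p p] p by simp
      then show "B p p = quad (comp_D Y Y') (fst p)" by (simp add: B_def)
    qed (simp add: quad_def)
    also have "fst ` {x. L x = 0} = range ((*v) (comp_T Y Y'))"
    proof (intro equalityI subsetI)
      fix c assume "c \<in> fst ` {x. L x = 0}"
      then have "comp_M Y Y' *v c = 0" by (auto simp: comp_M_kernel_iff L_def)
      then have "c = comp_T Y Y' *v c" by (simp add: comp_T_fix)
      then show "c \<in> range ((*v) (comp_T Y Y'))" by (rule range_eqI)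
    next
      fix c assume "c \<in> range ((*v) (comp_T Y Y'))"
      then obtain d where "upper Y' *v c = upper Y *v d" using comp_T_lift by blast
      then show "c \<in> fst ` {x. L x = 0}" by (intro image_eqI[of _ _ "(c, d)"]) (simp_all add: L_def)
    qed
    also have "neg_dim (quad (comp_D Y Y')) (range ((*v) (comp_T Y Y'))) = neg_inertia (comp_D Y Y')"
    proof (rule neg_dim_image[symmetric, OF matrix_vector_mul_linear subspace_UNIV])
      have TT: "comp_T Y Y' *v (comp_T Y Y' *v x) = comp_T Y Y' *v x" for x
        by (rule comp_T_fix[OF comp_T_kernel])
      show "quad (comp_D Y Y') x = quad (comp_D Y Y') (comp_T Y Y' *v x)" for x
        by (simp add: quad_def inner_comp_D TT)
    qed (simp add: quad_def)
    also have "\<dots> = neg_index (comp_D Y Y')"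
      by (rule neg_index_eq_neg_inertia[OF transpose_comp_D[OF Y Y'], symmetric])
    finally show ?thesis .
  qed
  ultimately show ?thesis by (simp add: comp_index_eq)
qed

text \<open>
  The form of \<open>comp_D\<close> lives on the kernel of \<open>comp_M\<close> and vanishes on the smaller kernel of
  \<open>upper Y'\<close>.
\<close>

lemma comp_index_le_rank:
  fixes Y Y' :: "real^'m^('m::finite + 'm)"
  assumes Y: "lagrangian_frame Y" and Y': "lagrangian_frame Y'"
  shows "comp_index Y Y' \<le> rank (upper Y')"
proof -
  let ?D = "comp_D Y Y'" and ?M = "comp_M Y Y'"
  note sym = transpose_comp_D[OF Y Y']
  let ?S = "{c. ?M *v c = 0}"
  have S: "subspace ?S" by (intro linear_subspace_kernel matrix_vector_mul_linear)
  obtain W where W: "subspace W" "neg_def_on (quad ?D) W" "dim W = neg_inertia ?D"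
    using neg_dim_attained[OF subspace_UNIV, of "quad ?D"] by auto
  have B: "symmetric_bilinear (\<lambda>x y. x \<bullet> (?D *v y))" by (rule symmetric_bilinear_matrix[OF sym])
  define C where "C = {c. upper Y' *v (comp_T Y Y' *v c) = 0}"
  have Csub: "subspace C"
    unfolding C_def using linear_subspace_kernel[OF matrix_vector_mul_linear, of "upper Y' ** comp_T Y Y'"]
    by (simp flip: matrix_vector_mul_assoc)
  have "dim W + dim C \<le> dim (UNIV :: (real^'m) set)"
  proof (rule dim_neg_plus_nonneg_le(2)[OF B subspace_UNIV W(1) _ _ Csub])
    show "neg_def_on (\<lambda>v. v \<bullet> (?D *v v)) W" using W(2) by (simp add: quad_def[abs_def])
    show "0 \<le> v \<bullet> (?D *v v)" if "v \<in> C" for v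
      using that by (simp add: C_def comp_D_def flip: matrix_vector_mul_assoc)
  qed auto
  moreover have "dim C + rank (upper Y' ** comp_T Y Y') = CARD('m)"
    using rank_plus_dim_kernel[of "upper Y' ** comp_T Y Y'"] by (simp add: C_def flip: matrix_vector_mul_assoc)
  moreover have "rank (upper Y' ** comp_T Y Y') = dim ((*v) (upper Y') ` ?S)"
  proof -
    have "range ((*v) (comp_T Y Y')) = ?S"
    proof (intro equalityI subsetI)
      fix c assume "c \<in> ?S"
      then have "c = comp_T Y Y' *v c" by (simp add: comp_T_fix)
      then show "c \<in> range ((*v) (comp_T Y Y'))" by (rule range_eqI)
    qed (auto simp: comp_T_kernel)
    then have "range ((*v) (upper Y' ** comp_T Y Y')) = (*v) (upper Y') ` ?S"
      by (metis image_comp matrix_vector_mult_matrix_matrix_mult_compose)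
    then show ?thesis by (simp add: rank_dim_range)
  qed
  moreover have "dim {c\<in>?S. upper Y' *v c = 0} + dim ((*v) (upper Y') ` ?S) = dim ?S"
    by (rule dim_kernel_plus_range[OF matrix_vector_mul_linear S])
  moreover have "{c\<in>?S. upper Y' *v c = 0} = {c. upper Y' *v c = 0}"
    by (auto simp: comp_M_mult)
  moreover note rank_plus_dim_kernel[of "upper Y'"] rank_plus_dim_kernel[of ?M]
  ultimately have "rank ?M + dim W \<le> rank (upper Y')" by simp
  then show ?thesis using W(3) neg_index_eq_neg_inertia[OF sym] by (simp add: comp_index_eq)
qed

section \<open>Charts for Lagrangian subspaces\<close>

lemma matrix_inv:
  fixes A :: "real^'n^'n"
  assumes "invertible A"
  shows "A ** matrix_inv A = mat 1" "matrix_inv A ** A = mat 1"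
    "A *v (matrix_inv A *v v) = v" "matrix_inv A *v (A *v v) = v"
proof -
  show 1: "A ** matrix_inv A = mat 1" "matrix_inv A ** A = mat 1"
    using someI_ex[OF assms[unfolded invertible_def]] unfolding matrix_inv_def by auto
  show "A *v (matrix_inv A *v v) = v" "matrix_inv A *v (A *v v) = v"
    using 1 by (simp_all add: matrix_vector_mul_assoc)
qed

lemma rank_invertible_mult:
  fixes A :: "real^'n^'n" and B :: "real^'m^'n"
  assumes "invertible A"
  shows "rank (A ** B) = rank B"
proof (rule antisym[OF rank_mul_le_right])
  have "rank B = rank (matrix_inv A ** (A ** B))"
    by (simp add: matrix_mul_assoc matrix_inv[OF assms])
  then show "rank B \<le> rank (A ** B)" using rank_mul_le_right by metis
qed

lemma rank_mult_invertible:
  fixes A :: "real^'n^'n" and B :: "real^'n^'m"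
  assumes "invertible A"
  shows "rank (B ** A) = rank B"
  by (metis assms transpose_invertible matrix_transpose_mul rank_invertible_mult rank_transpose)

definition chart_den :: "real \<Rightarrow> real^'m^('m::finite + 'm) \<Rightarrow> real^'m^'m"
  where "chart_den c Y = lower Y + c *\<^sub>R upper Y"

text \<open>
  The shear \<open>(x, u) \<mapsto> (x, u + c x)\<close> fixes the vertical vectors. If the sheared subspace is the
  graph of a symmetric matrix over the \<open>u\<close>-coordinates, this is that matrix; the vertical subspace
  has the matrix \<open>0\<close>.
\<close>

definition chart :: "real \<Rightarrow> real^'m^('m::finite + 'm) \<Rightarrow> real^'m^'m"
  where "chart c Y = upper Y ** matrix_inv (chart_den c Y)"

lemma chart_den_mult: "chart_den c Y *v v = lower Y *v v + c *\<^sub>R (upper Y *v v)"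
  by (simp add: chart_den_def matrix_vector_mult_add_rdistrib scaleR_matrix_vector_assoc)

text \<open>
  Vectors in the kernels for different \<open>c\<close> have \<open>x\<close>-parts that are nonzero and, by isotropy,
  mutually orthogonal, so at most as many \<open>c\<close> as the dimension are excluded.
\<close>

lemma finite_singular_charts:
  fixes Y :: "real^'m^('m::finite + 'm)"
  assumes Y: "lagrangian_frame Y"
  shows "finite {c. \<not> invertible (chart_den c Y)}"
proof -
  let ?S = "{c. \<not> invertible (chart_den c Y)}"
  have "\<exists>v. v \<noteq> 0 \<and> chart_den c Y *v v = 0" if "c \<in> ?S" for c
    using that by (metis (mono_tags) invertible_left_inverse matrix_left_invertible_ker mem_Collect_eq)
  then obtain v where v: "\<And>c. c \<in> ?S \<Longrightarrow> v c \<noteq> 0" "\<And>c. c \<in> ?S \<Longrightarrow> chart_den c Y *v v c = 0" by metis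
  define x where "x c = upper Y *v v c" for c
  have low: "lower Y *v v c = - c *\<^sub>R x c" if "c \<in> ?S" for c
    using v(2)[OF that] by (simp add: chart_den_mult x_def add_eq_0_iff2)
  have x0: "x c \<noteq> 0" if "c \<in> ?S" for c
  proof
    assume "x c = 0"
    then have "upper Y *v v c = 0" "lower Y *v v c = 0" using low[OF that] by (simp_all add: x_def)
    then have "v c = 0" using Y unfolding lagrangian_frame_def by blast
    then show False using v(1)[OF that] by simp
  qed
  have orth: "x c \<bullet> x d = 0" if "c \<in> ?S" "d \<in> ?S" "c \<noteq> d" for c d
  proof -
    have "x c \<bullet> (- d *\<^sub>R x d) = (- c *\<^sub>R x c) \<bullet> x d"
      using lagrangian_frame_isotropic[OF Y, of "v c" "v d"] low that by (simp add: x_def)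
    then show ?thesis using that by simp
  qed
  have inj: "inj_on x ?S"
  proof (rule inj_onI, rule ccontr)
    fix c d assume cd: "c \<in> ?S" "d \<in> ?S" "x c = x d" "c \<noteq> d"
    then have "x c \<bullet> x c = 0" using orth[OF cd(1,2,4)] by simp
    then show False using x0[OF cd(1)] by simp
  qed
  have "independent (x ` ?S)"
    by (rule pairwise_orthogonal_independent) (use orth x0 in \<open>auto simp: pairwise_def orthogonal_def\<close>)
  then have "finite (x ` ?S)" by (rule independent_imp_finite)
  then show ?thesis using inj by (rule finite_imageD)
qed

lemma common_chart:
  assumes "lagrangian_frame Y" "lagrangian_frame Y'"
  obtains c where "invertible (chart_den c Y)" "invertible (chart_den c Y')"
proof -
  have "finite ({c. \<not> invertible (chart_den c Y)} \<union> {c. \<not> invertible (chart_den c Y')})"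
    using assms by (simp add: finite_singular_charts)
  then obtain c where "c \<notin> {c. \<not> invertible (chart_den c Y)} \<union> {c. \<not> invertible (chart_den c Y')}"
    using ex_new_if_finite infinite_UNIV_char_0 by blast
  then show ?thesis using that by auto
qed

lemma chart_vec:
  assumes "invertible (chart_den c Y)"
  shows "upper Y *v (matrix_inv (chart_den c Y) *v v) = chart c Y *v v"
    "lower Y *v (matrix_inv (chart_den c Y) *v v) = v - c *\<^sub>R (chart c Y *v v)"
proof -
  show 1: "upper Y *v (matrix_inv (chart_den c Y) *v v) = chart c Y *v v"
    by (simp add: chart_def matrix_vector_mul_assoc)
  show "lower Y *v (matrix_inv (chart_den c Y) *v v) = v - c *\<^sub>R (chart c Y *v v)"
    using matrix_inv(3)[OF assms, of v] by (simp add: chart_den_mult 1 algebra_simps)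
qed

lemma transpose_chart:
  assumes "lagrangian_frame Y" "invertible (chart_den c Y)"
  shows "transpose (chart c Y) = chart c Y"
proof (rule transpose_eqI)
  fix x y
  show "x \<bullet> (chart c Y *v y) = (chart c Y *v x) \<bullet> y"
    using lagrangian_frame_isotropic[OF assms(1), of "matrix_inv (chart_den c Y) *v x" "matrix_inv (chart_den c Y) *v y"]
    by (simp add: chart_vec[OF assms(2)] inner_diff_left inner_diff_right)
qed

text \<open>
  In a chart the symplectic product of two Lagrangian subspaces is the difference of their
  matrices, so intersections become kernels of symmetric matrices.
\<close>

lemma wronskian_chart:
  assumes Y: "lagrangian_frame Y" "invertible (chart_den c Y)" and Y': "invertible (chart_den c Y')"
  shows "(matrix_inv (chart_den c Y) *v v) \<bullet> (wronskian Y Y' *v (matrix_inv (chart_den c Y') *v w))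
    = v \<bullet> ((chart c Y - chart c Y') *v w)"
  by (simp add: inner_wronskian chart_vec[OF Y(2)] chart_vec[OF Y'] inner_diff_left inner_diff_right
      inner_matrix_symmetric[OF transpose_chart[OF Y]] matrix_vector_mult_diff_rdistrib)

lemma chart_diff:
  assumes "lagrangian_frame Y" "invertible (chart_den c Y)" "invertible (chart_den c Y')"
  shows "chart c Y - chart c Y' =
    transpose (matrix_inv (chart_den c Y)) ** wronskian Y Y' ** matrix_inv (chart_den c Y')" (is "_ = ?R")
proof -
  have "v \<bullet> ((chart c Y - chart c Y') *v w) = v \<bullet> (?R *v w)" for v w
    using wronskian_chart[OF assms, of v w] by (simp add: inner_matrix_left flip: matrix_vector_mul_assoc)
  then show ?thesis unfolding matrix_eq by (metis vector_eq_ldot)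
qed

lemma invertible_matrix_inv: "invertible A \<Longrightarrow> invertible (matrix_inv A)" for A :: "real^'n^'n"
  using matrix_inv(1,2)[of A] unfolding invertible_def by blast

lemma rank_chart: "invertible (chart_den c Y) \<Longrightarrow> rank (chart c Y) = rank (upper Y)"
  by (simp add: chart_def rank_mult_invertible invertible_matrix_inv)

lemma rank_chart_diff:
  assumes "lagrangian_frame Y" "invertible (chart_den c Y)" "invertible (chart_den c Y')"
  shows "rank (chart c Y - chart c Y') = rank (wronskian Y Y')"
  by (simp add: chart_diff assms rank_mult_invertible rank_invertible_mult invertible_matrix_inv
      transpose_invertible)

text \<open>
  In a chart the triple form for the matrices \<open>Q\<close>, \<open>P\<close>, \<open>0\<close> is
  \<open>d \<bullet> (R\<^sub>1 c) + c \<bullet> (R\<^sub>2 e) + e \<bullet> (R\<^sub>3 d)\<close> with the differences \<open>R\<^sub>1 = Q - P\<close>, \<open>R\<^sub>2 = P\<close>, \<open>R\<^sub>3 = - Q\<close>.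
  Since \<open>R\<^sub>1 + R\<^sub>2 + R\<^sub>3 = 0\<close>, the substitution \<open>d = \<alpha> + \<beta>\<close>, \<open>c = \<beta> + \<gamma>\<close>, \<open>e = \<gamma> + \<alpha>\<close> makes all mixed
  terms cancel and splits the form into \<open>\<beta> \<bullet> (R\<^sub>1 \<beta>) + \<gamma> \<bullet> (R\<^sub>2 \<gamma>) + \<alpha> \<bullet> (R\<^sub>3 \<alpha>)\<close>.
\<close>

lemma comp_index_chart:
  fixes Y Y' :: "real^'m^('m::finite + 'm)"
  assumes Y: "lagrangian_frame Y" "invertible (chart_den c Y)"
    and Y': "lagrangian_frame Y'" "invertible (chart_den c Y')"
  shows "comp_index Y Y' + neg_inertia (chart c Y) =
    neg_inertia (chart c Y - chart c Y') + neg_inertia (chart c Y')"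
proof -
  let ?Q = "chart c Y" and ?P = "chart c Y'" and ?V = "chart_den c Y" and ?W = "chart_den c Y'"
  note Q = transpose_chart[OF Y] and P = transpose_chart[OF Y']
  have diff_sym: "transpose (A - B) = A - B" if "transpose A = A" "transpose B = B" for A B :: "real^'m^'m"
    using that by (simp add: transpose_def vec_eq_iff)
  have sym: "transpose (?Q - ?P) = ?Q - ?P" "transpose (- ?Q) = - ?Q"
    using diff_sym[OF Q P] Q by (simp_all add: transpose_def vec_eq_iff)
  have wr: "d \<bullet> (wronskian Y Y' *v e) = (?V *v d) \<bullet> ((?Q - ?P) *v (?W *v e))" for d e
    using wronskian_chart[OF Y Y'(2), of "?V *v d" "?W *v e"] by (simp add: matrix_inv Y Y')
  define g where "g z = (case z of ((a, b), e) \<Rightarrow>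
    ((matrix_inv ?W *v (b + e), matrix_inv ?V *v (a + b)), e + a))" for z :: "((real^'m) \<times> (real^'m)) \<times> (real^'m)"
  have g: "linear g"
    by (rule linearI) (auto simp: g_def matrix_vector_right_distrib matrix_vector_mult_scaleR algebra_simps)
  have surj_g: "range g = UNIV"
  proof (rule surjI)
    fix z :: "((real^'m) \<times> (real^'m)) \<times> (real^'m)"
    obtain x y e where z: "z = ((x, y), e)" by (metis surj_pair)
    let ?x = "?W *v x" and ?y = "?V *v y"
    have h: "(1/2) *\<^sub>R v + (1/2) *\<^sub>R v = v" for v :: "real^'m" by (simp flip: scaleR_add_left)
    have s: "(1/2) *\<^sub>R (?x + ?y - e) + (1/2) *\<^sub>R (?x + e - ?y) = ?x"
      "(1/2) *\<^sub>R (?y + e - ?x) + (1/2) *\<^sub>R (?x + ?y - e) = ?y"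
      "(1/2) *\<^sub>R (?x + e - ?y) + (1/2) *\<^sub>R (?y + e - ?x) = e"
      using h[of ?x] h[of ?y] h[of e] by (simp_all add: algebra_simps)
    show "g (case z of ((x, y), e) \<Rightarrow> (((1/2) *\<^sub>R (?V *v y + e - ?W *v x), (1/2) *\<^sub>R (?W *v x + ?V *v y - e)),
        (1/2) *\<^sub>R (?W *v x + e - ?V *v y))) = z"
      by (simp add: z g_def s matrix_inv Y Y')
  qed
  have tri: "triple_form Y Y' (g ((a, b), e)) = (a \<bullet> (- ?Q *v a) + b \<bullet> ((?Q - ?P) *v b)) + e \<bullet> (?P *v e)" for a b e
  proof -
    have "triple_form Y Y' (g ((a, b), e)) =
      (a + b) \<bullet> ((?Q - ?P) *v (b + e)) + (e + a) \<bullet> (?P *v (b + e) - ?Q *v (a + b))"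
      by (simp add: triple_form_def g_def wr matrix_inv Y Y' chart_vec)
    also have "\<dots> = - (a \<bullet> (?Q *v a)) + (b \<bullet> (?Q *v b) - b \<bullet> (?P *v b)) + e \<bullet> (?P *v e)
        + (b \<bullet> (?Q *v e) - e \<bullet> (?Q *v b)) + (e \<bullet> (?P *v b) - b \<bullet> (?P *v e)) - (e \<bullet> (?Q *v a) - a \<bullet> (?Q *v e))"
      by (simp add: matrix_vector_mult_diff_rdistrib matrix_vector_right_distrib inner_add_left inner_add_right
          inner_diff_left inner_diff_right)
    finally show ?thesis
      using inner_matrix_symmetric[OF Q, of b e] inner_matrix_symmetric[OF P, of b e] inner_matrix_symmetric[OF Q, of a e]
      by (simp add: matrix_vector_mult_diff_rdistrib uminus_matrix_vector_mult inner_diff_right inner_commute)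
  qed
  let ?B1 = "\<lambda>x y. x \<bullet> (- ?Q *v y)" and ?B2 = "\<lambda>x y. x \<bullet> ((?Q - ?P) *v y)" and ?B3 = "\<lambda>x y. x \<bullet> (?P *v y)"
  let ?B = "\<lambda>v w. ?B1 (fst v) (fst w) + ?B2 (snd v) (snd w)"
  note B1 = symmetric_bilinear_matrix[OF sym(2)] and B2 = symmetric_bilinear_matrix[OF sym(1)] and B3 = symmetric_bilinear_matrix[OF P]
  have "neg_dim (triple_form Y Y') UNIV = neg_dim (\<lambda>(x, e). ?B x x + ?B3 e e) UNIV"
    using neg_dim_image[OF g subspace_UNIV, of "\<lambda>(x, e). ?B x x + ?B3 e e" "triple_form Y Y'"] tri surj_g
    by (auto simp: triple_form_def zero_prod_def)
  also have "\<dots> = neg_dim (\<lambda>x. ?B x x) UNIV + neg_inertia ?P"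
    using neg_dim_sum[OF symmetric_bilinear_sum[OF B1 B2] B3] by (simp add: quad_def[abs_def])
  also have "neg_dim (\<lambda>x. ?B x x) UNIV = neg_inertia (- ?Q) + neg_inertia (?Q - ?P)"
    using neg_dim_sum[OF B1 B2] by (simp add: quad_def[abs_def] case_prod_unfold)
  finally have "comp_index Y Y' + rank (upper Y) = neg_inertia (- ?Q) + neg_inertia (?Q - ?P) + neg_inertia ?P"
    using comp_index_plus_rank[OF Y(1) Y'(1)] by simp
  moreover have "rank (upper Y) = neg_inertia ?Q + neg_inertia (- ?Q)"
    using rank_eq_inertia_sum[OF Q] rank_chart[OF Y(2)] by simp
  ultimately show ?thesis by simp
qed

section \<open>Drops of rank functions\<close>

definition drop_at :: "(real \<Rightarrow> nat) \<Rightarrow> real \<Rightarrow> int"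
  where "drop_at r u = int (Lim (at_left u) r) - int (r u)"

definition jumps :: "(real \<Rightarrow> nat) \<Rightarrow> real \<Rightarrow> real \<Rightarrow> int"
  where "jumps r s t = (\<Sum>u\<in>{u. s < u \<and> u \<le> t \<and> drop_at r u \<noteq> 0}. drop_at r u)"

text \<open>
  Finitely many drops, none of them negative. A left-hand limit in a discrete space exists exactly
  if the function is eventually constant.
\<close>

definition step_on :: "(real \<Rightarrow> nat) \<Rightarrow> real \<Rightarrow> real \<Rightarrow> bool"
  where "step_on r s t \<longleftrightarrow> finite {u. s < u \<and> u \<le> t \<and> drop_at r u \<noteq> 0} \<and>
    (\<forall>u. s < u \<and> u \<le> t \<longrightarrow> (\<exists>l\<ge>r u. eventually (\<lambda>v. r v = l) (at_left u)))"

lemma Lim_at_left_eventually: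
  fixes u :: real and r :: "real \<Rightarrow> nat"
  assumes "eventually (\<lambda>v. r v = l) (at_left u)"
  shows "Lim (at_left u) r = l"
  using assms by (intro tendsto_Lim tendsto_eventually) (auto simp: trivial_limit_at_left_real)

lemma drop_at_eq:
  assumes "eventually (\<lambda>v. r v = l) (at_left u)"
  shows "drop_at r u = int l - int (r u)"
  using Lim_at_left_eventually[OF assms] by (simp add: drop_at_def)

lemma drop_at_nonneg:
  assumes "step_on r s t" "s < u" "u \<le> t"
  shows "0 \<le> drop_at r u"
proof -
  obtain l where "l \<ge> r u" "eventually (\<lambda>v. r v = l) (at_left u)"
    using assms by (auto simp: step_on_def)
  then show ?thesis using drop_at_eq by simp
qed

lemma jumps_nonneg: "step_on r s t \<Longrightarrow> 0 \<le> jumps r s t"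
  unfolding jumps_def by (intro sum_nonneg drop_at_nonneg) auto

lemma jumps_eq_0_iff:
  assumes "step_on r s t"
  shows "jumps r s t = 0 \<longleftrightarrow> (\<forall>u. s < u \<and> u \<le> t \<longrightarrow> drop_at r u = 0)"
proof -
  have "jumps r s t = 0 \<longleftrightarrow> (\<forall>u\<in>{u. s < u \<and> u \<le> t \<and> drop_at r u \<noteq> 0}. drop_at r u = 0)"
    unfolding jumps_def using assms drop_at_nonneg[OF assms]
    by (intro sum_nonneg_eq_0_iff) (auto simp: step_on_def)
  then show ?thesis by blast
qed

lemma jumps_concat:
  assumes "step_on r s t" "step_on r t u" "s \<le> t" "t \<le> u"
  shows "step_on r s u" "jumps r s u = jumps r s t + jumps r t u"
proof -
  let ?A = "{v. s < v \<and> v \<le> t \<and> drop_at r v \<noteq> 0}" and ?B = "{v. t < v \<and> v \<le> u \<and> drop_at r v \<noteq> 0}"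
  have un: "{v. s < v \<and> v \<le> u \<and> drop_at r v \<noteq> 0} = ?A \<union> ?B" using assms(3,4) by auto
  have fin: "finite ?A" "finite ?B" using assms by (auto simp: step_on_def)
  have "\<exists>l\<ge>r v. eventually (\<lambda>w. r w = l) (at_left v)" if "s < v" "v \<le> u" for v
    using assms(1,2) that by (cases "v \<le> t") (auto simp: step_on_def)
  then show "step_on r s u" using un fin by (auto simp: step_on_def)
  show "jumps r s u = jumps r s t + jumps r t u"
    unfolding jumps_def un using fin by (intro sum.union_disjoint) auto
qed

text \<open>
  Here \<open>n\<^sub>1\<close> and \<open>n\<^sub>2\<close> stand for the numbers of negative and positive eigenvalues of a nondecreasing
  symmetric matrix. Monotonicity and semicontinuity together make \<open>n\<^sub>1\<close> continuous from the right
  and \<open>n\<^sub>2\<close> continuous from the left. So the left-hand drop of \<open>n\<^sub>1 + n\<^sub>2\<close> is that of \<open>n\<^sub>1\<close>, and \<open>n\<^sub>1\<close>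
  changes in no other way.
\<close>

lemma jumps_of_inertia:
  fixes n\<^sub>1 n\<^sub>2 :: "real \<Rightarrow> nat"
  assumes "s \<le> t"
    and r: "\<And>u. u \<in> {s..t} \<Longrightarrow> r u = n\<^sub>1 u + n\<^sub>2 u"
    and anti: "\<And>u v. s \<le> u \<Longrightarrow> u \<le> v \<Longrightarrow> v \<le> t \<Longrightarrow> n\<^sub>1 v \<le> n\<^sub>1 u"
    and mono: "\<And>u v. s \<le> u \<Longrightarrow> u \<le> v \<Longrightarrow> v \<le> t \<Longrightarrow> n\<^sub>2 u \<le> n\<^sub>2 v"
    and lsc: "\<And>u. u \<in> {s..t} \<Longrightarrow> eventually (\<lambda>v. n\<^sub>1 u \<le> n\<^sub>1 v \<and> n\<^sub>2 u \<le> n\<^sub>2 v) (at u within {s..t})"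
  shows "step_on r s t \<and> jumps r s t = int (n\<^sub>1 s) - int (n\<^sub>1 t)"
proof -
  define P where "P a b \<longleftrightarrow> s \<le> a \<and> b \<le> t \<longrightarrow> step_on r a b \<and> jumps r a b = int (n\<^sub>1 a) - int (n\<^sub>1 b)" for a b
  have "P s t"
    using \<open>s \<le> t\<close>
  proof (induction rule: Bolzano)
    case (trans a b c)
    then show ?case using jumps_concat[of r a b c] by (auto simp: P_def)
  next
    case (local x)
    then have x: "x \<in> {s..t}" by auto
    \<comment> \<open>Near \<open>x\<close> three things hold: semicontinuity at \<open>x\<close> (\<open>d1\<close>), constancy of \<open>n\<^sub>1\<close> to the left
      (\<open>d2\<close>) and of \<open>n\<^sub>2\<close> to the right (\<open>d3\<close>), as monotone bounded functions into \<open>nat\<close> have limits.\<close>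
    obtain d1 where d1: "d1 > 0" "\<And>v. v \<in> {s..t} \<Longrightarrow> dist v x < d1 \<Longrightarrow> n\<^sub>1 x \<le> n\<^sub>1 v \<and> n\<^sub>2 x \<le> n\<^sub>2 v"
      using lsc[OF x] unfolding eventually_at by (metis order_refl)
    have "\<exists>d>0. \<exists>L. \<forall>v. s \<le> v \<and> x - d < v \<and> v < x \<longrightarrow> n\<^sub>1 v = L"
    proof (cases "s < x")
      case True
      then obtain w where w: "s \<le> w \<and> w < x" "\<And>v. s \<le> v \<and> v < x \<Longrightarrow> n\<^sub>1 w \<le> n\<^sub>1 v"
        using ex_has_least_nat[of "\<lambda>v. s \<le> v \<and> v < x" s n\<^sub>1] by auto
      have "n\<^sub>1 v = n\<^sub>1 w" if "s \<le> v" "x - (x - w) < v" "v < x" for v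
        using w(2)[of v] anti[of w v] that w(1) local by force
      then show ?thesis using w(1) by (intro exI[of _ "x - w"]) auto
    qed (auto intro!: exI[of _ 1])
    then obtain d2 L where d2: "d2 > 0" "\<And>v. s \<le> v \<Longrightarrow> x - d2 < v \<Longrightarrow> v < x \<Longrightarrow> n\<^sub>1 v = L" by blast
    have "\<exists>d>0. \<exists>R. \<forall>v. v \<le> t \<and> x < v \<and> v < x + d \<longrightarrow> n\<^sub>2 v = R"
    proof (cases "x < t")
      case True
      then obtain w where w: "x < w \<and> w \<le> t" "\<And>v. x < v \<and> v \<le> t \<Longrightarrow> n\<^sub>2 w \<le> n\<^sub>2 v"
        using ex_has_least_nat[of "\<lambda>v. x < v \<and> v \<le> t" t n\<^sub>2] by auto
      have "n\<^sub>2 v = n\<^sub>2 w" if "v \<le> t" "x < v" "v < x + (w - x)" for v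
        using w(2)[of v] mono[of v w] that w(1) local by force
      then show ?thesis using w(1) by (intro exI[of _ "w - x"]) auto
    qed (auto intro!: exI[of _ 1])
    then obtain d3 R where d3: "d3 > 0" "\<And>v. v \<le> t \<Longrightarrow> x < v \<Longrightarrow> v < x + d3 \<Longrightarrow> n\<^sub>2 v = R" by blast
    define d where "d = min d1 (min d2 d3)"
    have left: "n\<^sub>1 v = L" "r v = L + n\<^sub>2 x" if "s \<le> v" "x - d < v" "v < x" for v
    proof -
      show 1: "n\<^sub>1 v = L" using that by (intro d2(2)) (auto simp: d_def)
      have "n\<^sub>2 v = n\<^sub>2 x"
        using that x d1(2)[of v] mono[of v x] by (force simp: d_def dist_real_def)
      then show "r v = L + n\<^sub>2 x" using 1 that x r[of v] by simp
    qed
    have right: "n\<^sub>1 v = n\<^sub>1 x" "r v = n\<^sub>1 x + R" if "v \<le> t" "x < v" "v < x + d" for v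
    proof -
      show 1: "n\<^sub>1 v = n\<^sub>1 x"
        using that x d1(2)[of v] anti[of x v] by (force simp: d_def dist_real_def)
      have "n\<^sub>2 v = R" using that by (intro d3(2)) (auto simp: d_def)
      then show "r v = n\<^sub>1 x + R" using 1 that x r[of v] by simp
    qed
    show ?case
    proof (intro exI[of _ d] conjI allI impI)
      show "d > 0" using d1 d2 d3 by (simp add: d_def)
      fix a b assume ab: "a \<le> x \<and> x \<le> b \<and> b - a < d"
      show "P a b"
        unfolding P_def
      proof
        assume st: "s \<le> a \<and> b \<le> t"
        have ev_left: "eventually (\<lambda>v. r v = L + n\<^sub>2 x) (at_left u)" if "a < u" "u \<le> x" for u
          using eventually_at_left_real[OF that(1)]
          by eventually_elim (use left(2) st ab that in auto)
        have ev_right: "eventually (\<lambda>v. r v = n\<^sub>1 x + R) (at_left u)" if "x < u" "u \<le> b" for u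
          using eventually_at_left_real[OF that(1)]
          by eventually_elim (use right(2) st ab that in auto)
        have drop_left: "drop_at r u = 0" if "a < u" "u < x" for u
          using drop_at_eq[OF ev_left[of u]] left(2)[of u] that ab st by auto
        have drop_right: "drop_at r u = 0" if "x < u" "u \<le> b" for u
          using drop_at_eq[OF ev_right[of u]] right(2)[of u] that ab st by auto
        have drop_x: "drop_at r x = int L - int (n\<^sub>1 x)" if "a < x"
          using drop_at_eq[OF ev_left[of x]] r[OF x] that by simp
        have sub: "{u. a < u \<and> u \<le> b \<and> drop_at r u \<noteq> 0} \<subseteq> {x}"
          using drop_left drop_right by force
        have Lx: "n\<^sub>1 x \<le> L" if "a < x"
          using anti[of a x] left(1)[of a] that ab st by force
        have "\<exists>l\<ge>r u. eventually (\<lambda>v. r v = l) (at_left u)" if "a < u" "u \<le> b" for u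
        proof -
          consider "u < x" | "u = x" | "x < u" by linarith
          then show ?thesis
          proof cases
            case 1
            then show ?thesis using ev_left[of u] left(2)[of u] that ab st by auto
          next
            case 2
            then show ?thesis using ev_left[of u] Lx that r[OF x] by (intro exI[of _ "L + n\<^sub>2 x"]) auto
          next
            case 3
            then show ?thesis using ev_right[of u] right(2)[of u] that ab st by auto
          qed
        qed
        then have "step_on r a b" using finite_subset[OF sub] by (auto simp: step_on_def)
        moreover have "jumps r a b = int (n\<^sub>1 a) - int (n\<^sub>1 b)"
        proof -
          have b: "n\<^sub>1 b = n\<^sub>1 x" using right(1)[of b] ab st by (cases "b = x") auto
          show ?thesis
          proof (cases "a < x")
            case True
            then have "{u. a < u \<and> u \<le> b \<and> drop_at r u \<noteq> 0} = (if drop_at r x = 0 then {} else {x})"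
              using sub ab by auto
            then have "jumps r a b = drop_at r x" by (simp add: jumps_def)
            then show ?thesis using drop_x[OF True] left(1)[of a] True ab st b by simp
          next
            case False
            then have "a = x" using ab by simp
            then have "{u. a < u \<and> u \<le> b \<and> drop_at r u \<noteq> 0} = {}" using sub by auto
            then have "jumps r a b = 0" unfolding jumps_def by (simp only: sum.empty)
            then show ?thesis using b \<open>a = x\<close> by simp
          qed
        qed
        ultimately show "step_on r a b \<and> jumps r a b = int (n\<^sub>1 a) - int (n\<^sub>1 b)" by simp
      qed
    qed
  qed
  then show ?thesis by (simp add: P_def)
qed

section \<open>Continuity of inverses and semicontinuity of inertia\<close>

lemma tendsto_matrixI:
  assumes "\<And>i j. ((\<lambda>x. f x $ i $ j) \<longlongrightarrow> l $ i $ j) F"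
  shows "(f \<longlongrightarrow> (l :: real^'n^'m)) F"
  using assms by (intro vec_tendstoI)

lemma tendsto_matrix_entry: "(f \<longlongrightarrow> (l :: real^'n^'m)) F \<Longrightarrow> ((\<lambda>x. f x $ i $ j) \<longlongrightarrow> l $ i $ j) F"
  by (intro tendsto_vec_nth)

lemma tendsto_matrix_mult [tendsto_intros]:
  fixes f :: "'x \<Rightarrow> real^'n^'m" and g :: "'x \<Rightarrow> real^'p^'n"
  assumes "(f \<longlongrightarrow> A) F" "(g \<longlongrightarrow> B) F"
  shows "((\<lambda>x. f x ** g x) \<longlongrightarrow> A ** B) F"
  unfolding matrix_matrix_mult_def
  by (rule tendsto_matrixI) (auto intro!: tendsto_intros tendsto_matrix_entry assms)

lemma tendsto_matrix_vector_mult [tendsto_intros]: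
  fixes f :: "'x \<Rightarrow> real^'n^'m"
  assumes "(f \<longlongrightarrow> A) F" "(g \<longlongrightarrow> v) F"
  shows "((\<lambda>x. f x *v g x) \<longlongrightarrow> A *v v) F"
  unfolding matrix_vector_mult_def
  by (rule vec_tendstoI) (auto intro!: tendsto_intros tendsto_matrix_entry assms)

lemma tendsto_det:
  fixes f :: "'x \<Rightarrow> real^'n^'n"
  assumes "(f \<longlongrightarrow> A) F"
  shows "((\<lambda>x. det (f x)) \<longlongrightarrow> det A) F"
  unfolding det_def by (intro tendsto_intros tendsto_matrix_entry assms)

lemma eventually_invertible:
  fixes f :: "'x \<Rightarrow> real^'n^'n"
  assumes "(f \<longlongrightarrow> A) F" "invertible A"
  shows "eventually (\<lambda>x. invertible (f x)) F"
  using tendsto_imp_eventually_ne[OF tendsto_det[OF assms(1)], of 0] assms(2)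
  by (simp add: invertible_det_nz)

text \<open>
  Cramer's rule, which exhibits the inverse as a continuous function.
\<close>

lemma matrix_inv_entry:
  fixes A :: "real^'n^'n"
  assumes "invertible A"
  shows "matrix_inv A $ k $ j = det (\<chi> i l. if l = k then axis j 1 $ i else A $ i $ l) / det A"
proof -
  have "det A \<noteq> 0" using assms by (simp add: invertible_det_nz)
  then have "matrix_inv A *v axis j 1 = (\<chi> k. det (\<chi> i l. if l = k then axis j 1 $ i else A $ i $ l) / det A)"
    using cramer[of A "matrix_inv A *v axis j 1" "axis j 1"] by (simp add: matrix_inv[OF assms])
  then show ?thesis
    by (simp add: matrix_vector_mult_basis column_def vec_eq_iff)
qed

lemma tendsto_matrix_inv:
  fixes f :: "'x \<Rightarrow> real^'n^'n"
  assumes "(f \<longlongrightarrow> A) F" "invertible A"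
  shows "((\<lambda>x. matrix_inv (f x)) \<longlongrightarrow> matrix_inv A) F"
proof (rule tendsto_matrixI)
  fix k j
  have "((\<lambda>x. (if l = k then axis j 1 $ i else f x $ i $ l)) \<longlongrightarrow> (if l = k then axis j 1 $ i else A $ i $ l)) F" for i l
    using assms(1) by (auto intro: tendsto_matrix_entry)
  then have "((\<lambda>x. det (\<chi> i l. if l = k then axis j 1 $ i else f x $ i $ l) / det (f x)) \<longlongrightarrow>
      det (\<chi> i l. if l = k then axis j 1 $ i else A $ i $ l) / det A) F"
    using assms by (intro tendsto_divide tendsto_det tendsto_matrixI) (auto simp: invertible_det_nz intro: tendsto_matrix_entry)
  then have "((\<lambda>x. det (\<chi> i l. if l = k then axis j 1 $ i else f x $ i $ l) / det (f x)) \<longlongrightarrow> matrix_inv A $ k $ j) F"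
    by (simp add: matrix_inv_entry[OF assms(2)])
  moreover have "eventually (\<lambda>x. det (\<chi> i l. if l = k then axis j 1 $ i else f x $ i $ l) / det (f x) = matrix_inv (f x) $ k $ j) F"
    using eventually_invertible[OF assms] by eventually_elim (simp add: matrix_inv_entry)
  ultimately show "((\<lambda>x. matrix_inv (f x) $ k $ j) \<longlongrightarrow> matrix_inv A $ k $ j) F"
    by (rule Lim_transform_eventually)
qed

lemma neg_inertia_antimono:
  assumes "\<And>v. quad A v \<le> quad B v"
  shows "neg_inertia B \<le> neg_inertia A"
proof -
  obtain W where W: "subspace W" "neg_def_on (quad B) W" "dim W = neg_inertia B"
    using neg_dim_attained[OF subspace_UNIV, of "quad B"] by auto
  then have "neg_def_on (quad A) W"
    using assms by (force simp: neg_def_on_def intro: le_less_trans)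
  then show ?thesis using dim_le_neg_dim[OF W(1), of UNIV] W(3) by auto
qed

text \<open>
  On the compact unit sphere of a maximal negative subspace the form is bounded away from \<open>0\<close>, so
  this subspace stays negative under small perturbations.
\<close>

lemma neg_inertia_lsc:
  fixes f :: "'x \<Rightarrow> real^'n^'n"
  assumes lim: "(f \<longlongrightarrow> A) F"
  shows "eventually (\<lambda>x. neg_inertia A \<le> neg_inertia (f x)) F"
proof -
  obtain W where W: "subspace W" "neg_def_on (quad A) W" "dim W = neg_inertia A"
    using neg_dim_attained[OF subspace_UNIV, of "quad A"] by auto
  have "\<exists>m>0. \<forall>v\<in>W \<inter> sphere 0 1. quad A v \<le> - m"
  proof (cases "W \<inter> sphere 0 1 = {}")
    case False
    have "compact (W \<inter> sphere 0 1)" using W(1) by (intro closed_Int_compact closed_subspace) auto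
    moreover have "continuous_on (W \<inter> sphere 0 1) (quad A)"
      unfolding quad_def by (intro continuous_intros matrix_vector_mult_linear_continuous_on)
    ultimately obtain u where u: "u \<in> W \<inter> sphere 0 1" "\<And>v. v \<in> W \<inter> sphere 0 1 \<Longrightarrow> quad A v \<le> quad A u"
      using continuous_attains_sup[of "W \<inter> sphere 0 1" "quad A"] False by blast
    moreover have "quad A u < 0" using u(1) W(2) by (auto simp: neg_def_on_def)
    ultimately show ?thesis by (intro exI[of _ "- quad A u"]) auto
  qed (auto intro: exI[of _ 1])
  then obtain m where m: "m > 0" "\<And>v. v \<in> W \<Longrightarrow> norm v = 1 \<Longrightarrow> quad A v \<le> - m" by auto
  have "bilinear (\<lambda>(B :: real^'n^'n) v. B *v v)"
    by (auto simp: bilinear_def intro!: linearI simp: matrix_vector_mult_add_rdistrib scaleR_matrix_vector_assoc)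
  then obtain K where K: "K > 0" "\<And>(B :: real^'n^'n) v. norm (B *v v) \<le> K * norm B * norm v"
    using bilinear_bounded_pos by blast
  have "eventually (\<lambda>x. dist (f x) A < m / K) F"
    using lim m(1) K(1) by (intro tendstoD) auto
  then show ?thesis
  proof eventually_elim
    case (elim x)
    have "neg_def_on (quad (f x)) W"
      unfolding neg_def_on_def
    proof (intro ballI impI)
      fix v assume v: "v \<in> W" "v \<noteq> 0"
      define w where "w = v /\<^sub>R norm v"
      have w: "w \<in> W" "norm w = 1" using v W(1) by (auto simp: w_def intro: subspace_scale)
      have "quad (f x) w = quad A w + w \<bullet> ((f x - A) *v w)"
        by (simp add: quad_def matrix_vector_mult_diff_rdistrib inner_diff_right)
      also have "w \<bullet> ((f x - A) *v w) \<le> norm w * norm ((f x - A) *v w)" by (rule norm_cauchy_schwarz)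
      also have "\<dots> \<le> K * norm (f x - A)" using K(2)[of "f x - A" w] w by simp
      also have "\<dots> < m" using elim K(1) by (simp add: dist_norm field_simps)
      finally have "quad (f x) w < 0" using m(2)[OF w] by simp
      moreover have "quad (f x) v = (norm v)\<^sup>2 * quad (f x) w"
        using v by (simp add: quad_def w_def matrix_vector_mult_scaleR power2_eq_square divide_simps)
      ultimately show "quad (f x) v < 0" using v by (simp add: mult_pos_neg)
    qed
    then show ?case using dim_le_neg_dim[OF W(1), of UNIV] W(3) by auto
  qed
qed

lemma neg_inertia_zero: "neg_inertia (0 :: real^'n^'n) = 0"
proof -
  obtain W where W: "subspace W" "neg_def_on (quad (0 :: real^'n^'n)) W" "dim W = neg_inertia (0 :: real^'n^'n)"
    using neg_dim_attained[OF subspace_UNIV, of "quad (0 :: real^'n^'n)"] by auto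
  then have "W \<subseteq> {0}" by (auto simp: neg_def_on_def quad_def)
  then show ?thesis using W(3) by (metis dim_eq_0)
qed

section \<open>Graphs of symplectic matrices\<close>

lemma bracket_entries:
  "upper (bracket S) $ Inl i $ Inl j = (if i = j then 1 else 0)" "upper (bracket S) $ Inl i $ Inr j = 0"
  "upper (bracket S) $ Inr i $ k = S $ Inl i $ k"
  "lower (bracket S) $ Inl i $ Inl j = 0" "lower (bracket S) $ Inl i $ Inr j = (if i = j then - 1 else 0)"
  "lower (bracket S) $ Inr i $ k = S $ Inr i $ k"
  by (cases k; simp add: bracket_def upper_def lower_def vstack_def block_def mat_def
      block11_def block12_def block21_def block22_def)+

text \<open>
  The columns of \<open>bracket S\<close> span the graph of \<open>S\<close>, with the sign of \<open>u\<close> changed at the first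
  endpoint. Therefore the symplectic form of the doubled space is the difference of the symplectic
  forms at the two endpoints.
\<close>

lemma wronskian_bracket: "wronskian (bracket S) (bracket S') = transpose S ** J_mat ** S' - J_mat"
proof -
  have "wronskian (bracket S) (bracket S') $ i $ j = (transpose S ** J_mat ** S' - J_mat) $ i $ j" for i j
    by (cases i; cases j)
      (simp_all add: wronskian_def matrix_matrix_mult_def transpose_def sum_UNIV_sum_type bracket_entries
        J_mat_simps if_distrib[where f = "\<lambda>x. _ * x"] if_distrib[where f = "\<lambda>x. x * _"] sum_negf algebra_simps cong: if_cong)
  then show ?thesis by (simp add: vec_eq_iff)
qed

lemma matrix_diff_ldistrib: "A ** (B - C) = A ** B - A ** C" for A :: "real^'n^'m"
  by (simp add: matrix_matrix_mult_def vec_eq_iff sum_subtractf algebra_simps)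

lemma matrix_diff_rdistrib: "(B - C) ** A = B ** A - C ** A" for A :: "real^'n^'m"
  by (simp add: matrix_matrix_mult_def vec_eq_iff sum_subtractf algebra_simps)

lemma wronskian_bracket_symplectic:
  "symplectic S \<Longrightarrow> wronskian (bracket S) (bracket S') = transpose S ** J_mat ** (S' - S)"
  by (simp add: wronskian_bracket symplectic_def matrix_diff_ldistrib)

lemma lagrangian_frame_bracket:
  assumes "symplectic S"
  shows "lagrangian_frame (bracket S)"
  unfolding lagrangian_frame_def
proof (intro conjI allI impI)
  show "wronskian (bracket S) (bracket S) = 0" using assms by (simp add: wronskian_bracket_symplectic)
  fix v assume v: "upper (bracket S) *v v = 0 \<and> lower (bracket S) *v v = 0"
  have "v $ Inl i = 0" "v $ Inr i = 0" for i
    using v by (auto simp: vec_eq_iff matrix_vector_mult_def sum_UNIV_sum_type bracket_entries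
        if_distrib[where f = "\<lambda>x. x * _"] cong: if_cong dest!: spec[of _ "Inl i"])
  then show "v = 0" by (simp add: vec_eq_iff) (metis sum.exhaust)
qed

text \<open>
  The intersection of the graph of \<open>S\<close> with the vertical subspace consists of the solutions with
  \<open>x = 0\<close> at both endpoints, that is, of the kernel of the upper right block.
\<close>

lemma rank_upper_bracket:
  fixes S :: "real^('n::finite + 'n)^('n + 'n)"
  shows "rank (upper (bracket S)) = rank (block12 S) + CARD('n)"
proof -
  define h :: "real^'n \<Rightarrow> real^('n + 'n)" where "h w = (\<chi> i. case i of Inl k \<Rightarrow> 0 | Inr k \<Rightarrow> w $ k)" for w
  have h_simps: "h w $ Inl k = 0" "h w $ Inr k = w $ k" for w k by (simp_all add: h_def)
  have h: "linear h"
  proof (rule linearI)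
    have "h (x + y) $ i = (h x + h y) $ i" "h (r *\<^sub>R x) $ i = (r *\<^sub>R h x) $ i" for x y r i
      by (cases i; simp add: h_simps)+
    then show "h (x + y) = h x + h y" "h (r *\<^sub>R x) = r *\<^sub>R h x" for x y r by (simp_all add: vec_eq_iff)
  qed
  have "inj h" by (rule injI) (metis h_simps(2) vec_eq_iff)
  have uh: "(upper (bracket S) *v v) $ Inl i = v $ Inl i"
    "(upper (bracket S) *v h w) $ Inr i = (block12 S *v w) $ i" for v w i
    by (simp_all add: matrix_vector_mult_def sum_UNIV_sum_type bracket_entries h_simps block12_def
        if_distrib[where f = "\<lambda>x. x * _"] cong: if_cong)
  have "{v. upper (bracket S) *v v = 0} = h ` {w. block12 S *v w = 0}"
  proof (intro equalityI subsetI)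
    fix v assume "v \<in> {v. upper (bracket S) *v v = 0}"
    then have v: "upper (bracket S) *v v = 0" by simp
    define w where "w = (\<chi> k. v $ Inr k)"
    have "v $ i = h w $ i" for i
      using uh(1)[of v] v by (cases i) (auto simp: h_simps w_def)
    then have vh: "v = h w" by (simp add: vec_eq_iff)
    have "block12 S *v w = 0" using uh(2)[of w] v vh by (simp add: vec_eq_iff)
    then show "v \<in> h ` {w. block12 S *v w = 0}" using vh by blast
  next
    fix v assume "v \<in> h ` {w. block12 S *v w = 0}"
    then obtain w where w: "v = h w" "block12 S *v w = 0" by blast
    have "(upper (bracket S) *v v) $ i = 0" for i
      using uh(1)[of "h w"] uh(2)[of w] w by (cases i) (simp_all add: h_simps)
    then show "v \<in> {v. upper (bracket S) *v v = 0}" by (simp add: vec_eq_iff)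
  qed
  then have "dim {v. upper (bracket S) *v v = 0} = dim {w. block12 S *v w = 0}"
    using dim_image_eq[OF h, of "{w. block12 S *v w = 0}"] \<open>inj h\<close> by (simp add: inj_on_subset)
  then show ?thesis
    using rank_plus_dim_kernel[of "upper (bracket S)"] rank_plus_dim_kernel[of "block12 S"] by simp
qed

lemma tendsto_upper_bracket: "(f \<longlongrightarrow> S) F \<Longrightarrow> ((\<lambda>x. upper (bracket (f x))) \<longlongrightarrow> upper (bracket S)) F"
proof (rule tendsto_matrixI)
  fix i j assume "(f \<longlongrightarrow> S) F"
  then show "((\<lambda>x. upper (bracket (f x)) $ i $ j) \<longlongrightarrow> upper (bracket S) $ i $ j) F"
    by (cases i; cases j) (auto simp: bracket_entries intro: tendsto_matrix_entry)
qed

lemma tendsto_lower_bracket: "(f \<longlongrightarrow> S) F \<Longrightarrow> ((\<lambda>x. lower (bracket (f x))) \<longlongrightarrow> lower (bracket S)) F"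
proof (rule tendsto_matrixI)
  fix i j assume "(f \<longlongrightarrow> S) F"
  then show "((\<lambda>x. lower (bracket (f x)) $ i $ j) \<longlongrightarrow> lower (bracket S) $ i $ j) F"
    by (cases i; cases j) (auto simp: bracket_entries intro: tendsto_matrix_entry)
qed

lemma tendsto_chart_den_bracket:
  "(f \<longlongrightarrow> S) F \<Longrightarrow> ((\<lambda>x. chart_den c (bracket (f x))) \<longlongrightarrow> chart_den c (bracket S)) F"
  unfolding chart_den_def by (intro tendsto_intros tendsto_upper_bracket tendsto_lower_bracket)

lemma tendsto_chart_bracket:
  "(f \<longlongrightarrow> S) F \<Longrightarrow> invertible (chart_den c (bracket S)) \<Longrightarrow>
    ((\<lambda>x. chart c (bracket (f x))) \<longlongrightarrow> chart c (bracket S)) F"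
  unfolding chart_def
  by (intro tendsto_intros tendsto_upper_bracket tendsto_matrix_inv tendsto_chart_den_bracket)

section \<open>Monotone symplectic paths\<close>

lemma matrix_add_rdistrib: "(B + C) ** A = B ** A + C ** A" for A :: "real^'n^'m"
  by (simp add: matrix_matrix_mult_def vec_eq_iff sum.distrib algebra_simps)

lemma bounded_bilinear_matrix_mult:
  "bounded_bilinear ((**) :: real^'n^'m \<Rightarrow> real^'p^'n \<Rightarrow> real^'p^'m)"
proof -
  have "bilinear ((**) :: real^'n^'m \<Rightarrow> real^'p^'n \<Rightarrow> real^'p^'m)"
    by (auto simp: bilinear_def matrix_add_ldistrib matrix_add_rdistrib matrix_scalar_ac
        scalar_matrix_assoc[symmetric] intro!: linearI)
  then show ?thesis by (simp add: bilinear_conv_bounded_bilinear)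
qed

lemma transpose_J_mat: "transpose J_mat = (- J_mat :: real^('m::finite + 'm)^('m + 'm))"
proof -
  have "transpose J_mat $ i $ j = (- J_mat) $ i $ j" for i j :: "'m + 'm"
    by (cases i; cases j) (auto simp: transpose_def J_mat_simps)
  then show ?thesis by (simp add: vec_eq_iff)
qed

lemma symplectic_mult:
  assumes "symplectic S" "symplectic T"
  shows "symplectic (S ** T)"
  using assms by (simp add: symplectic_def matrix_transpose_mul) (metis matrix_mul_assoc)

lemma symplectic_mat_1: "symplectic (mat 1)"
  by (simp add: symplectic_def)

lemma symplectic_matrix_inv:
  fixes S :: "real^('n::finite + 'n)^('n + 'n)"
  assumes "symplectic S"
  shows "symplectic (matrix_inv S)"
proof -
  note inv = matrix_inv[OF symplectic_imp_invertible[OF assms]]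
  have "transpose (matrix_inv S) ** transpose S = mat 1"
    using inv(1) by (metis matrix_transpose_mul transpose_mat)
  moreover have "transpose (matrix_inv S) ** (transpose S ** J_mat ** S) ** matrix_inv S
    = (transpose (matrix_inv S) ** transpose S) ** J_mat ** (S ** matrix_inv S)"
    by (simp add: matrix_mul_assoc)
  ultimately show ?thesis using assms inv(1) by (simp add: symplectic_def)
qed

lemma symplectic_inner:
  assumes "symplectic S"
  shows "(S *v x) \<bullet> (J_mat *v (S *v y)) = x \<bullet> (J_mat *v y)"
proof -
  have "(S *v x) \<bullet> (J_mat *v (S *v y)) = x \<bullet> ((transpose S ** J_mat ** S) *v y)"
    by (simp add: inner_matrix_left flip: matrix_vector_mul_assoc)
  then show ?thesis
    using assms by (simp add: symplectic_def)
qed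

text \<open>
  The last condition is \<open>Psi Z t \<ge> 0\<close> off a locally finite set, with the inverse removed by evaluating the form
  at \<open>Z t v\<close>. In this shape the condition is inherited by products.
\<close>

definition monotone_path :: "(real \<Rightarrow> real^('n::finite + 'n)^('n + 'n)) \<Rightarrow> bool"
  where "monotone_path Z \<longleftrightarrow> (\<forall>t. symplectic (Z t)) \<and> (\<forall>t. isCont Z t) \<and>
    (\<exists>P. (\<forall>c d. finite (P \<inter> {c..d})) \<and> (\<forall>t. t \<notin> P \<longrightarrow>
      (\<exists>D. (Z has_vector_derivative D) (at t) \<and> (\<forall>v. (Z t *v v) \<bullet> (J_mat *v (D *v v)) \<le> 0))))"

lemma monotone_path_const: "symplectic A \<Longrightarrow> monotone_path (\<lambda>t. A)"
  unfolding monotone_path_def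
  by (auto intro!: exI[of _ "{}"] exI[of _ 0] has_vector_derivative_const)

text \<open>
  \<open>Psi\<close> of a product is the sum of \<open>Psi\<close> of the left factor and a congruence transform of \<open>Psi\<close> of
  the right factor.
\<close>

lemma monotone_path_mult:
  assumes "monotone_path Z1" "monotone_path Z2"
  shows "monotone_path (\<lambda>t. Z1 t ** Z2 t)"
proof -
  obtain P1 where 1: "\<And>c d. finite (P1 \<inter> {c..d})" "\<And>t. t \<notin> P1 \<Longrightarrow> \<exists>D. (Z1 has_vector_derivative D) (at t) \<and>
      (\<forall>v. (Z1 t *v v) \<bullet> (J_mat *v (D *v v)) \<le> 0)"
    using assms(1) unfolding monotone_path_def by blast
  obtain P2 where 2: "\<And>c d. finite (P2 \<inter> {c..d})" "\<And>t. t \<notin> P2 \<Longrightarrow> \<exists>D. (Z2 has_vector_derivative D) (at t) \<and>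
      (\<forall>v. (Z2 t *v v) \<bullet> (J_mat *v (D *v v)) \<le> 0)"
    using assms(2) unfolding monotone_path_def by blast
  have sym: "symplectic (Z1 t)" "symplectic (Z2 t)" and cont: "isCont Z1 t" "isCont Z2 t" for t
    using assms by (auto simp: monotone_path_def)
  have der: "\<exists>D. ((\<lambda>t. Z1 t ** Z2 t) has_vector_derivative D) (at t) \<and>
      (\<forall>v. ((Z1 t ** Z2 t) *v v) \<bullet> (J_mat *v (D *v v)) \<le> 0)" if t: "t \<notin> P1 \<union> P2" for t
  proof -
    obtain D1 where D1: "(Z1 has_vector_derivative D1) (at t)"
      "\<And>v. (Z1 t *v v) \<bullet> (J_mat *v (D1 *v v)) \<le> 0" using 1(2) t by blast
    obtain D2 where D2: "(Z2 has_vector_derivative D2) (at t)"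
      "\<And>v. (Z2 t *v v) \<bullet> (J_mat *v (D2 *v v)) \<le> 0" using 2(2) t by blast
    have "((Z1 t ** Z2 t) *v v) \<bullet> (J_mat *v ((Z1 t ** D2 + D1 ** Z2 t) *v v)) \<le> 0" for v
    proof -
      have "((Z1 t ** Z2 t) *v v) \<bullet> (J_mat *v ((Z1 t ** D2 + D1 ** Z2 t) *v v)) =
        (Z2 t *v v) \<bullet> (J_mat *v (D2 *v v)) +
        (Z1 t *v (Z2 t *v v)) \<bullet> (J_mat *v (D1 *v (Z2 t *v v)))"
        by (simp add: matrix_vector_mult_add_rdistrib matrix_vector_right_distrib inner_add_right
            symplectic_inner[OF sym(1)] flip: matrix_vector_mul_assoc)
      then show ?thesis using D1(2)[of "Z2 t *v v"] D2(2)[of v] by simp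
    qed
    then show ?thesis
      using bounded_bilinear.has_vector_derivative[OF bounded_bilinear_matrix_mult D1(1) D2(1)] by blast
  qed
  have fin: "finite ((P1 \<union> P2) \<inter> {c..d})" for c d
    using 1(1)[of c d] 2(1)[of c d] by (simp add: Int_Un_distrib2)
  have "isCont (\<lambda>t. Z1 t ** Z2 t) t" for t
    using cont unfolding isCont_def by (intro tendsto_intros)
  then show ?thesis
    unfolding monotone_path_def
    by (intro conjI exI[of _ "P1 \<union> P2"] allI impI symplectic_mult sym fin der)
qed

lemma monotone_path_symplectic: "monotone_path Z \<Longrightarrow> symplectic (Z t)"
  by (simp add: monotone_path_def)

lemma monotone_path_tendsto: "monotone_path Z \<Longrightarrow> (Z \<longlongrightarrow> Z t) (at t within T)"
  using continuous_at_imp_continuous_at_within[of t Z T] by (simp add: monotone_path_def continuous_within)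

lemma transpose_chart_bracket:
  "symplectic S \<Longrightarrow> invertible (chart_den c (bracket S)) \<Longrightarrow> transpose (chart c (bracket S)) = chart c (bracket S)"
  by (intro transpose_chart lagrangian_frame_bracket)

lemma has_vector_derivative_quotient:
  assumes "(f has_vector_derivative D) (at t)"
  shows "((\<lambda>u. (f u - f t) /\<^sub>R (u - t)) \<longlongrightarrow> D) (at t)"
proof -
  have "((\<lambda>u. norm ((f u - f t - (u - t) *\<^sub>R D) /\<^sub>R norm (u - t))) \<longlongrightarrow> 0) (at t)"
    using assms unfolding has_vector_derivative_def has_derivative_at_within
    by (intro tendsto_norm_zero) blast
  then have "((\<lambda>u. norm ((f u - f t) /\<^sub>R (u - t) - D)) \<longlongrightarrow> 0) (at t)"
  proof (rule Lim_transform_eventually)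
    show "eventually (\<lambda>u. norm ((f u - f t - (u - t) *\<^sub>R D) /\<^sub>R norm (u - t)) = norm ((f u - f t) /\<^sub>R (u - t) - D)) (at t)"
      unfolding eventually_at_filter
    proof (intro always_eventually allI impI)
      fix u assume "u \<noteq> t"
      then have "(f u - f t) /\<^sub>R (u - t) - D = (f u - f t - (u - t) *\<^sub>R D) /\<^sub>R (u - t)"
        by (simp add: scaleR_diff_right)
      then show "norm ((f u - f t - (u - t) *\<^sub>R D) /\<^sub>R norm (u - t)) = norm ((f u - f t) /\<^sub>R (u - t) - D)" by simp
    qed
  qed
  then show ?thesis by (rule LIM_zero_cancel[OF tendsto_norm_zero_cancel])
qed

text \<open>
  The difference of two charts is a congruence transform of the Wronskian, which is linear in
  the increment of \<open>Z\<close>; so the derivative is found without differentiating an inverse.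
\<close>

lemma quad_chart_derivative:
  fixes v :: "real^('n::finite + 'n)"
  assumes Z: "\<And>t. symplectic (Z t)" and cont: "isCont Z t" and D: "(Z has_vector_derivative D) (at t)"
    and inv: "invertible (chart_den c (bracket (Z t)))"
  defines "\<xi> \<equiv> \<lambda>u. matrix_inv (chart_den c (bracket (Z u))) *v v"
  shows "((\<lambda>u. quad (chart c (bracket (Z u))) v) has_vector_derivative
    - ((Z t *v \<xi> t) \<bullet> (J_mat *v (D *v \<xi> t)))) (at t)"
proof -
  let ?Q = "\<lambda>u. chart c (bracket (Z u))"
  have lim: "(Z \<longlongrightarrow> Z t) (at t)" using cont by (simp add: isCont_def)
  have \<xi>: "(\<xi> \<longlongrightarrow> \<xi> t) (at t)"
    unfolding \<xi>_def
    by (rule tendsto_matrix_vector_mult[OF tendsto_matrix_inv[OF tendsto_chart_den_bracket[OF lim] inv] tendsto_const])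
  have D': "((\<lambda>u. (Z u - Z t) /\<^sub>R (u - t)) \<longlongrightarrow> D) (at t)"
    by (rule has_vector_derivative_quotient[OF D])
  have "((\<lambda>u. - ((Z u *v \<xi> u) \<bullet> (J_mat *v (((Z u - Z t) /\<^sub>R (u - t)) *v \<xi> t)))) \<longlongrightarrow>
      - ((Z t *v \<xi> t) \<bullet> (J_mat *v (D *v \<xi> t)))) (at t)"
    by (intro tendsto_minus tendsto_inner tendsto_matrix_vector_mult tendsto_const lim \<xi> D')
  moreover have "eventually (\<lambda>u. - ((Z u *v \<xi> u) \<bullet> (J_mat *v (((Z u - Z t) /\<^sub>R (u - t)) *v \<xi> t))) =
      (quad (?Q u) v - quad (?Q t) v) / (u - t)) (at t)"
    using eventually_invertible[OF tendsto_chart_den_bracket[OF lim] inv]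
  proof eventually_elim
    case (elim u)
    have "quad (?Q u) v - quad (?Q t) v = v \<bullet> ((?Q u - ?Q t) *v v)"
      by (simp add: quad_def matrix_vector_mult_diff_rdistrib inner_diff_right)
    also have "\<dots> = \<xi> u \<bullet> (wronskian (bracket (Z u)) (bracket (Z t)) *v \<xi> t)"
      unfolding \<xi>_def by (rule wronskian_chart[OF lagrangian_frame_bracket[OF Z] elim inv, symmetric])
    also have "\<dots> = (Z u *v \<xi> u) \<bullet> (J_mat *v ((Z t - Z u) *v \<xi> t))"
      by (simp add: wronskian_bracket_symplectic Z inner_matrix_left flip: matrix_vector_mul_assoc)
    also have "\<dots> = - ((Z u *v \<xi> u) \<bullet> (J_mat *v ((Z u - Z t) *v \<xi> t)))"
      by (simp add: matrix_vector_mult_diff_rdistrib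
          matrix_vector_mult_diff_distrib inner_diff_right)
    finally have diff: "quad (?Q u) v - quad (?Q t) v = - ((Z u *v \<xi> u) \<bullet> (J_mat *v ((Z u - Z t) *v \<xi> t)))" .
    have "((Z u - Z t) /\<^sub>R (u - t)) *v \<xi> t = inverse (u - t) *\<^sub>R ((Z u - Z t) *v \<xi> t)"
      by (rule scaleR_matrix_vector_assoc[symmetric])
    then show ?case
      by (simp only: diff matrix_vector_mult_scaleR inner_scaleR_right divide_inverse) (simp only: mult.commute mult_minus_left)
  qed
  ultimately have "((\<lambda>u. (quad (?Q u) v - quad (?Q t) v) / (u - t)) \<longlongrightarrow>
      - ((Z t *v \<xi> t) \<bullet> (J_mat *v (D *v \<xi> t)))) (at t)"
    by (rule Lim_transform_eventually)
  then have "((\<lambda>u. quad (?Q u) v) has_field_derivative - ((Z t *v \<xi> t) \<bullet> (J_mat *v (D *v \<xi> t)))) (at t)"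
    by (simp add: has_field_derivative_iff)
  then show ?thesis by (simp add: has_real_derivative_iff_has_vector_derivative)
qed

text \<open>
  The derivative is nonnegative off a finite set, and a continuous function is the integral of
  such a derivative.
\<close>

lemma quad_chart_mono:
  assumes Z: "monotone_path Z" and "s \<le> t"
    and inv: "\<And>u. u \<in> {s..t} \<Longrightarrow> invertible (chart_den c (bracket (Z u)))"
  shows "quad (chart c (bracket (Z s))) v \<le> quad (chart c (bracket (Z t))) v"
proof -
  define \<phi> where "\<phi> u = quad (chart c (bracket (Z u))) v" for u
  define \<xi> where "\<xi> u = matrix_inv (chart_den c (bracket (Z u))) *v v" for u
  obtain P where P: "\<And>c d. finite (P \<inter> {c..d})" "\<And>t. t \<notin> P \<Longrightarrow> \<exists>D. (Z has_vector_derivative D) (at t) \<and>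
      (\<forall>v. (Z t *v v) \<bullet> (J_mat *v (D *v v)) \<le> 0)"
    using Z unfolding monotone_path_def by blast
  have cont: "continuous_on {s..t} \<phi>"
    unfolding continuous_on_def
  proof
    fix u assume "u \<in> {s..t}"
    then show "(\<phi> \<longlongrightarrow> \<phi> u) (at u within {s..t})"
      unfolding \<phi>_def quad_def
      by (intro tendsto_intros tendsto_chart_bracket monotone_path_tendsto Z inv)
  qed
  have "\<exists>d\<ge>0. (\<phi> has_vector_derivative d) (at u)" if "u \<in> {s<..<t} - P \<inter> {s..t}" for u
  proof -
    have "u \<notin> P" "u \<in> {s..t}" using that by auto
    then obtain D where D: "(Z has_vector_derivative D) (at u)"
        "\<And>v. (Z u *v v) \<bullet> (J_mat *v (D *v v)) \<le> 0"
      using P(2) by blast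
    have "(\<phi> has_vector_derivative - ((Z u *v \<xi> u) \<bullet> (J_mat *v (D *v \<xi> u)))) (at u)"
      unfolding \<phi>_def \<xi>_def
      using Z by (intro quad_chart_derivative D(1) inv \<open>u \<in> {s..t}\<close>) (auto simp: monotone_path_def)
    moreover have "0 \<le> - ((Z u *v \<xi> u) \<bullet> (J_mat *v (D *v \<xi> u)))" using D(2)[of "\<xi> u"] by simp
    ultimately show ?thesis by blast
  qed
  then obtain \<phi>' where \<phi>': "\<And>u. u \<in> {s<..<t} - P \<inter> {s..t} \<Longrightarrow> 0 \<le> \<phi>' u \<and> (\<phi> has_vector_derivative \<phi>' u) (at u)"
    by metis
  define \<psi> where "\<psi> u = (if u \<in> {s<..<t} - P \<inter> {s..t} then \<phi>' u else 0)" for u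
  have "(\<phi> has_vector_derivative \<psi> u) (at u)" if "u \<in> {s<..<t} - P \<inter> {s..t}" for u
  proof -
    have "\<psi> u = \<phi>' u" unfolding \<psi>_def using that by (rule if_P)
    then show ?thesis using \<phi>'[OF that] by simp
  qed
  then have int: "(\<psi> has_integral (\<phi> t - \<phi> s)) {s..t}"
    by (rule fundamental_theorem_of_calculus_interior_strong[OF P(1)[of s t] \<open>s \<le> t\<close> _ cont])
  have "0 \<le> \<psi> u" for u
  proof (cases "u \<in> {s<..<t} - P \<inter> {s..t}")
    case True
    then have "\<psi> u = \<phi>' u" unfolding \<psi>_def by (rule if_P)
    then show ?thesis using \<phi>'[OF True] by simp
  next
    case False
    then have "\<psi> u = 0" unfolding \<psi>_def by (rule if_not_P)
    then show ?thesis by simp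
  qed
  then have "0 \<le> \<phi> t - \<phi> s" by (rule has_integral_nonneg[OF int])
  then show ?thesis by (simp add: \<phi>_def)
qed

lemma monotone_path_of_C1p:
  assumes C1p: "C1p S" and sym: "\<And>t. symplectic (S t)" and nonneg: "Psi_nonneg S"
  shows "monotone_path S"
proof -
  obtain f' P where P: "\<forall>c d. finite (P \<inter> {c..d})"
    "\<forall>t. t \<notin> P \<longrightarrow> (S has_vector_derivative f' t) (at t) \<and> isCont f' t"
    using C1p unfolding C1p_def by (elim conjE exE) (rule that)
  have der: "(S has_vector_derivative f' t) (at t)" if "t \<notin> P" for t using P(2) that by simp
  have "(S t *v v) \<bullet> (J_mat *v (f' t *v v)) \<le> 0" if "t \<notin> P" for t v
  proof -
    have "S differentiable (at t)" by (rule differentiableI_vector[OF der[OF that]])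
    then have "nonneg_definite (Psi S t)" using nonneg by (simp add: Psi_nonneg_def)
    then have "0 \<le> (S t *v v) \<bullet> (Psi S t *v (S t *v v))" by (simp add: nonneg_definite_def)
    also have "Psi S t *v (S t *v v) = - (J_mat *v (f' t *v v))"
      unfolding Psi_def vector_derivative_at[OF der[OF that]]
      by (simp only: matrix_vector_mul_assoc[symmetric] matrix_inv[OF symplectic_imp_invertible[OF sym]]
          transpose_J_mat uminus_matrix_vector_mult)
    finally show ?thesis by simp
  qed
  then have "\<forall>t. t \<notin> P \<longrightarrow> (\<exists>D. (S has_vector_derivative D) (at t) \<and> (\<forall>v. (S t *v v) \<bullet> (J_mat *v (D *v v)) \<le> 0))"
    using der by (intro allI impI exI[of _ "f' _"] conjI)
  moreover have "\<forall>t. isCont S t"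
    using C1p by (simp add: C1p_def continuous_on_eq_continuous_at)
  ultimately show ?thesis
    unfolding monotone_path_def using sym P(1) by (intro conjI exI[of _ P] allI) simp_all
qed

section \<open>Crossings along a monotone path\<close>

text \<open>
  The rank of the upper block of \<open>bracket Z\<close> exceeds that of the upper right block of \<open>Z\<close> by a
  constant, which drops do not notice.
\<close>

lemma step_on_shift:
  assumes "step_on (\<lambda>u. r u + k) s t"
  shows "step_on r s t" "jumps r s t = jumps (\<lambda>u. r u + k) s t"
proof -
  have ev: "\<exists>l\<ge>r u. eventually (\<lambda>v. r v = l) (at_left u) \<and> drop_at (\<lambda>u. r u + k) u = drop_at r u"
    if su: "s < u" "u \<le> t" for u
  proof -
    obtain l where l: "l \<ge> r u + k" "eventually (\<lambda>v. r v + k = l) (at_left u)"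
      using assms su unfolding step_on_def by blast
    then have e: "eventually (\<lambda>v. r v = l - k) (at_left u)" by (auto elim: eventually_mono)
    have "drop_at (\<lambda>u. r u + k) u = drop_at r u"
      using drop_at_eq[OF e] drop_at_eq[OF l(2)] l(1) by simp
    then show ?thesis using e l(1) by (intro exI[of _ "l - k"]) auto
  qed
  then have set: "{u. s < u \<and> u \<le> t \<and> drop_at r u \<noteq> 0} = {u. s < u \<and> u \<le> t \<and> drop_at (\<lambda>u. r u + k) u \<noteq> 0}"
    by force
  have "\<exists>l\<ge>r u. eventually (\<lambda>v. r v = l) (at_left u)" if "s < u" "u \<le> t" for u
    using ev[OF that] by blast
  moreover have "finite {u. s < u \<and> u \<le> t \<and> drop_at r u \<noteq> 0}"
    unfolding set using assms by (simp add: step_on_def)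
  ultimately show "step_on r s t" by (simp add: step_on_def)
  show "jumps r s t = jumps (\<lambda>u. r u + k) s t"
    unfolding jumps_def set
  proof (rule sum.cong[OF refl])
    fix u assume "u \<in> {u. s < u \<and> u \<le> t \<and> drop_at (\<lambda>u. r u + k) u \<noteq> 0}"
    then show "drop_at r u = drop_at (\<lambda>u. r u + k) u" using ev[of u] by auto
  qed
qed

lemma quad_diff: "quad (A - B) v = quad A v - quad B v"
  by (simp add: quad_def matrix_vector_mult_diff_rdistrib inner_diff_right)

lemma quad_minus: "quad (- A) v = - quad A v"
  by (simp add: quad_def uminus_matrix_vector_mult)

text \<open>
  Along a nondecreasing family of symmetric matrices eigenvalues cross zero upwards only, so every
  drop of the rank is a loss of negative eigenvalues.
\<close>

lemma chart_jumps:
  fixes Z :: "real \<Rightarrow> real^('n::finite + 'n)^('n + 'n)"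
  assumes Z: "monotone_path Z" and st: "s \<le> t"
    and inv: "\<And>u. u \<in> {s..t} \<Longrightarrow> invertible (chart_den c (bracket (Z u)))"
    and A: "transpose A = A"
    and r: "\<And>u. u \<in> {s..t} \<Longrightarrow> r u + k = rank (chart c (bracket (Z u)) - A)"
  shows "step_on r s t \<and> jumps r s t =
    int (neg_inertia (chart c (bracket (Z s)) - A)) - int (neg_inertia (chart c (bracket (Z t)) - A))"
proof -
  let ?Q = "\<lambda>u. chart c (bracket (Z u)) - A"
  have sym: "transpose (?Q u) = ?Q u" if "u \<in> {s..t}" for u
  proof -
    have "transpose (B - A) = B - A" if "transpose B = B" for B
      using that A by (simp add: transpose_def vec_eq_iff)
    then show ?thesis using transpose_chart_bracket[OF monotone_path_symplectic[OF Z] inv[OF that]] by blast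
  qed
  have mono: "quad (?Q u) x \<le> quad (?Q v) x" if "s \<le> u" "u \<le> v" "v \<le> t" for u v x
    using quad_chart_mono[OF Z \<open>u \<le> v\<close>, of c x] inv that by (simp add: quad_diff)
  have lim: "(?Q \<longlongrightarrow> ?Q u) (at u within {s..t})" if "u \<in> {s..t}" for u
    by (intro tendsto_diff tendsto_const tendsto_chart_bracket monotone_path_tendsto Z inv that)
  have "step_on (\<lambda>u. r u + k) s t \<and> jumps (\<lambda>u. r u + k) s t = int (neg_inertia (?Q s)) - int (neg_inertia (?Q t))"
  proof (rule jumps_of_inertia[OF st, where n\<^sub>2 = "\<lambda>u. neg_inertia (- ?Q u)"])
    show "r u + k = neg_inertia (?Q u) + neg_inertia (- ?Q u)" if "u \<in> {s..t}" for u
      unfolding r[OF that] by (rule rank_eq_inertia_sum[OF sym[OF that]])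
    show "neg_inertia (?Q v) \<le> neg_inertia (?Q u)" if "s \<le> u" "u \<le> v" "v \<le> t" for u v
      by (rule neg_inertia_antimono) (rule mono[OF that])
    show "neg_inertia (- ?Q u) \<le> neg_inertia (- ?Q v)" if "s \<le> u" "u \<le> v" "v \<le> t" for u v
    proof (rule neg_inertia_antimono)
      show "quad (- ?Q v) x \<le> quad (- ?Q u) x" for x
        unfolding quad_minus using mono[OF that, of x] by simp
    qed
    show "eventually (\<lambda>v. neg_inertia (?Q u) \<le> neg_inertia (?Q v) \<and> neg_inertia (- ?Q u) \<le> neg_inertia (- ?Q v)) (at u within {s..t})"
      if "u \<in> {s..t}" for u
      by (intro eventually_conj neg_inertia_lsc tendsto_minus lim that)
  qed
  then show ?thesis using step_on_shift[of r k s t] by simp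
qed

abbreviation focal_rank :: "(real \<Rightarrow> real^('n::finite + 'n)^('n + 'n)) \<Rightarrow> real \<Rightarrow> nat"
  where "focal_rank Z \<equiv> \<lambda>u. rank (block12 (Z u))"

lemma focal_jumps_chart:
  fixes Z :: "real \<Rightarrow> real^('n::finite + 'n)^('n + 'n)"
  assumes Z: "monotone_path Z" and st: "s \<le> t"
    and inv: "\<And>u. u \<in> {s..t} \<Longrightarrow> invertible (chart_den c (bracket (Z u)))"
  shows "step_on (focal_rank Z) s t" 
    "jumps (focal_rank Z) s t = int (neg_inertia (chart c (bracket (Z s)))) - int (neg_inertia (chart c (bracket (Z t))))"
proof -
  have "focal_rank Z u + CARD('n) = rank (chart c (bracket (Z u)) - 0)" if "u \<in> {s..t}" for u
    using rank_chart[OF inv[OF that]] by (simp add: rank_upper_bracket)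
  then have "step_on (focal_rank Z) s t \<and> jumps (focal_rank Z) s t =
      int (neg_inertia (chart c (bracket (Z s)) - 0)) - int (neg_inertia (chart c (bracket (Z t)) - 0))"
    by (intro chart_jumps[OF Z st inv]) (simp_all add: transpose_def vec_eq_iff)
  then show "step_on (focal_rank Z) s t" 
    "jumps (focal_rank Z) s t = int (neg_inertia (chart c (bracket (Z s)))) - int (neg_inertia (chart c (bracket (Z t))))"
    by simp_all
qed

lemma invertible_J_mat: "invertible J_mat"
proof -
  have "J_mat ** (- J_mat) = (mat 1 :: real^('a::finite + 'a)^('a + 'a))"
    using J_mat_square[where 'm = 'a] by (simp add: vec_eq_iff matrix_matrix_mult_def sum_negf)
  then show ?thesis using invertible_right_inverse by blast
qed

lemma rank_wronskian_bracket:
  assumes "symplectic S"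
  shows "rank (wronskian (bracket S) (bracket S')) = rank (S' - S)"
  by (simp add: wronskian_bracket_symplectic assms rank_invertible_mult invertible_mult
      transpose_invertible symplectic_imp_invertible invertible_J_mat)

lemma relative_jumps_chart:
  fixes Z :: "real \<Rightarrow> real^('n::finite + 'n)^('n + 'n)"
  assumes Z: "monotone_path Z" and st: "s \<le> t"
    and inv: "\<And>u. u \<in> {s..t} \<Longrightarrow> invertible (chart_den c (bracket (Z u)))"
    and M: "symplectic M" "invertible (chart_den c (bracket M))"
  shows "step_on (\<lambda>u. rank (M - Z u)) s t" 
    "jumps (\<lambda>u. rank (M - Z u)) s t = 
      int (neg_inertia (chart c (bracket (Z s)) - chart c (bracket M))) - 
      int (neg_inertia (chart c (bracket (Z t)) - chart c (bracket M)))"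
proof -
  note sym = monotone_path_symplectic[OF Z]
  have "rank (M - Z u) + 0 = rank (chart c (bracket (Z u)) - chart c (bracket M))" if "u \<in> {s..t}" for u
    using rank_chart_diff[OF lagrangian_frame_bracket[OF sym] inv[OF that] M(2)]
    by (simp add: rank_wronskian_bracket sym)
  then show "step_on (\<lambda>u. rank (M - Z u)) s t" 
    "jumps (\<lambda>u. rank (M - Z u)) s t = 
      int (neg_inertia (chart c (bracket (Z s)) - chart c (bracket M))) - 
      int (neg_inertia (chart c (bracket (Z t)) - chart c (bracket M)))"
    using chart_jumps[OF Z st inv transpose_chart_bracket[OF M]] by simp_all
qed

lemma local_common_chart:
  fixes F :: "'x::metric_space \<Rightarrow> real^('n::finite + 'n)^('n + 'n)"
  assumes sym: "symplectic (F x)" and cont: "(F \<longlongrightarrow> F x) (at x)" and M: "symplectic M"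
  obtains c d where "d > 0" "\<And>y. dist y x < d \<Longrightarrow> invertible (chart_den c (bracket (F y)))"
    "invertible (chart_den c (bracket M))"
proof -
  obtain c where c: "invertible (chart_den c (bracket (F x)))" "invertible (chart_den c (bracket M))"
    using common_chart[OF lagrangian_frame_bracket[OF sym] lagrangian_frame_bracket[OF M]] by blast
  have "eventually (\<lambda>y. invertible (chart_den c (bracket (F y)))) (at x)"
    by (rule eventually_invertible[OF tendsto_chart_den_bracket[OF cont] c(1)])
  then obtain d where d: "d > 0" "\<And>y. y \<noteq> x \<Longrightarrow> dist y x < d \<Longrightarrow> invertible (chart_den c (bracket (F y)))"
    unfolding eventually_at by auto
  have "invertible (chart_den c (bracket (F y)))" if "dist y x < d" for y
    using d(2)[of y] c(1) that by (cases "y = x") simp_all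
  then show ?thesis using that d(1) c(2) by blast
qed

text \<open>
  Crossings of the graph of \<open>Z\<close> with the vertical subspace and with the graph of \<open>M\<close> are, in a
  chart, losses of negative eigenvalues of \<open>Q\<close> and of \<open>Q - P\<close>. Their difference is therefore the
  variation of the comparative index \<open>n(Q - P) + n(P) - n(Q)\<close>, where \<open>n\<close> counts negative
  eigenvalues. Both sides are additive under concatenation of intervals, so the local statement
  implies the global one.
\<close>

lemma crossing_formula:
  fixes Z :: "real \<Rightarrow> real^('n::finite + 'n)^('n + 'n)"
  assumes Z: "monotone_path Z" and M: "symplectic M" and st: "s \<le> t"
  shows "step_on (focal_rank Z) s t \<and> step_on (\<lambda>u. rank (M - Z u)) s t \<and>
    jumps (focal_rank Z) s t - jumps (\<lambda>u. rank (M - Z u)) s t =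
      int (comp_index (bracket (Z t)) (bracket M)) - int (comp_index (bracket (Z s)) (bracket M))"
    (is "?P s t")
  using st
proof (induction rule: Bolzano)
  case (trans a b c)
  have f: "step_on (focal_rank Z) a b" "step_on (focal_rank Z) b c"
    and g: "step_on (\<lambda>u. rank (M - Z u)) a b" "step_on (\<lambda>u. rank (M - Z u)) b c"
    using trans(1,2) by blast+
  show ?case
  proof (intro conjI)
    show "jumps (focal_rank Z) a c - jumps (\<lambda>u. rank (M - Z u)) a c =
        int (comp_index (bracket (Z c)) (bracket M)) - int (comp_index (bracket (Z a)) (bracket M))"
      using jumps_concat(2)[OF f trans(3,4)] jumps_concat(2)[OF g trans(3,4)]
        trans(1)[THEN conjunct2, THEN conjunct2] trans(2)[THEN conjunct2, THEN conjunct2] by linarith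
  qed (rule jumps_concat(1)[OF f trans(3,4)] jumps_concat(1)[OF g trans(3,4)])+
next
  case (local x)
  note sym = monotone_path_symplectic[OF Z]
  obtain c d where cd: "d > 0" "\<And>y. dist y x < d \<Longrightarrow> invertible (chart_den c (bracket (Z y)))"
      "invertible (chart_den c (bracket M))"
    using local_common_chart[OF sym monotone_path_tendsto[OF Z] M] by blast
  show ?case
  proof (intro exI[of _ d] conjI[OF cd(1)] allI impI)
    fix a b assume ab: "a \<le> x \<and> x \<le> b \<and> b - a < d"
    then have le: "a \<le> b" and near: "\<And>u. u \<in> {a..b} \<Longrightarrow> invertible (chart_den c (bracket (Z u)))"
      by (auto intro!: cd(2) simp: dist_real_def)
    have idx: "int (comp_index (bracket (Z u)) (bracket M)) + int (neg_inertia (chart c (bracket (Z u)))) =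
        int (neg_inertia (chart c (bracket (Z u)) - chart c (bracket M))) + int (neg_inertia (chart c (bracket M)))"
      if "u \<in> {a..b}" for u
      unfolding of_nat_add[symmetric] of_nat_eq_iff
      by (rule comp_index_chart[OF lagrangian_frame_bracket[OF sym] near[OF that] lagrangian_frame_bracket[OF M] cd(3)])
    have mem: "a \<in> {a..b}" "b \<in> {a..b}" using le by auto
    have "jumps (focal_rank Z) a b - jumps (\<lambda>u. rank (M - Z u)) a b =
        int (comp_index (bracket (Z b)) (bracket M)) - int (comp_index (bracket (Z a)) (bracket M))"
      using focal_jumps_chart(2)[OF Z le near] relative_jumps_chart(2)[OF Z le near M cd(3)] idx[OF mem(1)] idx[OF mem(2)]
      by linarith
    then show "?P a b"
      using focal_jumps_chart(1)[OF Z le near] relative_jumps_chart(1)[OF Z le near M cd(3)] by blast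
  qed
qed

lemma comp_index_self:
  assumes "symplectic M"
  shows "comp_index (bracket M) (bracket M) = 0"
proof -
  obtain c where c: "invertible (chart_den c (bracket M))"
    using common_chart[OF lagrangian_frame_bracket[OF assms] lagrangian_frame_bracket[OF assms]] by blast
  show ?thesis
    using comp_index_chart[OF lagrangian_frame_bracket[OF assms] c lagrangian_frame_bracket[OF assms] c]
    by (simp add: neg_inertia_zero)
qed

lemma focal_step_on: "monotone_path Z \<Longrightarrow> s \<le> t \<Longrightarrow> step_on (focal_rank Z) s t"
  using crossing_formula[OF _ symplectic_mat_1] by blast

lemma focal_jumps_concat:
  "monotone_path Z \<Longrightarrow> s \<le> t \<Longrightarrow> t \<le> u \<Longrightarrow>
    jumps (focal_rank Z) s u = jumps (focal_rank Z) s t + jumps (focal_rank Z) t u"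
  by (rule jumps_concat(2)) (simp_all add: focal_step_on)

section \<open>Homotopy invariance for products of paths\<close>

context
  fixes P R :: "real \<Rightarrow> real^('n::finite + 'n)^('n + 'n)"
  assumes P: "monotone_path P" and R: "monotone_path R"
begin

abbreviation row_jumps :: "real \<Rightarrow> real \<Rightarrow> real \<Rightarrow> int"
  where "row_jumps s s' t \<equiv> jumps (focal_rank (\<lambda>u. P u ** R t)) s s'"

abbreviation col_jumps :: "real \<Rightarrow> real \<Rightarrow> real \<Rightarrow> int"
  where "col_jumps s t t' \<equiv> jumps (focal_rank (\<lambda>u. P s ** R u)) t t'"

abbreviation diag_jumps :: "real \<Rightarrow> real \<Rightarrow> int"
  where "diag_jumps s t \<equiv> jumps (focal_rank (\<lambda>u. P u ** R u)) s t"

lemma product_paths: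
  "monotone_path (\<lambda>u. P u ** R t)" "monotone_path (\<lambda>u. P s ** R u)" "monotone_path (\<lambda>u. P u ** R u)"
  by (intro monotone_path_mult monotone_path_const monotone_path_symplectic P R)+

text \<open>
  In a chart valid near \<open>(s\<^sub>0, t\<^sub>0)\<close>, the crossing numbers along horizontal, vertical and diagonal
  segments are differences of one function \<open>h\<close>, minus the negative inertia of the chart matrix.
\<close>

lemma local_product_potential:
  "\<exists>h. \<exists>d>0.
    (\<forall>s s' t. s \<le> s' \<and> \<bar>s - s\<^sub>0\<bar> < d \<and> \<bar>s' - s\<^sub>0\<bar> < d \<and> \<bar>t - t\<^sub>0\<bar> < d \<longrightarrow> row_jumps s s' t = h s' t - h s t) \<and>
    (\<forall>s t t'. t \<le> t' \<and> \<bar>s - s\<^sub>0\<bar> < d \<and> \<bar>t - t\<^sub>0\<bar> < d \<and> \<bar>t' - t\<^sub>0\<bar> < d \<longrightarrow> col_jumps s t t' = h s t' - h s t) \<and>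
    (\<forall>u v. s\<^sub>0 = t\<^sub>0 \<and> u \<le> v \<and> \<bar>u - t\<^sub>0\<bar> < d \<and> \<bar>v - t\<^sub>0\<bar> < d \<longrightarrow> diag_jumps u v = h v v - h u u)"
proof -
  define F where "F p = P (fst p) ** R (snd p)" for p :: "real \<times> real"
  have contP: "isCont P s" and contR: "isCont R s" for s using P R by (auto simp: monotone_path_def)
  have "(F \<longlongrightarrow> F (s\<^sub>0, t\<^sub>0)) (at (s\<^sub>0, t\<^sub>0))"
    unfolding F_def fst_conv snd_conv
    using isCont_tendsto_compose[OF contP, of fst s\<^sub>0] isCont_tendsto_compose[OF contR, of snd t\<^sub>0]
      tendsto_fst[OF tendsto_ident_at, of "(s\<^sub>0, t\<^sub>0)" UNIV] tendsto_snd[OF tendsto_ident_at, of "(s\<^sub>0, t\<^sub>0)" UNIV]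
    by (intro tendsto_matrix_mult) simp_all
  moreover have "symplectic (F (s\<^sub>0, t\<^sub>0))"
    unfolding F_def by (intro symplectic_mult monotone_path_symplectic P R)
  ultimately obtain c e where ce: "e > 0" "\<And>p. dist p (s\<^sub>0, t\<^sub>0) < e \<Longrightarrow> invertible (chart_den c (bracket (F p)))"
    using local_common_chart[OF _ _ symplectic_mat_1] by metis
  define d where "d = e / 2"
  have d: "d > 0" using ce(1) by (simp add: d_def)
  have inv: "invertible (chart_den c (bracket (P s ** R t)))" if "\<bar>s - s\<^sub>0\<bar> < d" "\<bar>t - t\<^sub>0\<bar> < d" for s t
  proof -
    have "dist (s, t) (s\<^sub>0, t\<^sub>0) \<le> \<bar>s - s\<^sub>0\<bar> + \<bar>t - t\<^sub>0\<bar>"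
      unfolding dist_Pair_Pair by (rule order_trans[OF sqrt_sum_squares_le_sum_abs]) (simp add: dist_real_def)
    then have "invertible (chart_den c (bracket (F (s, t))))" using that by (intro ce(2)) (simp add: d_def)
    then show ?thesis by (simp add: F_def)
  qed
  define h where "h s t = - int (neg_inertia (chart c (bracket (P s ** R t))))" for s t
  have "row_jumps s s' t = h s' t - h s t" if "s \<le> s'" "\<bar>s - s\<^sub>0\<bar> < d" "\<bar>s' - s\<^sub>0\<bar> < d" "\<bar>t - t\<^sub>0\<bar> < d" for s s' t
    unfolding h_def
    by (subst focal_jumps_chart(2)[OF product_paths(1) that(1)]) (use that in \<open>auto intro!: inv\<close>)
  moreover have "col_jumps s t t' = h s t' - h s t" if "t \<le> t'" "\<bar>s - s\<^sub>0\<bar> < d" "\<bar>t - t\<^sub>0\<bar> < d" "\<bar>t' - t\<^sub>0\<bar> < d" for s t t'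
    unfolding h_def
    by (subst focal_jumps_chart(2)[OF product_paths(2) that(1)]) (use that in \<open>auto intro!: inv\<close>)
  moreover have "diag_jumps u v = h v v - h u u" if "s\<^sub>0 = t\<^sub>0" "u \<le> v" "\<bar>u - t\<^sub>0\<bar> < d" "\<bar>v - t\<^sub>0\<bar> < d" for u v
    unfolding h_def
    by (subst focal_jumps_chart(2)[OF product_paths(3) that(2)]) (use that in \<open>auto intro!: inv\<close>)
  ultimately show ?thesis using d by (intro exI[of _ h] exI[of _ d] conjI allI impI) simp_all
qed

text \<open>
  Homotopy invariance of the crossing number. Small rectangles have equal crossing numbers along
  both pairs of edges because of the local potential; subdividing in one direction for a fixed
  value of the other and then in the other direction reaches every rectangle.
\<close>

lemma rectangle_jumps:
  assumes "s \<le> s'" "t \<le> t'"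
  shows "row_jumps s s' t + col_jumps s' t t' = col_jumps s t t' + row_jumps s s' t'"
proof -
  define C where "C s s' t t' \<longleftrightarrow> row_jumps s s' t + col_jumps s' t t' = col_jumps s t t' + row_jumps s s' t'"
    for s s' t t'
  have "C s s' t t'"
    using assms(2)
  proof (induction rule: Bolzano)
    case (trans a b c)
    then show ?case
      using focal_jumps_concat[OF product_paths(2) \<open>a \<le> b\<close> \<open>b \<le> c\<close>] by (simp add: C_def)
  next
    case (local t\<^sub>0)
    \<comment> \<open>The existential quantifier over \<open>d\<close> inside \<open>D\<close> supplies a height that works along the whole
      segment from \<open>s\<close> to \<open>s'\<close>.\<close>
    define D where "D a b \<longleftrightarrow> (\<exists>d>0. \<forall>t t'. t \<le> t\<^sub>0 \<and> t\<^sub>0 \<le> t' \<and> t' - t < d \<longrightarrow> C a b t t')" for a b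
    have "D s s'"
      using assms(1)
    proof (induction rule: Bolzano)
      case (trans a b c)
      obtain d1 where d1: "d1 > 0" "\<And>t t'. t \<le> t\<^sub>0 \<and> t\<^sub>0 \<le> t' \<and> t' - t < d1 \<Longrightarrow> C a b t t'"
        using trans unfolding D_def by blast
      obtain d2 where d2: "d2 > 0" "\<And>t t'. t \<le> t\<^sub>0 \<and> t\<^sub>0 \<le> t' \<and> t' - t < d2 \<Longrightarrow> C b c t t'"
        using trans unfolding D_def by blast
      have "C a c t t'" if "t \<le> t\<^sub>0 \<and> t\<^sub>0 \<le> t' \<and> t' - t < min d1 d2" for t t'
        using d1(2)[of t t'] d2(2)[of t t'] that focal_jumps_concat[OF product_paths(1) \<open>a \<le> b\<close> \<open>b \<le> c\<close>]
        by (simp add: C_def)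
      then show ?case unfolding D_def using d1(1) d2(1) by (intro exI[of _ "min d1 d2"]) simp
    next
      case (local s\<^sub>0)
      obtain h d where hd: "d > 0"
        "\<forall>s s' t. s \<le> s' \<and> \<bar>s - s\<^sub>0\<bar> < d \<and> \<bar>s' - s\<^sub>0\<bar> < d \<and> \<bar>t - t\<^sub>0\<bar> < d \<longrightarrow> row_jumps s s' t = h s' t - h s t"
        "\<forall>s t t'. t \<le> t' \<and> \<bar>s - s\<^sub>0\<bar> < d \<and> \<bar>t - t\<^sub>0\<bar> < d \<and> \<bar>t' - t\<^sub>0\<bar> < d \<longrightarrow> col_jumps s t t' = h s t' - h s t"
        using local_product_potential[of s\<^sub>0 t\<^sub>0] by (elim exE conjE) (rule that)
      have "C a b t t'" if "a \<le> s\<^sub>0 \<and> s\<^sub>0 \<le> b \<and> b - a < d" "t \<le> t\<^sub>0 \<and> t\<^sub>0 \<le> t' \<and> t' - t < d" for a b t t'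
      proof -
        have near: "a \<le> b" "t \<le> t'" "\<bar>a - s\<^sub>0\<bar> < d" "\<bar>b - s\<^sub>0\<bar> < d" "\<bar>t - t\<^sub>0\<bar> < d" "\<bar>t' - t\<^sub>0\<bar> < d"
          using that by linarith+
        show ?thesis
          unfolding C_def
          using hd(2)[rule_format, of a b t] hd(2)[rule_format, of a b t'] hd(3)[rule_format, of t t' a]
            hd(3)[rule_format, of t t' b] near by linarith
      qed
      then show ?case unfolding D_def using hd(1) by (intro exI[of _ d] conjI allI impI) simp_all
    qed
    then show ?case unfolding D_def .
  qed
  then show ?thesis by (simp add: C_def)
qed

lemma diagonal_jumps_lower_corner:
  assumes "s \<le> t"
  shows "diag_jumps s t = row_jumps s t s + col_jumps t s t"
  using assms
proof (induction rule: Bolzano)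
  case (trans a b c)
  then show ?case
    using focal_jumps_concat[OF product_paths(3) \<open>a \<le> b\<close> \<open>b \<le> c\<close>]
      focal_jumps_concat[OF product_paths(2)[of c] \<open>a \<le> b\<close> \<open>b \<le> c\<close>]
      focal_jumps_concat[OF product_paths(1)[of a] \<open>a \<le> b\<close> \<open>b \<le> c\<close>] rectangle_jumps[OF \<open>b \<le> c\<close> \<open>a \<le> b\<close>]
    by linarith
next
  case (local t\<^sub>0)
  obtain h d where hd: "d > 0"
    "\<forall>s s' t. s \<le> s' \<and> \<bar>s - t\<^sub>0\<bar> < d \<and> \<bar>s' - t\<^sub>0\<bar> < d \<and> \<bar>t - t\<^sub>0\<bar> < d \<longrightarrow> row_jumps s s' t = h s' t - h s t"
    "\<forall>s t t'. t \<le> t' \<and> \<bar>s - t\<^sub>0\<bar> < d \<and> \<bar>t - t\<^sub>0\<bar> < d \<and> \<bar>t' - t\<^sub>0\<bar> < d \<longrightarrow> col_jumps s t t' = h s t' - h s t"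
    "\<forall>u v. t\<^sub>0 = t\<^sub>0 \<and> u \<le> v \<and> \<bar>u - t\<^sub>0\<bar> < d \<and> \<bar>v - t\<^sub>0\<bar> < d \<longrightarrow> diag_jumps u v = h v v - h u u"
    using local_product_potential[of t\<^sub>0 t\<^sub>0] by (elim exE conjE) (rule that)
  show ?case
  proof (intro exI[of _ d] conjI[OF hd(1)] allI impI)
    fix a b assume "a \<le> t\<^sub>0 \<and> t\<^sub>0 \<le> b \<and> b - a < d"
    then have near: "a \<le> b" "\<bar>a - t\<^sub>0\<bar> < d" "\<bar>b - t\<^sub>0\<bar> < d" by linarith+
    then show "diag_jumps a b = row_jumps a b a + col_jumps b a b"
      using hd(2)[rule_format, of a b a] hd(3)[rule_format, of a b b] hd(4)[rule_format, of a b] by linarith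
  qed
qed

text \<open>
  The diagonal of a square can be deformed into either pair of adjacent edges: \<open>p\<close> is the value of
  the first parameter while the second one moves, and \<open>q\<close> the value of the second parameter while
  the first one moves.
\<close>

lemma diagonal_jumps:
  assumes "s \<le> t" and corner: "(p, q) = (s, t) \<or> (p, q) = (t, s)"
  shows "diag_jumps s t = col_jumps p s t + row_jumps s t q"
  using corner diagonal_jumps_lower_corner[OF assms(1)] rectangle_jumps[OF assms(1) assms(1)] by auto

end

section \<open>Moving one coefficient at a time\<close>

lemma matrix_inv_unique:
  fixes A X :: "real^'n^'n"
  assumes "A ** X = mat 1"
  shows "matrix_inv A = X"
proof -
  have "invertible A" using assms invertible_right_inverse by blast
  then have "matrix_inv A = matrix_inv A ** (A ** X)" using assms by simp
  also have "\<dots> = X" using matrix_inv(2)[OF \<open>invertible A\<close>] by (simp add: matrix_mul_assoc)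
  finally show ?thesis .
qed

lemma matrix_inv_mult:
  fixes A B :: "real^'n^'n"
  assumes "invertible A" "invertible B"
  shows "matrix_inv (A ** B) = matrix_inv B ** matrix_inv A"
proof (rule matrix_inv_unique)
  have "A ** B ** (matrix_inv B ** matrix_inv A) = A ** (B ** matrix_inv B) ** matrix_inv A"
    by (simp add: matrix_mul_assoc)
  then show "A ** B ** (matrix_inv B ** matrix_inv A) = mat 1" by (simp add: matrix_inv assms)
qed

lemma matrix_inv_matrix_inv: "invertible A \<Longrightarrow> matrix_inv (matrix_inv A) = A" for A :: "real^'n^'n"
  by (intro matrix_inv_unique matrix_inv)

lemma matrix_inv_cancel:
  fixes A :: "real^'n^'n" and C :: "real^'n^'m"
  assumes "invertible A"
  shows "C ** matrix_inv A ** A = C"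
  by (simp add: matrix_inv assms flip: matrix_mul_assoc)

lemma jumps_const: "jumps (\<lambda>u. n) s t = 0"
proof -
  have "drop_at (\<lambda>u. n) u = 0" for u using drop_at_eq[of "\<lambda>u. n" n u] by simp
  then show ?thesis by (simp add: jumps_def)
qed

lemma monotone_path_fund0:
  "(\<And>k. k < K \<Longrightarrow> monotone_path (S k)) \<Longrightarrow> monotone_path (\<lambda>t. fund0 S t K)"
proof (induction K)
  case 0
  then show ?case by (simp add: monotone_path_const symplectic_mat_1)
next
  case (Suc K)
  then show ?case by (simp add: monotone_path_mult)
qed

lemma symplectic_fund0: "(\<And>k. k < K \<Longrightarrow> monotone_path (S k)) \<Longrightarrow> symplectic (fund0 S t K)"
  using monotone_path_fund0 monotone_path_symplectic by blast

text \<open>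
  All factors of the product are moved from \<open>a\<close> to \<open>b\<close> one after another instead of together. While
  factor \<open>k\<close> moves, the factors to its left stay at \<open>p\<close> and those to its right at \<open>q\<close>.
\<close>

lemma staircase_jumps:
  assumes "symplectic A" "a \<le> b" "(p, q) = (a, b) \<or> (p, q) = (b, a)" "\<And>k. k < K \<Longrightarrow> monotone_path (S k)"
  shows "jumps (focal_rank (\<lambda>u. A ** fund0 S u K)) a b = (\<Sum>k<K. jumps (focal_rank
    (\<lambda>u. A ** (fund0 S p K ** matrix_inv (fund0 S p (Suc k))) ** S k u ** fund0 S q k)) a b)"
  using assms(1,4)
proof (induction K arbitrary: A)
  case 0
  then show ?case by (simp add: jumps_const)
next
  case (Suc K)
  have mono: "monotone_path (S k)" if "k \<le> K" for k using Suc.prems(2) that by simp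
  have P: "monotone_path (\<lambda>u. A ** S K u)"
    by (intro monotone_path_mult monotone_path_const Suc.prems(1) mono) simp
  have R: "monotone_path (\<lambda>u. fund0 S u K)" by (rule monotone_path_fund0) (simp add: mono)
  have inv: "invertible (fund0 S p (Suc K))"
    by (intro symplectic_imp_invertible symplectic_fund0 mono) simp
  have "jumps (focal_rank (\<lambda>u. A ** fund0 S u (Suc K))) a b
      = jumps (focal_rank (\<lambda>u. A ** S K u ** fund0 S u K)) a b"
    by (simp add: matrix_mul_assoc)
  also have "\<dots> = jumps (focal_rank (\<lambda>u. A ** S K p ** fund0 S u K)) a b
      + jumps (focal_rank (\<lambda>u. A ** S K u ** fund0 S q K)) a b"
    by (rule diagonal_jumps[OF P R \<open>a \<le> b\<close> assms(3)])
  also have "jumps (focal_rank (\<lambda>u. A ** S K p ** fund0 S u K)) a b = (\<Sum>k<K. jumps (focal_rank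
      (\<lambda>u. A ** S K p ** (fund0 S p K ** matrix_inv (fund0 S p (Suc k))) ** S k u ** fund0 S q k)) a b)"
    by (rule Suc.IH) (use monotone_path_symplectic[OF P] mono in simp_all)
  also have "\<dots> = (\<Sum>k<K. jumps (focal_rank
      (\<lambda>u. A ** (fund0 S p (Suc K) ** matrix_inv (fund0 S p (Suc k))) ** S k u ** fund0 S q k)) a b)"
    by (simp add: matrix_mul_assoc)
  also have "jumps (focal_rank (\<lambda>u. A ** S K u ** fund0 S q K)) a b = jumps (focal_rank
      (\<lambda>u. A ** (fund0 S p (Suc K) ** matrix_inv (fund0 S p (Suc K))) ** S K u ** fund0 S q K)) a b"
    by (simp only: matrix_inv[OF inv] matrix_mul_rid)
  finally show ?case by simp
qed

lemma step_on_relative: "monotone_path Z \<Longrightarrow> a \<le> b \<Longrightarrow> step_on (\<lambda>u. rank (Z a - Z u)) a b"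
  using crossing_formula monotone_path_symplectic by blast

text \<open>
  The crossing formula for the graph of \<open>L Z(u) R\<close> and its own initial position, at which the
  comparative index vanishes. The multipliers do not affect \<open>rank (Z a - Z u)\<close>.
\<close>

lemma coefficient_jumps:
  assumes Z: "monotone_path Z" and L: "symplectic L" and R: "symplectic R" and ab: "a \<le> b"
  shows "jumps (focal_rank (\<lambda>u. L ** Z u ** R)) a b =
    int (comp_index (bracket (L ** Z b ** R)) (bracket (L ** Z a ** R))) + jumps (\<lambda>u. rank (Z a - Z u)) a b"
proof -
  have path: "monotone_path (\<lambda>u. L ** Z u ** R)"
    by (intro monotone_path_mult monotone_path_const L R Z)
  note sym = monotone_path_symplectic[OF path, of a]
  have "L ** Z a ** R - L ** Z u ** R = L ** (Z a - Z u) ** R" for u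
    by (simp add: matrix_diff_ldistrib matrix_diff_rdistrib)
  then have "rank (L ** Z a ** R - L ** Z u ** R) = rank (Z a - Z u)" for u
    by (simp add: rank_mult_invertible rank_invertible_mult symplectic_imp_invertible L R)
  then show ?thesis
    using crossing_formula[OF path sym ab] comp_index_self[OF sym] by simp
qed

section \<open>Finite eigenvalues and comparative indices\<close>

lemma sum_drops_eq_sum_jumps:
  fixes N :: nat
  assumes r: "\<And>k. k \<le> N \<Longrightarrow> step_on (r k) a b"
  shows "(\<Sum>u\<in>{u. a < u \<and> u \<le> b \<and> (\<Sum>k\<le>N. drop_at (r k) u) \<noteq> 0}. \<Sum>k\<le>N. drop_at (r k) u)
    = (\<Sum>k\<le>N. jumps (r k) a b)"
proof -
  define U where "U = (\<Union>k\<le>N. {u. a < u \<and> u \<le> b \<and> drop_at (r k) u \<noteq> 0})"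
  have U: "finite U" unfolding U_def
  proof (rule finite_UN_I)
    show "finite {..N}" by simp
    show "finite {u. a < u \<and> u \<le> b \<and> drop_at (r k) u \<noteq> 0}" if "k \<in> {..N}" for k
      using r[of k] that by (simp add: step_on_def)
  qed
  have "(\<Sum>u\<in>{u. a < u \<and> u \<le> b \<and> (\<Sum>k\<le>N. drop_at (r k) u) \<noteq> 0}. \<Sum>k\<le>N. drop_at (r k) u)
      = (\<Sum>u\<in>U. \<Sum>k\<le>N. drop_at (r k) u)"
  proof (rule sum.mono_neutral_left[OF U])
    show "{u. a < u \<and> u \<le> b \<and> (\<Sum>k\<le>N. drop_at (r k) u) \<noteq> 0} \<subseteq> U"
      unfolding U_def by (auto elim!: sum.not_neutral_contains_not_neutral)
  qed (auto simp: U_def)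
  also have "\<dots> = (\<Sum>k\<le>N. \<Sum>u\<in>U. drop_at (r k) u)" by (rule sum.swap)
  also have "\<dots> = (\<Sum>k\<le>N. jumps (r k) a b)"
    unfolding jumps_def
    by (intro sum.cong refl sum.mono_neutral_right U) (auto simp: U_def)
  finally show ?thesis .
qed

lemma upper_principal: "upper (principal S l t k) = block12 (fund S l t k)"
  by (simp add: upper_def principal_def block12_def vec_eq_iff matrix_matrix_mult_def sum_UNIV_sum_type
      vstack_def mat_def if_distrib[where f = "\<lambda>x. _ * x"] cong: if_cong)

lemma fund_0: "fund S 0 t k = fund0 S t k"
  by (simp add: fund_def matrix_inv_unique[OF matrix_mul_lid])

lemma eig_count_eq_jumps:
  assumes "step_on (focal_rank (\<lambda>t. fund0 S t (Suc N))) a b"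
  shows "eig_count S N a b = jumps (focal_rank (\<lambda>t. fund0 S t (Suc N))) a b"
proof -
  have mult: "eig_mult S N = drop_at (focal_rank (\<lambda>t. fund0 S t (Suc N)))"
    by (simp add: fun_eq_iff eig_mult_def rank_drop_def rank_left_def drop_at_def upper_principal fund_0)
  have "{\<nu> \<in> finite_eigs S N. a < \<nu> \<and> \<nu> \<le> b} =
      {u. a < u \<and> u \<le> b \<and> drop_at (focal_rank (\<lambda>t. fund0 S t (Suc N))) u \<noteq> 0}"
    using drop_at_nonneg[OF assms] by (force simp: finite_eigs_def mult)
  then show ?thesis by (simp add: eig_count_def jumps_def mult)
qed

context
  fixes S :: "nat \<Rightarrow> real \<Rightarrow> real^('n::finite + 'n)^('n + 'n)" and N :: nat and a b :: real
  assumes mono: "\<And>k. k \<le> N \<Longrightarrow> monotone_path (S k)" and ab: "a \<le> b"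
begin

abbreviation coefficient_defect :: "nat \<Rightarrow> int"
  where "coefficient_defect k \<equiv> jumps (\<lambda>t. rank (S k a - S k t)) a b"

lemma invertible_S: "k \<le> N \<Longrightarrow> invertible (S k t)"
  by (intro symplectic_imp_invertible monotone_path_symplectic mono)

lemma fund0_facts:
  assumes "k \<le> Suc N"
  shows "symplectic (fund0 S t k)" "invertible (fund0 S t k)"
  using symplectic_fund0[of k S t] mono assms symplectic_imp_invertible by auto

lemma fund_facts:
  assumes "k \<le> Suc N" "l \<le> Suc N"
  shows "symplectic (fund S l t k)" "matrix_inv (fund S l t k) = fund0 S t l ** matrix_inv (fund0 S t k)"
proof -
  show "symplectic (fund S l t k)"
    unfolding fund_def by (intro symplectic_mult symplectic_matrix_inv fund0_facts assms)
  show "matrix_inv (fund S l t k) = fund0 S t l ** matrix_inv (fund0 S t k)"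
    unfolding fund_def
    by (simp add: matrix_inv_mult matrix_inv_matrix_inv invertible_matrix_inv fund0_facts assms)
qed

lemma fund0_step_back: "k \<le> N \<Longrightarrow> matrix_inv (fund0 S t (Suc k)) ** S k t = matrix_inv (fund0 S t k)"
  by (simp add: matrix_inv_mult invertible_S fund0_facts matrix_inv_cancel)

text \<open>
  The finite eigenvalues are the crossings of the graph of the product of all coefficients with the
  vertical subspace; each step of the staircase contributes a comparative index and the defect of
  one coefficient.
\<close>

lemma eig_count_eq_staircase:
  assumes corner: "(p, q) = (a, b) \<or> (p, q) = (b, a)"
  defines "L \<equiv> \<lambda>k. fund0 S p (Suc N) ** matrix_inv (fund0 S p (Suc k))"
  shows "eig_count S N a b = (\<Sum>k\<le>N. int (comp_index (bracket (L k ** S k b ** fund0 S q k))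
    (bracket (L k ** S k a ** fund0 S q k)))) + (\<Sum>k\<le>N. coefficient_defect k)"
proof -
  have path: "monotone_path (\<lambda>t. fund0 S t (Suc N))" by (rule monotone_path_fund0) (simp add: mono)
  have "eig_count S N a b = jumps (focal_rank (\<lambda>t. mat 1 ** fund0 S t (Suc N))) a b"
    by (simp only: matrix_mul_lid) (rule eig_count_eq_jumps[OF focal_step_on[OF path ab]])
  also have "\<dots> = (\<Sum>k<Suc N. jumps (focal_rank (\<lambda>u. mat 1 ** L k ** S k u ** fund0 S q k)) a b)"
    unfolding L_def by (rule staircase_jumps[OF symplectic_mat_1 ab corner]) (simp add: mono)
  also have "\<dots> = (\<Sum>k\<le>N. jumps (focal_rank (\<lambda>u. L k ** S k u ** fund0 S q k)) a b)"
    by (simp only: matrix_mul_lid lessThan_Suc_atMost)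
  also have "\<dots> = (\<Sum>k\<le>N. int (comp_index (bracket (L k ** S k b ** fund0 S q k))
    (bracket (L k ** S k a ** fund0 S q k))) + coefficient_defect k)"
  proof (rule sum.cong[OF refl])
    fix k assume "k \<in> {..N}"
    then have k: "k \<le> N" "k \<le> Suc N" "Suc k \<le> Suc N" by auto
    show "jumps (focal_rank (\<lambda>u. L k ** S k u ** fund0 S q k)) a b =
      int (comp_index (bracket (L k ** S k b ** fund0 S q k)) (bracket (L k ** S k a ** fund0 S q k)))
      + coefficient_defect k"
      unfolding L_def
      by (intro coefficient_jumps mono k symplectic_mult symplectic_matrix_inv fund0_facts order_refl ab)
  qed
  finally show ?thesis by (simp add: sum.distrib)
qed

text \<open>
  At the two ends of step \<open>k\<close> the path is at consecutive members of the sequence that is formed from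
  the fundamental matrices at \<open>p\<close> and \<open>q\<close>. Hence the order of the factors decides which of
  the two sums of comparative indices arises.
\<close>

lemma staircase_corners:
  assumes "k \<le> N"
  shows "fund0 S p (Suc N) ** matrix_inv (fund0 S p (Suc k)) ** S k q ** fund0 S q k
      = matrix_inv (fund S (Suc N) p (Suc k)) ** fund S 0 q (Suc k)"
    and "fund0 S p (Suc N) ** matrix_inv (fund0 S p (Suc k)) ** S k p ** fund0 S q k
      = matrix_inv (fund S (Suc N) p k) ** fund S 0 q k"
proof -
  have k: "k \<le> Suc N" "Suc k \<le> Suc N" using assms by auto
  show "fund0 S p (Suc N) ** matrix_inv (fund0 S p (Suc k)) ** S k q ** fund0 S q k
      = matrix_inv (fund S (Suc N) p (Suc k)) ** fund S 0 q (Suc k)"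
    unfolding fund_facts(2)[OF k(2) order_refl] fund_0 by (simp add: matrix_mul_assoc)
  show "fund0 S p (Suc N) ** matrix_inv (fund0 S p (Suc k)) ** S k p ** fund0 S q k
      = matrix_inv (fund S (Suc N) p k) ** fund S 0 q k"
    unfolding fund_facts(2)[OF k(1) order_refl] fund_0 fund0_step_back[OF assms, symmetric]
    by (simp only: matrix_mul_assoc)
qed

lemma eig_count_eq_Ld:
  "eig_count S N a b = int (Ld (fund S (Suc N) a) (fund S 0 b) N) + (\<Sum>k\<le>N. coefficient_defect k)"
  using eig_count_eq_staircase[of a b]
  by (simp add: Ld_def staircase_corners del: fund0.simps(2) cong: sum.cong_simp)

lemma eig_count_eq_Ld_star:
  "eig_count S N a b = int (Ld_star (fund S 0 a) (fund S (Suc N) b) N) + (\<Sum>k\<le>N. coefficient_defect k)"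
  using eig_count_eq_staircase[of b a]
  by (simp add: Ld_star_def staircase_corners del: fund0.simps(2) cong: sum.cong_simp)

text \<open>
  The transformed coefficients start at the identity for parameter \<open>a\<close>, so each of them is a single
  application of the crossing formula.
\<close>

lemma focal_sum_eq_comp_sum:
  assumes l: "l \<le> Suc N"
  shows "focal_sum S N l a b = int (comp_sum S N l a b) + (\<Sum>k\<le>N. coefficient_defect k)"
proof -
  have path: "monotone_path (transformed S l a k)" 
    and jump: "jumps (focal_rank (transformed S l a k)) a b =
      int (comp_index (bracket (transformed S l a k b)) (bracket (mat 1))) + coefficient_defect k"
    if k: "k \<le> N" for k
  proof -
    have k': "k \<le> Suc N" "Suc k \<le> Suc N" using k by auto
    have L: "symplectic (matrix_inv (fund S l a (Suc k)))" and R: "symplectic (fund S l a k)"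
      by (intro symplectic_matrix_inv fund_facts k' l)+
    show "monotone_path (transformed S l a k)"
      unfolding transformed_def[abs_def]
      by (intro monotone_path_mult monotone_path_const L R mono k)
    have "transformed S l a k a = matrix_inv (fund S l a (Suc k)) ** fund S l a (Suc k)"
      unfolding transformed_def fund_Suc by (simp add: matrix_mul_assoc)
    also have "\<dots> = mat 1"
      by (intro matrix_inv symplectic_imp_invertible fund_facts k' l)
    finally have "transformed S l a k a = mat 1" .
    then show "jumps (focal_rank (transformed S l a k)) a b =
      int (comp_index (bracket (transformed S l a k b)) (bracket (mat 1))) + coefficient_defect k"
      using coefficient_jumps[OF mono[OF k] L R ab] by (simp add: transformed_def)
  qed
  have n_Z: "n_Z S N l a u = (\<Sum>k\<le>N. drop_at (focal_rank (transformed S l a k)) u)" for u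
    by (simp add: n_Z_def rank_drop_def rank_left_def drop_at_def)
  have "focal_sum S N l a b = (\<Sum>k\<le>N. jumps (focal_rank (transformed S l a k)) a b)"
    unfolding focal_sum_def n_Z by (rule sum_drops_eq_sum_jumps) (intro focal_step_on path ab)
  also have "\<dots> = (\<Sum>k\<le>N. int (comp_index (bracket (transformed S l a k b)) (bracket (mat 1))) + coefficient_defect k)"
    by (intro sum.cong refl jump) simp
  finally show ?thesis by (simp add: comp_sum_def sum.distrib)
qed

text \<open>
  The graph of the identity meets the vertical subspace in dimension \<open>n\<close>, so its \<open>x\<close>-part has
  rank \<open>n\<close> only.
\<close>

lemma comp_sum_le:
  assumes l: "l \<le> Suc N"
  shows "comp_sum S N l a b \<le> CARD('n) * (N + 1)"
proof -
  have "comp_index (bracket (transformed S l a k b)) (bracket (mat 1)) \<le> CARD('n)" if k: "k \<le> N" for k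
  proof -
    have k': "k \<le> Suc N" "Suc k \<le> Suc N" using k by auto
    have "symplectic (transformed S l a k b)"
      unfolding transformed_def
      by (intro symplectic_mult symplectic_matrix_inv fund_facts k' l monotone_path_symplectic mono k)
    then have "comp_index (bracket (transformed S l a k b)) (bracket (mat 1))
        \<le> rank (upper (bracket (mat 1 :: real^('n + 'n)^('n + 'n))))"
      by (intro comp_index_le_rank lagrangian_frame_bracket symplectic_mat_1)
    also have "\<dots> = CARD('n)"
    proof -
      have "block12 (mat 1 :: real^('n + 'n)^('n + 'n)) = 0"
        by (simp add: block12_def mat_def vec_eq_iff)
      then show ?thesis by (simp add: rank_upper_bracket)
    qed
    finally show ?thesis .
  qed
  then have "comp_sum S N l a b \<le> (\<Sum>k\<le>N. CARD('n))" unfolding comp_sum_def by (intro sum_mono) simp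
  then show ?thesis by (simp add: mult.commute)
qed

lemma coefficient_defect_eq_0_iff:
  "(\<Sum>k\<le>N. coefficient_defect k) = 0 \<longleftrightarrow> (\<forall>\<tau>. a < \<tau> \<and> \<tau> \<le> b \<longrightarrow> (\<forall>k\<le>N. rho S a k \<tau> = 0))"
proof -
  have step: "step_on (\<lambda>t. rank (S k a - S k t)) a b" if "k \<le> N" for k
    by (intro step_on_relative mono that ab)
  have rho: "rho S a k \<tau> = drop_at (\<lambda>t. rank (S k a - S k t)) \<tau>" for k \<tau>
    by (simp add: rho_def rank_drop_def rank_left_def drop_at_def)
  have "(\<Sum>k\<le>N. coefficient_defect k) = 0 \<longleftrightarrow> (\<forall>k\<in>{..N}. coefficient_defect k = 0)"
    by (rule sum_nonneg_eq_0_iff) (simp_all add: jumps_nonneg step)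
  also have "\<dots> \<longleftrightarrow> (\<forall>k\<in>{..N}. \<forall>\<tau>. a < \<tau> \<and> \<tau> \<le> b \<longrightarrow> rho S a k \<tau> = 0)"
    by (simp add: jumps_eq_0_iff[OF step] rho)
  also have "\<dots> \<longleftrightarrow> (\<forall>\<tau>. a < \<tau> \<and> \<tau> \<le> b \<longrightarrow> (\<forall>k\<le>N. rho S a k \<tau> = 0))" by auto
  finally show ?thesis .
qed

end

theorem theorem4p7:
  fixes S :: "nat \<Rightarrow> real \<Rightarrow> real^('n::finite + 'n)^('n + 'n)"
    and N :: nat and a b :: real
  assumes "\<And>k. k \<le> N \<Longrightarrow> C1p (S k)"
    and "\<And>k \<tau>. k \<le> N \<Longrightarrow> symplectic (S k \<tau>)"
    and "\<And>k. k \<le> N \<Longrightarrow> Psi_nonneg (S k)"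
    and "a < b"
  shows "((\<forall>\<tau>. a < \<tau> \<and> \<tau> \<le> b \<longrightarrow> (\<forall>k\<le>N. rho S a k \<tau> = 0)) \<longleftrightarrow>
           (Ld_star (fund S 0 a) (fund S (Suc N) b) N = Ld (fund S (Suc N) a) (fund S 0 b) N \<and>
            int (Ld (fund S (Suc N) a) (fund S 0 b) N) = eig_count S N a b)) \<and>
         (\<forall>l\<in>{0, Suc N}.
           (\<forall>\<tau>. a < \<tau> \<and> \<tau> \<le> b \<longrightarrow> (\<forall>k\<le>N. rho S a k \<tau> = 0)) \<longleftrightarrow>
           (focal_sum S N l a b = int (comp_sum S N l a b) \<and>
            comp_sum S N l a b \<le> CARD('n) * (N + 1)))"
proof -
  have mono: "monotone_path (S k)" if "k \<le> N" for k
    using assms that by (intro monotone_path_of_C1p)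
  have ab: "a \<le> b" using \<open>a < b\<close> by simp
  define \<delta> where "\<delta> = (\<Sum>k\<le>N. jumps (\<lambda>t. rank (S k a - S k t)) a b)"
  have defect: "\<delta> = 0 \<longleftrightarrow> (\<forall>\<tau>. a < \<tau> \<and> \<tau> \<le> b \<longrightarrow> (\<forall>k\<le>N. rho S a k \<tau> = 0))"
    unfolding \<delta>_def by (rule coefficient_defect_eq_0_iff[OF mono ab])
  have "eig_count S N a b = int (Ld (fund S (Suc N) a) (fund S 0 b) N) + \<delta>"
    "eig_count S N a b = int (Ld_star (fund S 0 a) (fund S (Suc N) b) N) + \<delta>"
    unfolding \<delta>_def by (rule eig_count_eq_Ld[OF mono ab] eig_count_eq_Ld_star[OF mono ab], assumption)+
  then have eig: "\<delta> = 0 \<longleftrightarrow>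
      Ld_star (fund S 0 a) (fund S (Suc N) b) N = Ld (fund S (Suc N) a) (fund S 0 b) N \<and>
      int (Ld (fund S (Suc N) a) (fund S 0 b) N) = eig_count S N a b"
    by linarith
  have foc: "\<delta> = 0 \<longleftrightarrow> focal_sum S N l a b = int (comp_sum S N l a b) \<and>
      comp_sum S N l a b \<le> CARD('n) * (N + 1)" if "l \<in> {0, Suc N}" for l
  proof -
    have l: "l \<le> Suc N" using that by auto
    have "focal_sum S N l a b = int (comp_sum S N l a b) + \<delta>"
      unfolding \<delta>_def by (rule focal_sum_eq_comp_sum[OF mono ab l])
    moreover have "comp_sum S N l a b \<le> CARD('n) * (N + 1)"
      by (rule comp_sum_le[OF mono ab l])
    ultimately show ?thesis by auto
  qed
  show ?thesis
    unfolding defect[symmetric] using eig foc by blast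
qed

end
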